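(* Let $G_o$ be a non-compact unimodular lcsc group and let $P_o\subset G_o$ be a subset such that the set $\Lambda:=P_oP_o^{-1}$ is relatively dense in $G_o$ and $\Lambda^3$ is uniformly discrete. Let $\mu$ be a $G_o$-invariant Borel probability measure on $\Omega_{P_o}^\times$ and let $\nu$ be its transverse measure on $\mathcal T_{P_o}$. Let $r\ge1$ be an integer. Then for $\nu^{\otimes r}$-almost all $(Q_1,\dots,Q_r)\in\mathcal T_{P_o}^r$ and every convenient sequence $(G_t)$ in $G_o$ we have $$\underline{\mathrm{Dens}}_{(G_t)}\big(Q_1\cap\dots\cap Q_r\big)>0 .$$
   Context: lcsc = locally compact second countable; $m_{G_o}$ is a Haar measure on $G_o$. $\mathcal C(G_o)$ is the space of closed subsets of $G_o$ with the Chabauty--Fell topology, i.e. the topology generated by the sets $\{P: P\cap K=\emptyset\}$ ($K$ compact) and $\{P: P\cap V\ne\emptyset\}$ ($V$ open); it is compact metrizable, and $G_o$ acts on it jointly continuously by $g.A:=Ag^{-1}$. $\Omega_{P_o}:=\overline{\{P_og^{-1}:g\in G_o\}}$ is the hull of $P_o$, $\Omega_{P_o}^\times:=\Omega_{P_o}\setminus\{\emptyset\}$, and $\mathcal T_{P_o}:=\{Q\in\Omega_{P_o}: e\in Q\}$. $A\subset G_o$ is uniformly discrete if $AA^{-1}\cap U=\{e\}$ for some identity neighbourhood $U$; it is relatively dense if $G_o=KA$ for some compact $K$. $\Lambda^n$ denotes the $n$-fold product set. The transverse measure $\nu$ of $\mu$ is the unique finite Borel measure on $\mathcal T_{P_o}$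 such that for every bounded non-negative Borel function $f$ on $G_o\times\mathcal T_{P_o}$, $$\int \sum_{p\in P} f(p^{-1},p.P)\,d\mu(P)=\int_{G_o}\int_{\mathcal T_{P_o}} f(g,Q)\,d\nu(Q)\,dm_{G_o}(g).$$ Convenient sequences. For a unimodular lcsc group $G$ with Haar measure $m_G$, an open identity neighbourhood $V$ and a pre-compact Borel set $B\subset G$ put $B_V^-:=\bigcap_{v\in V}v^{-1}B$, $B_V^+:=\bigcup_{v\in V}v^{-1}B$. A family $(G_t)$ (indexed by real $t>0$) of pre-compact Borel sets of positive Haar measure is called a convenient sequence if, for some decreasing sequence $(V_n)$ of open identity neighbourhoods: (a) there are sequences $(\delta_n),(\varepsilon_n),(t_n)$ of positive reals with $\delta_n,\varepsilon_n\to0$ such that for all $n$: $G_{t-\delta_n}\subset (G_t)^-_{V_n}\subset (G_t)^+_{V_n}\subset G_{t+\delta_n}$ for all $t>t_n$, and $1-\varepsilon_n\le\liminf_{t\to\infty}\frac{m_G(G_{t-\delta_n})}{m_G(G_t)}$ and $\limsup_{t\to\infty}\frac{m_G(G_{t+\delta_n})}{m_G(G_t)}\le1+\varepsilon_n$; (b) for every standard Borel space $X$ with Borel $G$-action and every bounded real Borel function $\varphi$ on $X$, the set $E_\varphi$ of $x\in X$ for which $\overline\varphi(x):=\lim_{t\to\infty}\frac1{m_G(G_t)}\int_{G_t}\varphi(g.x)\,dm_G(g)$ exists is Borel and is $\mu$-conull for every finite $G$-invariant Borel measure $\mu$ on $X$, the function $\overline\varphi:E_\varphi\to\mathbb R$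 is Borel, and for every $G$-ergodic $G$-invariant Borel probability measure $\mu$ there is a $G$-invariant $\mu$-conull Borel set $E_\varphi(\mu)\subset E_\varphi$ with $\overline\varphi(x)=\int\varphi\,d\mu$ for all $x\in E_\varphi(\mu)$. Lower density: $\underline{\mathrm{Dens}}_{(G_t)}(A):=\liminf_{t\to\infty}\frac{|A\cap G_t|}{m_{G_o}(G_t)}$ for locally finite $A\subset G_o$.
   Formalization: The convenient sequence is fixed first, so the exceptional null set of (Q_1,…,Q_r) may depend on (G_t); a single null set for all convenient sequences is impossible (G_o the integers, Bernoulli μ, G_t enumerating the complement of Q, by the return times theorem). *)

theory Defs
  imports "HOL-Probability.Probability"
begin

text \<open>
  Groups are written additively, although they are not assumed to be commutative: the class
  \<^class>\<open>group_add\<close> has no commutativity axiom.  So \<open>0\<close> is the identity \<open>e\<close>,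
  \<open>g + h\<close> is the product \<open>gh\<close>, \<open>- g\<close> is the inverse and \<open>g - h\<close> is \<open>g h^{-1}\<close>.
  Second countability and the Hausdorff property come from the type classes
  \<^class>\<open>second_countable_topology\<close> and \<^class>\<open>t2_space\<close>; local compactness is stated
  as \<open>locally_compact_space euclidean\<close>.
\<close>

section \<open>Subsets of groups\<close>

text \<open>The set \<open>A A^{-1}\<close>.\<close>

definition difference_set :: "'g::group_add set \<Rightarrow> 'g set" where
  "difference_set A = {a - b | a b. a \<in> A \<and> b \<in> A}"

definition uniformly_discrete :: "'g::{group_add,topological_space} set \<Rightarrow> bool" where
  "uniformly_discrete A \<longleftrightarrow> (\<exists>U. open U \<and> 0 \<in> U \<and> difference_set A \<inter> U = {0})"

text \<open>The sum of two sets is the elementwise sum (here: the product set \<open>KA\<close>).\<close>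

definition relatively_dense :: "'g::{group_add,topological_space} set \<Rightarrow> bool" where
  "relatively_dense A \<longleftrightarrow> (\<exists>K. compact K \<and> K + A = UNIV)"


section \<open>Haar measure\<close>

text \<open>
  On a locally compact second countable group, Borel measures that are finite on compact sets are
  automatically regular.
\<close>

definition left_haar_measure :: "'g::{group_add,topological_space} measure \<Rightarrow> bool" where
  "left_haar_measure m \<longleftrightarrow>
     sets m = sets borel \<and>
     emeasure m UNIV \<noteq> 0 \<and>
     (\<forall>K. compact K \<longrightarrow> emeasure m K < \<infinity>) \<and>
     (\<forall>g. distr m m (\<lambda>x. g + x) = m)"

definition unimodular :: "'g::{group_add,topological_space} itself \<Rightarrow> bool" where
  "unimodular _ \<longleftrightarrow>
     (\<forall>m :: 'g measure. left_haar_measure m \<longrightarrow> (\<forall>g. distr m m (\<lambda>x. x + g) = m))"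


section \<open>Standard Borel spaces and Borel actions\<close>

definition borel_of :: "'x topology \<Rightarrow> 'x measure" where
  "borel_of T = sigma (topspace T) {U. openin T U}"

text \<open>
  Only the carrier and the \<open>\<sigma>\<close>-algebra of the argument matter: the \<open>\<sigma>\<close>-algebra is
  generated by some Polish topology on the carrier.
\<close>

definition standard_borel_space :: "'x measure \<Rightarrow> bool" where
  "standard_borel_space X \<longleftrightarrow>
     (\<exists>T. completely_metrizable_space T \<and> second_countable T \<and>
          space X = topspace T \<and> sets X = sets (borel_of T))"

definition borel_action ::
  "'x measure \<Rightarrow> ('g::{group_add,topological_space} \<Rightarrow> 'x \<Rightarrow> 'x) \<Rightarrow> bool" where
  "borel_action X act \<longleftrightarrow>
     (\<lambda>(g, x). act g x) \<in> (borel \<Otimes>\<^sub>M X) \<rightarrow>\<^sub>M X \<and>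
     (\<forall>x\<in>space X. act 0 x = x) \<and>
     (\<forall>g h. \<forall>x\<in>space X. act (g + h) x = act g (act h x))"

definition invariant_measure :: "('g \<Rightarrow> 'x \<Rightarrow> 'x) \<Rightarrow> 'x measure \<Rightarrow> bool" where
  "invariant_measure act \<mu> \<longleftrightarrow> (\<forall>g. distr \<mu> \<mu> (act g) = \<mu>)"

definition invariant_set :: "('g \<Rightarrow> 'x \<Rightarrow> 'x) \<Rightarrow> 'x set \<Rightarrow> bool" where
  "invariant_set act A \<longleftrightarrow> (\<forall>g. act g ` A = A)"

definition ergodic_measure :: "('g \<Rightarrow> 'x \<Rightarrow> 'x) \<Rightarrow> 'x measure \<Rightarrow> bool" where
  "ergodic_measure act \<mu> \<longleftrightarrow>
     (\<forall>A\<in>sets \<mu>. invariant_set act A \<longrightarrow> emeasure \<mu> A = 0 \<or> emeasure \<mu> (space \<mu> - A) = 0)"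


section \<open>The Chabauty--Fell space and the hull\<close>

text \<open>
  The carrier of this topology consists of the closed sets only (take \<open>K = {}\<close> below).
\<close>

definition chabauty_fell :: "'g::topological_space set topology" where
  "chabauty_fell = topology_generated_by
     ({{P. closed P \<and> P \<inter> K = {}} | K. compact K} \<union>
      {{P. closed P \<and> P \<inter> V \<noteq> {}} | V. open V})"

lemma topspace_chabauty_fell: "topspace chabauty_fell = {P. closed P}"
  unfolding chabauty_fell_def topology_generated_by_topspace by auto

text \<open>The action \<open>g.A = A g^{-1}\<close>.\<close>

definition translate :: "'g::group_add \<Rightarrow> 'g set \<Rightarrow> 'g set" where
  "translate g A = (\<lambda>a. a - g) ` A"

definition orbit_hull :: "'g::{group_add,topological_space} set \<Rightarrow> 'g set set" where
  "orbit_hull P = chabauty_fell closure_of (range (\<lambda>g. translate g P))"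

definition punctured_hull :: "'g::{group_add,topological_space} set \<Rightarrow> 'g set set" where
  "punctured_hull P = orbit_hull P - {{}}"

definition transversal :: "'g::{group_add,topological_space} set \<Rightarrow> 'g set set" where
  "transversal P = {Q \<in> orbit_hull P. 0 \<in> Q}"

definition borel_punctured_hull :: "'g::{group_add,topological_space} set \<Rightarrow> 'g set measure" where
  "borel_punctured_hull P = borel_of (subtopology chabauty_fell (punctured_hull P))"

definition borel_transversal :: "'g::{group_add,topological_space} set \<Rightarrow> 'g set measure" where
  "borel_transversal P = borel_of (subtopology chabauty_fell (transversal P))"

text \<open>
  The defining property of the transverse measure of \<open>\<mu>\<close> with respect to the Haar measure
  \<open>m\<close>.  Integration against the counting measure on \<open>P\<close> is the sum over \<open>p \<in> P\<close>.
\<close>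

definition is_transverse_measure ::
  "'g::{group_add,topological_space} measure \<Rightarrow> 'g set \<Rightarrow> 'g set measure \<Rightarrow> 'g set measure \<Rightarrow> bool"
where
  "is_transverse_measure m P\<^sub>o \<mu> \<nu> \<longleftrightarrow>
     sets \<nu> = sets (borel_transversal P\<^sub>o) \<and> finite_measure \<nu> \<and>
     (\<forall>f :: 'g \<times> 'g set \<Rightarrow> real.
        f \<in> borel_measurable (borel \<Otimes>\<^sub>M borel_transversal P\<^sub>o) \<and>
        (\<exists>C. \<forall>g. \<forall>Q\<in>transversal P\<^sub>o. 0 \<le> f (g, Q) \<and> f (g, Q) \<le> C) \<longrightarrow>
        (\<integral>\<^sup>+ P. (\<integral>\<^sup>+ p. ennreal (f (- p, translate p P)) \<partial>count_space P) \<partial>\<mu>)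
        = (\<integral>\<^sup>+ g. (\<integral>\<^sup>+ Q. ennreal (f (g, Q)) \<partial>\<nu>) \<partial>m))"


section \<open>Convenient sequences and lower density\<close>

text \<open>The sets \<open>B_V^-\<close> and \<open>B_V^+\<close>.\<close>

definition inner_set :: "'g::group_add set \<Rightarrow> 'g set \<Rightarrow> 'g set" where
  "inner_set V B = (\<Inter>v\<in>V. (\<lambda>b. - v + b) ` B)"

definition outer_set :: "'g::group_add set \<Rightarrow> 'g set \<Rightarrow> 'g set" where
  "outer_set V B = (\<Union>v\<in>V. (\<lambda>b. - v + b) ` B)"

definition window_average ::
  "'g::{group_add,topological_space} measure \<Rightarrow> (real \<Rightarrow> 'g set) \<Rightarrow> ('g \<Rightarrow> 'x \<Rightarrow> 'x) \<Rightarrow>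
   ('x \<Rightarrow> real) \<Rightarrow> real \<Rightarrow> 'x \<Rightarrow> real" where
  "window_average m G act \<phi> t x = (LINT g:G t|m. \<phi> (act g x)) / measure m (G t)"

definition convergence_set ::
  "'g::{group_add,topological_space} measure \<Rightarrow> (real \<Rightarrow> 'g set) \<Rightarrow> 'x measure \<Rightarrow>
   ('g \<Rightarrow> 'x \<Rightarrow> 'x) \<Rightarrow> ('x \<Rightarrow> real) \<Rightarrow> 'x set" where
  "convergence_set m G X act \<phi> =
     {x \<in> space X. \<exists>l. ((\<lambda>t. window_average m G act \<phi> t x) \<longlongrightarrow> l) at_top}"

definition limit_average ::
  "'g::{group_add,topological_space} measure \<Rightarrow> (real \<Rightarrow> 'g set) \<Rightarrow> ('g \<Rightarrow> 'x \<Rightarrow> 'x) \<Rightarrow>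
   ('x \<Rightarrow> real) \<Rightarrow> 'x \<Rightarrow> real" where
  "limit_average m G act \<phi> x = Lim at_top (\<lambda>t. window_average m G act \<phi> t x)"

definition boundary_regular ::
  "'g::{group_add,topological_space} measure \<Rightarrow> (real \<Rightarrow> 'g set) \<Rightarrow> (nat \<Rightarrow> 'g set) \<Rightarrow> bool" where
  "boundary_regular m G V \<longleftrightarrow>
     (\<exists>\<delta> \<epsilon> \<tau> :: nat \<Rightarrow> real.
        (\<forall>n. \<delta> n > 0 \<and> \<epsilon> n > 0 \<and> \<tau> n > 0) \<and>
        \<delta> \<longlonglongrightarrow> 0 \<and> \<epsilon> \<longlonglongrightarrow> 0 \<and>
        (\<forall>n.
          (\<forall>t>\<tau> n. G (t - \<delta> n) \<subseteq> inner_set (V n) (G t) \<and>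
                    inner_set (V n) (G t) \<subseteq> outer_set (V n) (G t) \<and>
                    outer_set (V n) (G t) \<subseteq> G (t + \<delta> n)) \<and>
          ereal (1 - \<epsilon> n) \<le> Liminf at_top (\<lambda>t. ereal (measure m (G (t - \<delta> n)) / measure m (G t))) \<and>
          Limsup at_top (\<lambda>t. ereal (measure m (G (t + \<delta> n)) / measure m (G t))) \<le> ereal (1 + \<epsilon> n)))"

definition ergodic_averages_converge ::
  "'g::{group_add,topological_space} measure \<Rightarrow> (real \<Rightarrow> 'g set) \<Rightarrow> 'x measure \<Rightarrow>
   ('g \<Rightarrow> 'x \<Rightarrow> 'x) \<Rightarrow> ('x \<Rightarrow> real) \<Rightarrow> bool" where
  "ergodic_averages_converge m G X act \<phi> \<longleftrightarrow>
     (let E = convergence_set m G X act \<phi>; \<phi>' = limit_average m G act \<phi> in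
       E \<in> sets X \<and>
       (\<forall>\<mu>. sets \<mu> = sets X \<and> finite_measure \<mu> \<and> invariant_measure act \<mu> \<longrightarrow>
             space X - E \<in> null_sets \<mu>) \<and>
       \<phi>' \<in> borel_measurable (restrict_space X E) \<and>
       (\<forall>\<mu>. sets \<mu> = sets X \<and> prob_space \<mu> \<and> invariant_measure act \<mu> \<and> ergodic_measure act \<mu> \<longrightarrow>
             (\<exists>E'\<in>sets X. E' \<subseteq> E \<and> invariant_set act E' \<and> space X - E' \<in> null_sets \<mu> \<and>
               (\<forall>x\<in>E'. \<phi>' x = (\<integral>y. \<phi> y \<partial>\<mu>)))))"

text \<open>
  The family is indexed by \<open>t > 0\<close>; values at other reals are irrelevant, since the conditions
  only concern large \<open>t\<close>.

  A quantifier over all standard Borel spaces cannot range over all types.  Every standard Borel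
  space is Borel isomorphic to one whose points are real numbers, and the condition is invariant
  under equivariant Borel isomorphism, so it suffices to let \<open>X\<close> range over all standard Borel
  spaces carried by sets of reals (any such set with any standard Borel structure).
\<close>

definition convenient_sequence ::
  "'g::{group_add,topological_space} measure \<Rightarrow> (real \<Rightarrow> 'g set) \<Rightarrow> bool" where
  "convenient_sequence m G \<longleftrightarrow>
     (\<forall>t>0. G t \<in> sets borel \<and> compact (closure (G t)) \<and> measure m (G t) > 0) \<and>
     (\<exists>V. (\<forall>n. open (V n) \<and> 0 \<in> V n) \<and> decseq V \<and> boundary_regular m G V) \<and>
     (\<forall>(X :: real measure) act \<phi>.
        standard_borel_space X \<and> borel_action X act \<and>
        \<phi> \<in> borel_measurable X \<and> (\<exists>C. \<forall>x\<in>space X. \<bar>\<phi> x\<bar> \<le> C) \<longrightarrow>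
        ergodic_averages_converge m G X act \<phi>)"

text \<open>
  Only meaningful for locally finite \<open>A\<close> and pre-compact windows, for which \<open>A \<inter> G t\<close> is finite.
\<close>

definition lower_density :: "'g measure \<Rightarrow> (real \<Rightarrow> 'g set) \<Rightarrow> 'g set \<Rightarrow> ereal" where
  "lower_density m G A =
     Liminf at_top (\<lambda>t. ereal (real (card (A \<inter> G t)) / measure m (G t)))"

end

theory Submission
  imports Defs "HOL-Complex_Analysis.Great_Picard"
begin

text \<open>
  Every \<open>Q \<in> \<T>\<close> is contained in \<open>\<Lambda>\<close>, so \<open>Z = Q\<^sub>1 \<inter> \<dots> \<inter> Q\<^sub>r\<close> is a random subset of the
  countable set \<open>L = \<Lambda> + \<Lambda>\<close>.  Shifting the \<open>\<mu>\<close>-random set by the small element, unique if it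
  exists, that makes it meet \<open>\<Lambda>\<close> yields a probability measure on \<open>Pow L\<close> under which the
  pattern events \<open>F \<subseteq> Z\<close> and \<open>F + c \<subseteq> Z\<close> are equiprobable whenever \<open>F\<close> and \<open>F + c\<close> both meet \<open>\<Lambda>\<close>; the law \<open>\<rho>\<close> of the intersection of \<open>r\<close>
  independent copies inherits this property, since its pattern probabilities are \<open>r\<close>-th powers, and
  controls the null sets of \<open>\<nu>\<^sup>r\<close> on \<open>{Z. 0 \<in> Z}\<close>.

  If a bad set of \<open>Z \<ni> 0\<close> had positive \<open>\<rho>\<close>-measure, then so it would for some measure \<open>\<rho>'\<close> that is
  extremal among the measures with the same invariance.  Such a \<open>\<rho>'\<close> induces a finite
  \<open>G\<^sub>o\<close>-invariant measure on the compact space \<open>{Z. Z - Z \<subseteq> \<Lambda>}\<close>, finiteness coming from the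
  relative density of \<open>\<Lambda>\<close> and invariance from mass transport, and extremality makes it ergodic.
  The ergodic theorem for the indicator of \<open>{Z. Z \<inter> V \<noteq> {}}\<close> then gives a positive limit of averages
  for \<open>\<rho>'\<close>-almost every \<open>Z\<close>, and boundary regularity turns it into a positive lower density, so the
  bad set is null after all.
\<close>

section \<open>Measures on the power set of a countable set\<close>

text \<open>The shift in the overview answers an obstacle: independent \<open>\<mu>\<close>-random
  sets need not meet at all, since for fixed P and Q only countably many g make P meet
  \<open>translate g Q\<close>, a Haar null set when points are null. Aligned copies all live on the
  one countable set \<open>L\<close>. The price is that \<open>Pow L\<close> carries no group
  action, only partial translations between sets that meet \<open>\<Lambda>\<close>; hence the side
  conditions on F and F + c.

  The ergodic theorem identifies the limit with the space average only for ergodic measures, and the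
  law of the intersection need not lead to one. An extremal measure that still charges the bad set
  replaces an ergodic decomposition. On \<open>Pow L\<close> invariance is a family of equations
  between probabilities of clopen sets, so it survives limits and the extremal measure arises by
  maximisation. It depends on the bad set, which therefore must be defined without reference to a
  measure: the averages fail to converge to a positive limit.

  The third factor of \<open>\<Lambda>\<close> comes from identities such as -l + ((l - b) - (l' -
  b')) + l' = -b + b': a difference in \<open>\<Lambda>\<close> flanked by two more elements of
  \<open>\<Lambda>\<close>.\<close>

definition pow_measurable :: "'a set \<Rightarrow> 'a set measure" where
  "pow_measurable L = sigma (Pow L) ((\<lambda>l. {Z \<in> Pow L. l \<in> Z}) ` L)"

definition determined :: "'a set \<Rightarrow> 'a set \<Rightarrow> 'a set set \<Rightarrow> bool" where
  "determined L F A \<longleftrightarrow> A \<subseteq> Pow L \<and> (\<forall>x\<in>Pow L. \<forall>y\<in>Pow L. x \<inter> F = y \<inter> F \<longrightarrow> (x \<in> A \<longleftrightarrow> y \<in> A))"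

text \<open>Under the identification of \<open>Pow L\<close> with the product {0,1}^L these are
  exactly its clopen sets, that is, the cylinders over finitely many coordinates.\<close>

definition clopens :: "'a set \<Rightarrow> 'a set set set" where
  "clopens L = {A. \<exists>F. finite F \<and> F \<subseteq> L \<and> determined L F A}"

lemma clopensE:
  assumes "A \<in> clopens L"
  obtains F where "finite F" "F \<subseteq> L" "determined L F A"
  using assms unfolding clopens_def by auto

lemma clopensI: "finite F \<Longrightarrow> F \<subseteq> L \<Longrightarrow> determined L F A \<Longrightarrow> A \<in> clopens L"
  unfolding clopens_def by auto

lemma space_pow_measurable [simp]: "space (pow_measurable L) = Pow L"
  unfolding pow_measurable_def by (auto simp: space_measure_of_conv)

lemma sets_pow_measurable:
  "sets (pow_measurable L) = sigma_sets (Pow L) ((\<lambda>l. {Z \<in> Pow L. l \<in> Z}) ` L)"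
  unfolding pow_measurable_def by (auto intro!: sets_measure_of)

lemma sets_pow_measurable_mem [measurable]: "{Z \<in> Pow L. l \<in> Z} \<in> sets (pow_measurable L)"
proof (cases "l \<in> L")
  case True
  then show ?thesis unfolding sets_pow_measurable by auto
next
  case False
  then have "{Z \<in> Pow L. l \<in> Z} = {}" by auto
  then show ?thesis by (metis sets.empty_sets)
qed

lemma measurable_pow_measurable:
  assumes "\<And>x. x \<in> space M \<Longrightarrow> f x \<subseteq> L" "\<And>l. l \<in> L \<Longrightarrow> {x \<in> space M. l \<in> f x} \<in> sets M"
  shows "f \<in> M \<rightarrow>\<^sub>M pow_measurable L"
  unfolding pow_measurable_def
proof (rule measurable_sigma_sets)
  show "sets (sigma (Pow L) ((\<lambda>l. {Z \<in> Pow L. l \<in> Z}) ` L)) =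
    sigma_sets (Pow L) ((\<lambda>l. {Z \<in> Pow L. l \<in> Z}) ` L)"
    by (auto intro!: sets_measure_of)
  show "f \<in> space M \<rightarrow> Pow L" using assms by auto
  fix y assume "y \<in> (\<lambda>l. {Z \<in> Pow L. l \<in> Z}) ` L"
  then obtain l where l: "l \<in> L" "y = {Z \<in> Pow L. l \<in> Z}" by auto
  then have "f -` y \<inter> space M = {x \<in> space M. l \<in> f x}" using assms(1) by auto
  then show "f -` y \<inter> space M \<in> sets M" using assms(2) l by simp
qed auto

lemma determined_mono:
  assumes "determined L F A" "F \<subseteq> F'"
  shows "determined L F' A"
proof -
  have "x \<inter> F = y \<inter> F" if "x \<inter> F' = y \<inter> F'" for x y
    using that assms(2) by blast
  then show ?thesis using assms(1) unfolding determined_def by metis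
qed

lemma determined_Int: "determined L F A \<Longrightarrow> Z \<in> Pow L \<Longrightarrow> Z \<inter> F \<in> A \<longleftrightarrow> Z \<in> A"
  unfolding determined_def by (metis Int_absorb Int_assoc PowD PowI inf.coboundedI1)

lemma determined_subset: "determined L F A \<Longrightarrow> Z \<in> A \<Longrightarrow> Z \<in> Pow L"
  unfolding determined_def by (rule subsetD, rule conjunct1)

lemma determined_cong:
  "determined L F A \<Longrightarrow> x \<in> Pow L \<Longrightarrow> y \<in> Pow L \<Longrightarrow> x \<inter> F = y \<inter> F \<Longrightarrow> x \<in> A \<longleftrightarrow> y \<in> A"
  unfolding determined_def by metis

lemma determined_cylinder: "determined L F {Z \<in> Pow L. F \<subseteq> Z}"
  unfolding determined_def by blast

lemma clopens_cylinder: "finite F \<Longrightarrow> {Z \<in> Pow L. F \<subseteq> Z} \<in> clopens L"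
proof (cases "F \<subseteq> L")
  case True
  assume "finite F"
  then show ?thesis using determined_cylinder True unfolding clopens_def by blast
next
  case False
  then have "{Z \<in> Pow L. F \<subseteq> Z} = {}" by auto
  then show ?thesis unfolding clopens_def determined_def by auto
qed

lemma clopens_empty: "{} \<in> clopens L"
  unfolding clopens_def determined_def by auto

lemma algebra_clopens: "algebra (Pow L) (clopens L)"
  unfolding algebra_iff_Int
proof (intro conjI ballI)
  show "clopens L \<subseteq> Pow (Pow L)" unfolding clopens_def determined_def by auto
  show "{} \<in> clopens L" by (rule clopens_empty)
next
  fix A assume "A \<in> clopens L"
  then obtain F where F: "finite F" "F \<subseteq> L" "determined L F A"
    unfolding clopens_def by auto
  then have "determined L F (Pow L - A)"
    unfolding determined_def by (intro conjI ballI impI Diff_subset) (metis Diff_iff)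
  then show "Pow L - A \<in> clopens L" using F by (intro clopensI)
next
  fix A B assume "A \<in> clopens L" "B \<in> clopens L"
  then obtain F F' where F: "finite F" "F \<subseteq> L" "determined L F A" "finite F'" "F' \<subseteq> L" "determined L F' B"
    by (meson clopensE)
  have "determined L (F \<union> F') A" "determined L (F \<union> F') B"
    using determined_mono[OF F(3), of "F \<union> F'"] determined_mono[OF F(6), of "F \<union> F'"] by auto
  then have "determined L (F \<union> F') (A \<inter> B)"
    unfolding determined_def by (intro conjI ballI impI le_infI1) (simp, metis Int_iff)
  then show "A \<inter> B \<in> clopens L" using F clopensI[of "F \<union> F'" L] by simp
qed

lemma sigma_sets_clopens:
  assumes "countable L"
  shows "sets (pow_measurable L) = sigma_sets (Pow L) (clopens L)"
proof
  have "{Z \<in> Pow L. l \<in> Z} \<in> clopens L" for l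
    using clopens_cylinder[of "{l}" L] by simp
  then show "sets (pow_measurable L) \<subseteq> sigma_sets (Pow L) (clopens L)"
    unfolding sets_pow_measurable by (intro sigma_sets_mono') auto
next
  have "A \<in> sets (pow_measurable L)" if A: "A \<in> clopens L" for A
  proof -
    obtain F where F: "finite F" "F \<subseteq> L" "determined L F A"
      using A by (rule clopensE)
    have atom: "{Z \<in> Pow L. Z \<inter> F = G} \<in> sets (pow_measurable L)" if "G \<subseteq> F" for G
    proof -
      have "{Z \<in> Pow L. Z \<inter> F = G} =
        {Z \<in> space (pow_measurable L). \<forall>l\<in>F. (Z \<in> {Z \<in> Pow L. l \<in> Z}) = (l \<in> G)}"
        using that by auto
      also have "\<dots> \<in> sets (pow_measurable L)"
        using F(1) by measurable
      finally show ?thesis .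
    qed
    have "A = (\<Union>G\<in>{G. G \<subseteq> F \<and> G \<in> A}. {Z \<in> Pow L. Z \<inter> F = G})"
    proof (intro Set.set_eqI iffI)
      fix Z assume Z: "Z \<in> A"
      then have "Z \<in> Pow L" by (rule determined_subset[OF F(3)])
      moreover from this have "Z \<inter> F \<in> A" using Z determined_Int[OF F(3)] by blast
      ultimately show "Z \<in> (\<Union>G\<in>{G. G \<subseteq> F \<and> G \<in> A}. {Z \<in> Pow L. Z \<inter> F = G})" by auto
    next
      fix Z assume "Z \<in> (\<Union>G\<in>{G. G \<subseteq> F \<and> G \<in> A}. {Z \<in> Pow L. Z \<inter> F = G})"
      then have "Z \<inter> F \<in> A" "Z \<in> Pow L" by auto
      then show "Z \<in> A" using determined_Int[OF F(3)] by blast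
    qed
    also have "\<dots> \<in> sets (pow_measurable L)"
      using F(1) by (intro sets.finite_UN atom) auto
    finally show ?thesis .
  qed
  then show "sigma_sets (Pow L) (clopens L) \<subseteq> sets (pow_measurable L)"
    by (metis sets.sigma_sets_subset space_pow_measurable subsetI)
qed

text \<open>A clopen set is coded by finite data: a finite F that determines it and the finite
  family of traces on F of its members.\<close>

lemma countable_clopens:
  assumes "countable L"
  shows "countable (clopens L)"
proof -
  have "clopens L \<subseteq> (\<lambda>(F, \<G>). {Z \<in> Pow L. Z \<inter> F \<in> \<G>}) `
      ({F. F \<subseteq> L \<and> finite F} \<times> {\<G>. \<G> \<subseteq> {F. F \<subseteq> L \<and> finite F} \<and> finite \<G>})"
  proof
    fix A assume "A \<in> clopens L"
    then obtain F where F: "finite F" "F \<subseteq> L" "determined L F A"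
      unfolding clopens_def by auto
    have "A = {Z \<in> Pow L. Z \<inter> F \<in> (\<lambda>Z. Z \<inter> F) ` A}"
    proof (intro Set.set_eqI iffI)
      fix Z assume "Z \<in> A"
      then show "Z \<in> {Z \<in> Pow L. Z \<inter> F \<in> (\<lambda>Z. Z \<inter> F) ` A}"
        using determined_subset[OF F(3)] by blast
    next
      fix Z assume "Z \<in> {Z \<in> Pow L. Z \<inter> F \<in> (\<lambda>Z. Z \<inter> F) ` A}"
      then obtain Y where "Z \<in> Pow L" "Z \<inter> F = Y \<inter> F" "Y \<in> A" by blast
      then show "Z \<in> A" using determined_cong[OF F(3)] determined_subset[OF F(3)] by blast
    qed
    moreover have "finite ((\<lambda>Z. Z \<inter> F) ` A)"
      by (rule finite_subset[of _ "Pow F"]) (use F in auto)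
    ultimately show "A \<in> (\<lambda>(F, \<G>). {Z \<in> Pow L. Z \<inter> F \<in> \<G>}) `
      ({F. F \<subseteq> L \<and> finite F} \<times> {\<G>. \<G> \<subseteq> {F. F \<subseteq> L \<and> finite F} \<and> finite \<G>})"
      using F by (intro image_eqI[of _ _ "(F, (\<lambda>Z. Z \<inter> F) ` A)"]) auto
  qed
  moreover have "countable {F. F \<subseteq> L \<and> finite F}"
    using countable_Collect_finite_subset[OF assms] by (simp add: conj_commute)
  moreover from this have "countable {\<G>. \<G> \<subseteq> {F. F \<subseteq> L \<and> finite F} \<and> finite \<G>}"
    using countable_Collect_finite_subset[of "{F. F \<subseteq> L \<and> finite F}"] by (simp add: conj_commute)
  ultimately show ?thesis
    by (meson countable_SIGMA countable_image countable_subset)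
qed

text \<open>Compactness of {0,1}^L: a decreasing sequence of nonempty closed sets has a common
  point.\<close>

lemma clopens_decseq_empty:
  assumes "range A \<subseteq> clopens L" "decseq A" "(\<Inter>i. A i) = {}"
  shows "\<exists>i. A i = {}"
proof (rule ccontr)
  assume ne: "\<nexists>i. A i = {}"
  let ?T = "product_topology (\<lambda>_. discrete_topology (UNIV :: bool set)) L"
  let ?e = "\<lambda>Z. \<lambda>l\<in>L. l \<in> Z"
  have comp: "compact_space ?T" by (simp add: compact_space_product_topology compact_space_discrete_topology)
  have ext: "x \<in> topspace ?T \<Longrightarrow> ?e {l \<in> L. x l} = x" for x
    by (auto simp: PiE_def extensional_def fun_eq_iff)
  have "(\<Inter>i. ?e ` A i) \<noteq> {}"
  proof (rule compact_space_imp_nest[OF comp])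
    fix n
    obtain F where F: "finite F" "F \<subseteq> L" "determined L F (A n)"
      using assms(1) by (meson clopensE rangeI subsetD)
    have eq: "?e ` A n = {x \<in> topspace ?T. {l \<in> L. x l} \<in> A n}"
    proof (intro Set.set_eqI iffI)
      fix x assume "x \<in> ?e ` A n"
      then obtain Z where Z: "Z \<in> A n" "x = ?e Z" by blast
      then have "{l \<in> L. x l} = Z" using determined_subset[OF F(3)] by auto
      then show "x \<in> {x \<in> topspace ?T. {l \<in> L. x l} \<in> A n}" using Z by auto
    next
      fix x assume "x \<in> {x \<in> topspace ?T. {l \<in> L. x l} \<in> A n}"
      then have x: "x \<in> topspace ?T" "{l \<in> L. x l} \<in> A n" by blast+
      show "x \<in> ?e ` A n" 
        by (rule image_eqI[where f = ?e and x = "{l \<in> L. x l}"]) (rule ext[OF x(1), symmetric], rule x(2))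
    qed
    have "\<exists>W. openin ?T W \<and> x \<in> W \<and> W \<subseteq> topspace ?T - ?e ` A n"
      if x: "x \<in> topspace ?T - ?e ` A n" for x
    proof -
      let ?W = "PiE L (\<lambda>l. if l \<in> F then {x l} else UNIV)"
      have "{l. (if l \<in> F then {x l} else UNIV) \<noteq> UNIV} \<subseteq> F" by auto
      then have "finite {l. (if l \<in> F then {x l} else UNIV) \<noteq> UNIV}"
        using F(1) by (rule finite_subset)
      then have op: "openin ?T ?W"
        by (intro product_topology_basis) (simp_all only: topspace_discrete_topology openin_discrete_topology subset_UNIV)
      have xW: "x \<in> ?W" using x by (auto simp: PiE_def)
      have yW: "y \<notin> ?e ` A n" if "y \<in> ?W" for y
      proof -
        have "{l \<in> L. y l} \<inter> F = {l \<in> L. x l} \<inter> F" using that F(2)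
          by (auto simp: PiE_def Pi_def split: if_splits)
        then have "{l \<in> L. y l} \<in> A n \<longleftrightarrow> {l \<in> L. x l} \<in> A n"
          by (intro determined_cong[OF F(3)]) auto
        then show ?thesis using x unfolding eq by auto
      qed
      have sub: "?W \<subseteq> topspace ?T" by (auto simp: PiE_def Pi_def)
      have "?W \<subseteq> topspace ?T - ?e ` A n" using sub yW by (meson DiffI subsetD subsetI)
      with op xW show ?thesis by (intro exI[of _ ?W] conjI)
    qed
    then have "openin ?T (topspace ?T - ?e ` A n)"
      by (subst openin_subopen) (rule ballI)
    moreover have "?e ` A n \<subseteq> topspace ?T" unfolding eq by (rule Collect_restrict)
    ultimately show "closedin ?T (?e ` A n)" unfolding closedin_def by (rule conjI[rotated])
    show "?e ` A n \<noteq> {}" using ne by auto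
  next
    show "decseq (\<lambda>i. ?e ` A i)" using assms(2) unfolding decseq_def by blast
  qed
  then obtain x where x: "\<And>i. x \<in> ?e ` A i" by auto
  have "{l \<in> L. x l} \<in> A i" for i
  proof -
    obtain Z where Z: "Z \<in> A i" "x = ?e Z" using x by blast
    moreover have "A i \<in> clopens L" using assms(1) by auto
    ultimately have "Z \<subseteq> L" by (meson clopensE determined_subset PowD)
    then have "{l \<in> L. x l} = Z" using Z by auto
    then show ?thesis using Z by simp
  qed
  then show False using assms(3) by auto
qed

text \<open>Finite additivity suffices for a Caratheodory extension, because by compactness a
  decreasing sequence of clopen sets with empty intersection is eventually empty, so continuity at
  the empty set is automatic.\<close>

lemma prob_extension_clopens:
  fixes c :: "'a set set \<Rightarrow> real"
  assumes L: "countable L"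
    and nonneg: "\<And>A. A \<in> clopens L \<Longrightarrow> c A \<ge> 0"
    and add: "\<And>A B. A \<in> clopens L \<Longrightarrow> B \<in> clopens L \<Longrightarrow> A \<inter> B = {} \<Longrightarrow> c (A \<union> B) = c A + c B"
    and one: "c (Pow L) = 1"
  obtains \<rho> where "sets \<rho> = sets (pow_measurable L)" "prob_space \<rho>"
    "\<And>A. A \<in> clopens L \<Longrightarrow> measure \<rho> A = c A"
proof -
  interpret algebra "Pow L" "clopens L" by (rule algebra_clopens)
  have c0: "c {} = 0" using add[of "{}" "{}"] by simp
  let ?f = "\<lambda>A. ennreal (c A)"
  have "\<exists>\<mu>. (\<forall>s\<in>clopens L. \<mu> s = ?f s) \<and> measure_space (Pow L) (sigma_sets (Pow L) (clopens L)) \<mu>"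
  proof (rule caratheodory_empty_continuous)
    show "positive (clopens L) ?f" using c0 by (simp add: positive_def)
    show "additive (clopens L) ?f" using add nonneg by (auto simp: additive_def ennreal_plus)
    fix A :: "nat \<Rightarrow> _" assume A: "range A \<subseteq> clopens L" "decseq A" "(\<Inter>i. A i) = {}"
    then obtain i where "A i = {}" using clopens_decseq_empty by blast
    then have "\<forall>j\<ge>i. ?f (A j) = 0" using A(2) c0 unfolding decseq_def by (metis ennreal_0 subset_empty)
    then show "(\<lambda>i. ?f (A i)) \<longlonglongrightarrow> 0"
      by (intro tendsto_eventually) (auto simp: eventually_sequentially)
  qed auto
  then obtain \<mu> where \<mu>: "\<And>s. s \<in> clopens L \<Longrightarrow> \<mu> s = ?f s"
    "measure_space (Pow L) (sigma_sets (Pow L) (clopens L)) \<mu>" by auto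
  define \<rho> where "\<rho> = measure_of (Pow L) (clopens L) \<mu>"
  have s: "sets \<rho> = sigma_sets (Pow L) (clopens L)"
    unfolding \<rho>_def by (simp add: space_closed)
  have e: "emeasure \<rho> A = ?f A" if "A \<in> clopens L" for A
    using emeasure_measure_of[OF \<rho>_def space_closed] that \<mu> s by (simp add: measure_space_def)
  show ?thesis
  proof (rule that)
    show "sets \<rho> = sets (pow_measurable L)" unfolding s sigma_sets_clopens[OF L] ..
    then have "space \<rho> = Pow L" by (metis sets_eq_imp_space_eq space_pow_measurable)
    then show "prob_space \<rho>" using e[of "Pow L"] one top by (intro prob_spaceI) simp
    show "measure \<rho> A = c A" if "A \<in> clopens L" for A
      using e[OF that] nonneg[OF that] by (simp add: measure_def)
  qed
qed

text \<open>Sequential weak compactness of the probability measures on \<open>Pow L\<close>: a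
  diagonal subsequence converges on each of the countably many clopen sets, and the limit is
  finitely additive, hence extends to a measure.\<close>

lemma prob_clopens_compactness:
  fixes \<rho> :: "nat \<Rightarrow> 'a set measure"
  assumes L: "countable L"
    and s: "\<And>n. sets (\<rho> n) = sets (pow_measurable L)" and p: "\<And>n. prob_space (\<rho> n)"
  obtains k \<rho>' where "strict_mono (k :: nat \<Rightarrow> nat)" "sets \<rho>' = sets (pow_measurable L)" "prob_space \<rho>'"
    "\<And>A. A \<in> clopens L \<Longrightarrow> (\<lambda>n. measure (\<rho> (k n)) A) \<longlonglongrightarrow> measure \<rho>' A"
proof -
  have bound: "norm (measure (\<rho> n) A) \<le> 1" for n A
    using prob_space.prob_le_1[OF p] by (simp add: measure_nonneg)
  obtain k where k: "strict_mono (k :: nat \<Rightarrow> nat)"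
    "\<And>A. A \<in> clopens L \<Longrightarrow> \<exists>l. (\<lambda>n. measure (\<rho> (k n)) A) \<longlonglongrightarrow> l"
    using function_convergent_subsequence[OF countable_clopens[OF L], of "\<lambda>n A. measure (\<rho> n) A" 1] bound
    by blast
  define c where "c A = lim (\<lambda>n. measure (\<rho> (k n)) A)" for A
  have c: "(\<lambda>n. measure (\<rho> (k n)) A) \<longlonglongrightarrow> c A" if "A \<in> clopens L" for A
    using k(2)[OF that] unfolding c_def by (metis limI)
  interpret algebra "Pow L" "clopens L" by (rule algebra_clopens)
  have cs: "A \<in> sets (\<rho> n)" if "A \<in> clopens L" for A n
    using that s sigma_sets_clopens[OF L] by auto
  have "\<exists>\<rho>'. sets \<rho>' = sets (pow_measurable L) \<and> prob_space \<rho>' \<and> (\<forall>A\<in>clopens L. measure \<rho>' A = c A)"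
  proof (rule prob_extension_clopens[OF L, of c])
    show "c A \<ge> 0" if "A \<in> clopens L" for A
      using c[OF that] by (rule LIMSEQ_le_const) auto
    show "c (A \<union> B) = c A + c B" if AB: "A \<in> clopens L" "B \<in> clopens L" "A \<inter> B = {}" for A B
    proof (rule LIMSEQ_unique)
      show "(\<lambda>n. measure (\<rho> (k n)) (A \<union> B)) \<longlonglongrightarrow> c (A \<union> B)" using AB by (intro c) auto
      have "measure (\<rho> n) (A \<union> B) = measure (\<rho> n) A + measure (\<rho> n) B" for n
      proof -
        interpret prob_space "\<rho> n" by (rule p)
        show ?thesis using AB cs by (intro finite_measure_Union) auto
      qed
      then show "(\<lambda>n. measure (\<rho> (k n)) (A \<union> B)) \<longlonglongrightarrow> c A + c B"
        using tendsto_add[OF c[OF AB(1)] c[OF AB(2)]] by simp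
    qed
    have "measure (\<rho> n) (Pow L) = 1" for n
      using prob_space.prob_space[OF p[of n]] sets_eq_imp_space_eq[OF s[of n]] by simp
    then show "c (Pow L) = 1" using c[OF top] by (simp add: LIMSEQ_const_iff)
  qed blast
  then show ?thesis using that k(1) c by metis
qed

text \<open>Inner regularity by compact sets, with the compact set written as a decreasing
  intersection of clopen sets. This is the form that behaves well under limits of measures that
  converge on clopen sets only.\<close>

lemma clopens_inner_regular:
  assumes L: "countable L" and s: "sets \<rho> = sets (pow_measurable L)" and p: "prob_space \<rho>"
    and B: "B \<in> sets \<rho>" "measure \<rho> B > 0"
  obtains C :: "nat \<Rightarrow> 'a set set" where "range C \<subseteq> clopens L" "decseq C" "(\<Inter>n. C n) \<subseteq> B" "measure \<rho> (\<Inter>n. C n) > 0"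
proof -
  interpret prob_space \<rho> by (rule p)
  have sp: "space \<rho> = Pow L" by (metis s sets_eq_imp_space_eq space_pow_measurable)
  define i where "i = to_nat_on L"
  have inj: "inj_on i L" unfolding i_def using L by (rule inj_on_to_nat_on)
  \<comment> \<open>Coding sets by 0-1 sequences transfers the problem to a Polish type, where inner
    regularity of finite Borel measures is available.\<close>
  define e :: "'a set \<Rightarrow> nat \<Rightarrow> real" where "e Z n = (if n \<in> i ` Z then 1 else 0)" for Z n
  have mem: "l \<in> Z \<longleftrightarrow> i l \<in> i ` Z" if "Z \<subseteq> L" "l \<in> L" for l Z
    using inj that by (simp add: inj_on_image_mem_iff)
  have mem': "{Z \<in> Pow L. l \<in> Z} = {Z \<in> Pow L. i l \<in> i ` Z}" if "l \<in> L" for l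
    by (intro Collect_cong conj_cong refl) (rule mem[OF _ that], simp)
  have e: "e \<in> borel_measurable \<rho>"
  proof (rule measurable_coordinatewise_then_product)
    fix n
    have "{Z \<in> space \<rho>. n \<in> i ` Z} \<in> sets \<rho>"
    proof (cases "n \<in> i ` L")
      case True
      then obtain l where l: "l \<in> L" "n = i l" by blast
      then have "{Z \<in> space \<rho>. n \<in> i ` Z} = {Z \<in> Pow L. l \<in> Z}"
        unfolding sp mem'[OF l(1)] by simp
      then show ?thesis by (simp only: s sets_pow_measurable_mem)
    next
      case False
      then have "n \<notin> i ` Z" if "Z \<subseteq> L" for Z using that by blast
      then have "{Z \<in> space \<rho>. n \<in> i ` Z} = {}" unfolding sp by blast
      then show ?thesis by (simp only: sets.empty_sets)
    qed
    then show "(\<lambda>Z. e Z n) \<in> borel_measurable \<rho>" unfolding e_def by (intro measurable_If) simp_all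
  qed
  have "sets \<rho> \<subseteq> sets (vimage_algebra (Pow L) e borel)"
    unfolding s sets_pow_measurable
  proof (rule sets.sigma_sets_subset[of _ "vimage_algebra (Pow L) e borel", simplified], safe)
    fix l assume l: "l \<in> L"
    have "{Z \<in> Pow L. l \<in> Z} = e -` {x. x (i l) = 1} \<inter> Pow L"
      unfolding mem'[OF l] by (auto simp: e_def simp del: image_iff split: if_splits)
    moreover have "{x :: nat \<Rightarrow> real. x (i l) = 1} \<in> sets borel" by measurable
    ultimately show "{Z \<in> Pow L. l \<in> Z} \<in> sets (vimage_algebra (Pow L) e borel)"
      unfolding sets_vimage_algebra2[of e "Pow L" borel, simplified] by blast
  qed
  then obtain B' where B': "B' \<in> sets borel" "B = e -` B' \<inter> Pow L"
    using B(1) unfolding sets_vimage_algebra2[of e "Pow L" borel, simplified] by blast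
  let ?N = "distr \<rho> borel e"
  have N: "emeasure ?N B' > 0"
    using B B' e sp by (simp add: emeasure_distr emeasure_eq_measure)
  interpret N: prob_space ?N using e by (rule prob_space_distr)
  have "emeasure ?N B' = (SUP K\<in>{K. K \<subseteq> B' \<and> compact K}. emeasure ?N K)"
    by (rule inner_regular) (use B' in auto)
  with N obtain K' where K': "K' \<subseteq> B'" "compact K'" "emeasure ?N K' > 0"
    by (auto simp: less_SUP_iff)
  have clK: "closed K'" using K'(2) by (rule compact_imp_closed)
  define K where "K = e -` K' \<inter> Pow L"
  define F where "F n = {l \<in> L. i l < n}" for n
  have finF: "finite (F n)" for n
  proof (rule inj_on_finite[of i _ "{..<n}"])
    show "inj_on i (F n)" using inj by (rule inj_on_subset) (auto simp: F_def)
  qed (auto simp: F_def)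
  \<comment> \<open>The clopen hull of \<open>K\<close> seen through the first n coordinates; as
    \<open>K\<close> is closed, these hulls shrink to \<open>K\<close>.\<close>
  define C where "C n = {Z \<in> Pow L. \<exists>Y\<in>K. Z \<inter> F n = Y \<inter> F n}" for n
  have "(\<Inter>n. C n) = K"
  proof
    show "K \<subseteq> (\<Inter>n. C n)" by (auto simp: C_def K_def)
    show "(\<Inter>n. C n) \<subseteq> K"
    proof
      fix Z assume Z: "Z \<in> (\<Inter>n. C n)"
      then have ZL: "Z \<subseteq> L" by (auto simp: C_def)
      from Z have "\<forall>n. \<exists>Y. Y \<in> K \<and> Z \<inter> F n = Y \<inter> F n" unfolding C_def by blast
      then obtain Y where Y: "\<And>n. Y n \<in> K" "\<And>n. Z \<inter> F n = Y n \<inter> F n" by metis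
      have "(\<lambda>n. e (Y n) j) \<longlonglongrightarrow> e Z j" for j
      proof -
        have "e (Y n) j = e Z j" if "n > j" for n
        proof (cases "j \<in> i ` L")
          case True
          then obtain l where l: "l \<in> L" "j = i l" by auto
          then have "l \<in> F n" using that by (auto simp: F_def)
          then have "l \<in> Z \<longleftrightarrow> l \<in> Y n" using Y(2)[of n] by auto
          moreover have "Y n \<subseteq> L" using Y(1) by (auto simp: K_def)
          ultimately show ?thesis using mem l ZL by (simp add: e_def)
        next
          case False
          moreover have "Y n \<subseteq> L" using Y(1) by (auto simp: K_def)
          ultimately have "j \<notin> i ` Y n" "j \<notin> i ` Z" using ZL by auto
          then show ?thesis by (simp add: e_def)
        qed
        then show ?thesis
          by (intro tendsto_eventually) (auto simp: eventually_at_top_dense)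
      qed
      then have "limitin (product_topology (\<lambda>_. euclidean) UNIV) (\<lambda>n. e (Y n)) (e Z) sequentially"
        unfolding limitin_componentwise by auto
      then have "(\<lambda>n. e (Y n)) \<longlonglongrightarrow> e Z"
        unfolding euclidean_product_topology by simp
      moreover have "e (Y n) \<in> K'" for n using Y(1)[of n] by (simp add: K_def)
      ultimately have "e Z \<in> K'" using closed_sequentially[OF clK, of "\<lambda>n. e (Y n)"] by simp
      then show "Z \<in> K" using ZL by (simp add: K_def)
    qed
  qed
  show ?thesis
  proof (rule that[of C])
    show "range C \<subseteq> clopens L"
    proof safe
      fix n
      have "determined L (F n) (C n)"
        unfolding determined_def C_def by (intro conjI ballI impI) (rule Collect_restrict, simp)
      moreover have "F n \<subseteq> L" by (auto simp: F_def)
      ultimately show "C n \<in> clopens L" using finF by (intro clopensI)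
    qed
    show "decseq C"
    proof (rule decseq_SucI)
      fix n
      have "F n = F (Suc n) \<inter> F n" by (auto simp: F_def)
      then have "Z \<inter> F (Suc n) = Y \<inter> F (Suc n) \<Longrightarrow> Z \<inter> F n = Y \<inter> F n" for Z Y
        by (metis Int_assoc)
      then show "C (Suc n) \<subseteq> C n" unfolding C_def by (intro Collect_mono) meson
    qed
    show "(\<Inter>n. C n) \<subseteq> B" using \<open>(\<Inter>n. C n) = K\<close> B' K' by (auto simp: K_def)
    have "emeasure \<rho> K > 0"
      using K'(3) e sp clK by (simp add: emeasure_distr K_def)
    then show "measure \<rho> (\<Inter>n. C n) > 0"
      unfolding \<open>(\<Inter>n. C n) = K\<close> by (simp add: emeasure_eq_measure)
  qed
qed

text \<open>
  The maximiser of \<open>m K + \<epsilon> \<Sum>\<^sub>n 2\<^sup>-\<^sup>n (m a\<^sub>n)\<^sup>2\<close>, where \<open>a\<^sub>n\<close> enumerates the clopen sets: the first term is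
  upper semicontinuous for compact \<open>K\<close>, which preserves positivity on \<open>B0 \<supseteq> K\<close>, and strict convexity of the
  second forces extremality.
\<close>

lemma exists_extremal_measure:
  fixes R :: "('a set set \<times> 'a set set) set"
  assumes L: "countable L" and R: "R \<subseteq> clopens L \<times> clopens L"
    and s: "sets \<rho> = sets (pow_measurable L)" and p: "prob_space \<rho>"
    and inv: "\<And>A B. (A, B) \<in> R \<Longrightarrow> measure \<rho> A = measure \<rho> B"
    and B0: "B0 \<in> sets (pow_measurable L)" "measure \<rho> B0 > 0"
  obtains \<rho>' where "sets \<rho>' = sets (pow_measurable L)" "prob_space \<rho>'"
    "\<And>A B. (A, B) \<in> R \<Longrightarrow> measure \<rho>' A = measure \<rho>' B" "measure \<rho>' B0 > 0"
    "\<And>D. D \<in> sets (pow_measurable L) \<Longrightarrow>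
      (\<And>A B. (A, B) \<in> R \<Longrightarrow> measure \<rho>' (A \<inter> D) = measure \<rho>' (B \<inter> D)) \<Longrightarrow>
      measure \<rho>' D = 0 \<or> measure \<rho>' D = 1"
proof -
  obtain C :: "nat \<Rightarrow> 'a set set" where C: "range C \<subseteq> clopens L" "decseq C" "(\<Inter>n. C n) \<subseteq> B0"
    "measure \<rho> (\<Inter>n. C n) > 0"
    using clopens_inner_regular[OF L s p, of B0] B0 s by auto
  define K where "K = (\<Inter>n. C n)"
  define \<delta> where "\<delta> = measure \<rho> K"
  \<comment> \<open>Since \<open>\<Phi>\<close> is at most 2, the second term of \<open>J\<close>
    contributes at most \<open>\<delta>\<close> / 2. A maximiser has \<open>J\<close> at least
    \<open>\<delta>\<close>, so it keeps mass at least \<open>\<delta>\<close> / 2 on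
    \<open>K\<close>.\<close>
  define \<epsilon> where "\<epsilon> = \<delta> / 4"
  have \<delta>: "\<delta> > 0" "\<epsilon> > 0" using C(4) by (auto simp: \<delta>_def K_def \<epsilon>_def)
  have cs: "A \<in> sets (pow_measurable L)" if "A \<in> clopens L" for A
    using that sigma_sets_clopens[OF L] by auto
  have Cs: "C n \<in> sets (pow_measurable L)" for n using C(1) cs by blast
  then have Ks: "K \<in> sets (pow_measurable L)" unfolding K_def by auto
  define a where "a = from_nat_into (clopens L)"
  have ne: "clopens L \<noteq> {}" using clopens_empty by blast
  have a: "a n \<in> clopens L" for n unfolding a_def using ne by (rule from_nat_into)
  have a_surj: "\<exists>n. A = a n" if "A \<in> clopens L" for A
    unfolding a_def using from_nat_into_surj[OF countable_clopens[OF L] that] by metis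
  define adm where "adm m \<longleftrightarrow> sets m = sets (pow_measurable L) \<and> prob_space m \<and>
    (\<forall>(A, B)\<in>R. measure m A = measure m B)" for m
  define \<Phi> where "\<Phi> m = (\<Sum>n. (1/2)^n * (measure m (a n))\<^sup>2)" for m
  define J where "J m = measure m K + \<epsilon> * \<Phi> m" for m
  have half: "summable (\<lambda>n. (1/2::real)^n)" "(\<Sum>n. (1/2::real)^n) = 2"
    using summable_geometric[of "1/2::real"] suminf_geometric[of "1/2::real"] by auto
  have le1: "measure m A \<le> 1" if "adm m" for m A
    using prob_space.prob_le_1[of m] that by (auto simp: adm_def)
  have sq1: "0 \<le> (1/2::real)^n * (measure m (a n))\<^sup>2 \<and> (1/2::real)^n * (measure m (a n))\<^sup>2 \<le> (1/2)^n"
    if "adm m" for m n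
    using le1[OF that, of "a n"] by (auto simp: power_le_one mult_left_le)
  have summ: "summable (\<lambda>n. (1/2)^n * (measure m (a n))\<^sup>2)" if "adm m" for m
    by (rule summable_comparison_test'[OF half(1), of 0]) (use sq1[OF that] in auto)
  have \<Phi>: "0 \<le> \<Phi> m" "\<Phi> m \<le> 2" if "adm m" for m
    unfolding \<Phi>_def using sq1[OF that] suminf_le[OF _ summ[OF that] half(1)] half(2)
    by (auto intro!: suminf_nonneg summ that)
  have bdd: "bdd_above (J ` {m. adm m})"
  proof (rule bdd_aboveI2)
    fix m assume "m \<in> {m. adm m}"
    then show "J m \<le> 1 + \<epsilon> * 2" unfolding J_def using le1 \<Phi>(2) \<delta>(2)
      by (intro add_mono mult_left_mono) auto
  qed
  have adm\<rho>: "adm \<rho>" unfolding adm_def using s p inv by auto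
  define S where "S = (SUP m\<in>{m. adm m}. J m)"
  have JS: "J m \<le> S" if "adm m" for m unfolding S_def using bdd that by (intro cSUP_upper) auto
  have "\<exists>m. adm m \<and> J m > S - 1 / real (Suc j)" for j
    using less_cSUP_iff[of "{m. adm m}" J "S - 1 / real (Suc j)"] bdd adm\<rho> unfolding S_def by auto
  then obtain m where m: "\<And>j. adm (m j)" "\<And>j. J (m j) > S - 1 / real (Suc j)" by metis
  obtain k M where k: "strict_mono (k :: nat \<Rightarrow> nat)" "sets M = sets (pow_measurable L)" "prob_space M"
    "\<And>A. A \<in> clopens L \<Longrightarrow> (\<lambda>n. measure (m (k n)) A) \<longlonglongrightarrow> measure M A"
    using prob_clopens_compactness[OF L, of m] m(1) unfolding adm_def by blast
  interpret M: prob_space M by (rule k(3))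
  have spM: "space M = Pow L" using sets_eq_imp_space_eq[OF k(2)] by simp
  have "measure M A = measure M B" if AB: "(A, B) \<in> R" for A B
  proof (rule LIMSEQ_unique)
    show "(\<lambda>n. measure (m (k n)) A) \<longlonglongrightarrow> measure M A" using R AB by (intro k(4)) auto
    have "measure (m (k n)) A = measure (m (k n)) B" for n
      using m(1)[of "k n"] AB unfolding adm_def by auto
    then show "(\<lambda>n. measure (m (k n)) A) \<longlonglongrightarrow> measure M B" using k(4)[of B] R AB by auto
  qed
  then have admM: "adm M" unfolding adm_def using k by auto
  \<comment> \<open>The mass of \<open>K\<close> need not converge along the subsequence. It is
    bounded by the mass of the clopen set \<open>C i\<close>, which does converge; afterwards i
    tends to infinity.\<close>
  have "S \<le> measure M (C i) + \<epsilon> * \<Phi> M" for i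
  proof (rule LIMSEQ_le)
    have "(\<lambda>n. S - 1 / real (Suc n)) \<longlonglongrightarrow> S - 0"
      by (intro tendsto_diff tendsto_const LIMSEQ_Suc[OF lim_1_over_n])
    then show "(\<lambda>n. S - 1 / real (Suc (k n))) \<longlonglongrightarrow> S"
      using LIMSEQ_subseq_LIMSEQ[OF _ k(1)] by (auto simp: o_def)
    have "(\<lambda>n. \<Phi> (m (k n))) \<longlonglongrightarrow> \<Phi> M"
      unfolding \<Phi>_def
    proof (rule conjunct2[OF conjunct2[OF tannerys_theorem[OF _ _ half(1)]]])
      show "(\<lambda>n. (1/2)^i * (measure (m (k n)) (a i))\<^sup>2) \<longlonglongrightarrow> (1/2)^i * (measure M (a i))\<^sup>2" for i
        by (intro tendsto_intros k(4) a)
      show "\<forall>\<^sub>F (i, n) in sequentially \<times>\<^sub>F sequentially. norm ((1/2)^i * (measure (m (k n)) (a i))\<^sup>2) \<le> (1/2)^i"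
        using sq1[OF m(1)] by (intro always_eventually) auto
    qed simp
    then show "(\<lambda>n. measure (m (k n)) (C i) + \<epsilon> * \<Phi> (m (k n))) \<longlonglongrightarrow> measure M (C i) + \<epsilon> * \<Phi> M"
      using C(1) by (intro tendsto_add tendsto_mult tendsto_const k(4)) auto
    have "S - 1 / real (Suc (k n)) \<le> measure (m (k n)) (C i) + \<epsilon> * \<Phi> (m (k n))" for n
    proof -
      interpret prob_space "m (k n)" using m(1) by (auto simp: adm_def)
      have "C i \<in> sets (m (k n))" using m(1) Cs by (auto simp: adm_def)
      then have "measure (m (k n)) K \<le> measure (m (k n)) (C i)"
        by (intro finite_measure_mono) (auto simp: K_def)
      then show ?thesis using m(2)[of "k n"] unfolding J_def by linarith
    qed
    then show "\<exists>N. \<forall>n\<ge>N. S - 1 / real (Suc (k n)) \<le> measure (m (k n)) (C i) + \<epsilon> * \<Phi> (m (k n))"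
      by blast
  qed
  moreover have "(\<lambda>i. measure M (C i) + \<epsilon> * \<Phi> M) \<longlonglongrightarrow> J M"
    unfolding J_def K_def using Cs C(2) k(2)
    by (intro tendsto_add tendsto_const M.finite_Lim_measure_decseq) auto
  ultimately have SJ: "S \<le> J M" by (intro LIMSEQ_le_const) auto
  have "\<delta> \<le> J \<rho>" unfolding J_def \<delta>_def using \<Phi>(1)[OF adm\<rho>] \<delta>(2) by simp
  also have "\<dots> \<le> J M" using JS[OF adm\<rho>] SJ by simp
  also have "\<dots> \<le> measure M K + \<epsilon> * 2" unfolding J_def using \<Phi>(2)[OF admM] \<delta>(2) by simp
  finally have "measure M K > 0" using \<delta> unfolding \<epsilon>_def by simp
  moreover have "measure M K \<le> measure M B0" using C(3) B0 k(2) unfolding K_def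
    by (intro M.finite_measure_mono) auto
  ultimately have MB0: "measure M B0 > 0" by simp
  have ext: "measure M D = 0 \<or> measure M D = 1"
    if D: "D \<in> sets (pow_measurable L)" "\<And>A B. (A, B) \<in> R \<Longrightarrow> measure M (A \<inter> D) = measure M (B \<inter> D)" for D
  proof (rule ccontr)
    assume neg: "\<not> (measure M D = 0 \<or> measure M D = 1)"
    define t where "t = measure M D"
    have t: "0 < t" "t < 1" using neg M.prob_le_1[of D] measure_nonneg[of M D] unfolding t_def by linarith+
    define D' where "D' = space M - D"
    have DM [measurable]: "D \<in> sets M" "D' \<in> sets M" using D(1) k(2) unfolding D'_def by auto
    have tD': "measure M D' = 1 - t" unfolding D'_def t_def using DM by (intro M.prob_compl) auto
    have split: "measure M A = measure M (D \<inter> A) + measure M (D' \<inter> A)" if "A \<in> sets M" for A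
    proof -
      have "A = (D \<inter> A) \<union> (D' \<inter> A)" using sets.sets_into_space[OF that] unfolding D'_def by auto
      moreover have "measure M ((D \<inter> A) \<union> (D' \<inter> A)) = measure M (D \<inter> A) + measure M (D' \<inter> A)"
        using that by (intro M.finite_measure_Union) (auto simp: D'_def)
      ultimately show ?thesis by simp
    qed
    \<comment> \<open>The two conditional measures of \<open>M\<close> given \<open>D\<close> and
      given its complement. The assumption on \<open>D\<close> makes the first admissible, and
      subtraction from the equations for \<open>M\<close> makes the second admissible.\<close>
    define m1 m2 where "m1 = uniform_measure M D" "m2 = uniform_measure M D'"
    have m1: "measure m1 A = measure M (D \<inter> A) / t" if "A \<in> sets M" for A
      unfolding m1_m2_def t_def using that t DM neg
      by (intro measure_uniform_measure) (auto simp: M.emeasure_eq_measure)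
    have m2: "measure m2 A = measure M (D' \<inter> A) / (1 - t)" if "A \<in> sets M" for A
      unfolding m1_m2_def using that t DM tD'
      by (subst measure_uniform_measure) (auto simp: M.emeasure_eq_measure)
    have RM: "A \<in> sets M" "B \<in> sets M" if "(A, B) \<in> R" for A B using that R cs k(2) by auto
    have "adm m1"
      unfolding adm_def using t tD' k(2) m1 RM D(2)
      by (auto simp: m1_m2_def t_def[symmetric] M.emeasure_eq_measure Int_commute intro!: prob_space_uniform_measure)
    have "measure M (D' \<inter> A) = measure M (D' \<inter> B)" if "(A, B) \<in> R" for A B
      using split[OF RM(1)[OF that]] split[OF RM(2)[OF that]] D(2)[OF that] admM that
      by (auto simp: adm_def Int_commute)
    then have "adm m2"
      unfolding adm_def using t tD' k(2) m2 RM
      by (auto simp: m1_m2_def M.emeasure_eq_measure intro!: prob_space_uniform_measure)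
    have conv: "measure M A = t * measure m1 A + (1 - t) * measure m2 A" if "A \<in> sets M" for A
      using split[OF that] m1[OF that] m2[OF that] t by simp
    \<comment> \<open>The convexity defect of the square: t x^2 + (1 - t) y^2 - (t x + (1 - t) y)^2
      = t (1 - t) (x - y)^2. Maximality of \<open>M\<close> forces the weighted sum of the defects
      to vanish, so \<open>m1\<close> and \<open>m2\<close> agree on all clopen sets, although only
      the first charges \<open>D\<close>.\<close>
    let ?q = "\<lambda>n. (1/2)^n * (t * (1 - t) * (measure m1 (a n) - measure m2 (a n))\<^sup>2)"
    have aM: "a n \<in> sets M" for n using a cs k(2) by auto
    have q: "?q n = t * ((1/2)^n * (measure m1 (a n))\<^sup>2) + (1 - t) * ((1/2)^n * (measure m2 (a n))\<^sup>2)
      - (1/2)^n * (measure M (a n))\<^sup>2" for n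
      unfolding conv[OF aM] by (simp add: power2_eq_square algebra_simps)
    have sq: "summable ?q"
      unfolding q by (intro summable_diff summable_add summable_mult summ \<open>adm m1\<close> \<open>adm m2\<close> admM)
    have "suminf ?q = t * \<Phi> m1 + (1 - t) * \<Phi> m2 - \<Phi> M"
      unfolding q \<Phi>_def
      by (simp add: suminf_diff[symmetric] suminf_add[symmetric] suminf_mult[symmetric] summable_mult
        summable_add summ \<open>adm m1\<close> \<open>adm m2\<close> admM)
    moreover have "t * J m1 + (1 - t) * J m2 \<le> t * J M + (1 - t) * J M"
      using JS[OF \<open>adm m1\<close>] JS[OF \<open>adm m2\<close>] SJ t by (intro add_mono mult_left_mono) auto
    then have "\<epsilon> * (t * \<Phi> m1 + (1 - t) * \<Phi> m2 - \<Phi> M) \<le> 0"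
      using conv[of K] Ks k(2) unfolding J_def by (simp add: algebra_simps)
    ultimately have "suminf ?q \<le> 0" using \<delta>(2) by (simp add: mult_le_0_iff)
    moreover have qn: "0 \<le> ?q n" for n using t by simp
    ultimately have "suminf ?q = 0" using suminf_nonneg[OF sq] by (meson antisym)
    then have "?q n = 0" for n using suminf_eq_zero_iff[OF sq] qn by auto
    then have eq: "measure m1 (a n) = measure m2 (a n)" for n using t by auto
    have "m1 = m2"
    proof (rule measure_eqI_generator_eq[where E = "clopens L" and \<Omega> = "Pow L" and A = "\<lambda>_. Pow L"])
      interpret algebra "Pow L" "clopens L" by (rule algebra_clopens)
      show "Int_stable (clopens L)" by (auto simp: Int_stable_def)
      show "clopens L \<subseteq> Pow (Pow L)" by (rule space_closed)
      show "emeasure m1 X = emeasure m2 X" if X: "X \<in> clopens L" for X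
      proof -
        interpret m1: prob_space m1 using \<open>adm m1\<close> by (simp add: adm_def)
        interpret m2: prob_space m2 using \<open>adm m2\<close> by (simp add: adm_def)
        show ?thesis using eq a_surj[OF X] by (auto simp: m1.emeasure_eq_measure m2.emeasure_eq_measure)
      qed
      show "sets m1 = sigma_sets (Pow L) (clopens L)" "sets m2 = sigma_sets (Pow L) (clopens L)"
        using \<open>adm m1\<close> \<open>adm m2\<close> sigma_sets_clopens[OF L] by (auto simp: adm_def)
      show "range (\<lambda>_. Pow L) \<subseteq> clopens L" using top by auto
      interpret m1: prob_space m1 using \<open>adm m1\<close> by (simp add: adm_def)
      show "emeasure m1 (Pow L) \<noteq> \<infinity>" by simp
    qed auto
    moreover have "measure m1 D = 1" using m1[OF DM(1)] t by (simp add: t_def)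
    moreover have "measure m2 D = 0" using m2[OF DM(1)] by (simp add: D'_def Diff_Int_distrib2)
    ultimately show False by simp
  qed
  show ?thesis
  proof (rule that[OF k(2,3) _ MB0 ext])
    show "measure M A = measure M B" if "(A, B) \<in> R" for A B
      using admM that unfolding adm_def by auto
  qed
qed

section \<open>Closed sets and the Chabauty--Fell topology\<close>

lemma openin_hit: "open V \<Longrightarrow> openin chabauty_fell {P. closed P \<and> P \<inter> V \<noteq> {}}"
  unfolding chabauty_fell_def by (rule topology_generated_by_Basis) blast

lemma openin_miss: "compact K \<Longrightarrow> openin chabauty_fell {P. closed P \<and> P \<inter> K = {}}"
  unfolding chabauty_fell_def by (rule topology_generated_by_Basis) blast

lemma space_borel_of: "space (borel_of T) = topspace T"
  unfolding borel_of_def by (rule space_measure_of) (auto dest: openin_subset)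

lemma sets_borel_of: "sets (borel_of T) = sigma_sets (topspace T) {U. openin T U}"
  unfolding borel_of_def by (rule sets_measure_of) (auto dest: openin_subset)

lemma borel_of_open: "openin T U \<Longrightarrow> U \<in> sets (borel_of T)"
  unfolding sets_borel_of by auto

lemma space_borel_of_fell: "space (borel_of (subtopology chabauty_fell S)) = {P \<in> S. closed P}"
  by (auto simp: space_borel_of topspace_chabauty_fell)

lemma sets_borel_of_hit:
  assumes "open V"
  shows "{P \<in> space (borel_of (subtopology chabauty_fell S)). P \<inter> V \<noteq> {}}
    \<in> sets (borel_of (subtopology chabauty_fell S))"
proof (rule borel_of_open)
  have "openin (subtopology chabauty_fell S) (S \<inter> {P. closed P \<and> P \<inter> V \<noteq> {}})"
    using openin_hit[OF assms] by (metis inf_commute openin_subtopology_Int)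
  moreover have "S \<inter> {P. closed P \<and> P \<inter> V \<noteq> {}} =
    {P \<in> space (borel_of (subtopology chabauty_fell S)). P \<inter> V \<noteq> {}}"
    unfolding space_borel_of_fell by auto
  ultimately show "openin (subtopology chabauty_fell S)
    {P \<in> space (borel_of (subtopology chabauty_fell S)). P \<inter> V \<noteq> {}}" by simp
qed

text \<open>A closed set contains l iff it hits every basic neighbourhood of l, which is a countable
  conjunction of hitting conditions.\<close>

lemma sets_borel_of_mem:
  fixes l :: "'g::{second_countable_topology, t2_space}"
  shows "{P \<in> space (borel_of (subtopology chabauty_fell S)). l \<in> P}
    \<in> sets (borel_of (subtopology chabauty_fell S))"
proof -
  let ?M = "borel_of (subtopology chabauty_fell S)"
  obtain \<B> :: "'g set set" where \<B>: "countable \<B>" "topological_basis \<B>"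
    using ex_countable_basis by blast
  have "l \<in> P" if P: "closed P" "\<And>V. V \<in> \<B> \<Longrightarrow> l \<in> V \<Longrightarrow> P \<inter> V \<noteq> {}" for P
  proof (rule ccontr)
    assume "l \<notin> P"
    then obtain V where "V \<in> \<B>" "l \<in> V" "V \<subseteq> - P"
      using topological_basisE[OF \<B>(2), of "- P" l] P(1) by (metis ComplI open_Compl)
    then show False using P(2)[of V] by blast
  qed
  then have "{P \<in> space ?M. l \<in> P} =
    space ?M - (\<Union>V\<in>{V \<in> \<B>. l \<in> V}. space ?M - {P \<in> space ?M. P \<inter> V \<noteq> {}})"
    unfolding space_borel_of_fell by blast
  also have "\<dots> \<in> sets ?M"
  proof (intro sets.Diff sets.top sets.countable_UN'')
    show "countable {V \<in> \<B>. l \<in> V}" using \<B>(1) by simp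
    show "{P \<in> space ?M. P \<inter> V \<noteq> {}} \<in> sets ?M" if "V \<in> {V \<in> \<B>. l \<in> V}" for V
      using that topological_basis_open[OF \<B>(2)] by (intro sets_borel_of_hit) blast
  qed
  finally show ?thesis .
qed

section \<open>Uniformly discrete sets\<close>

text \<open>A complete rewrite system for the word problem in (non-commutative) free groups.\<close>

lemmas group_normalize = diff_conv_add_uminus minus_add add.assoc minus_minus left_minus
  right_minus add_0_left add_0_right minus_add_cancel add_minus_cancel minus_zero

lemma difference_setI: "a \<in> A \<Longrightarrow> b \<in> A \<Longrightarrow> a - b \<in> difference_set A"
  unfolding difference_set_def by blast

lemma difference_set_translate [simp]: "difference_set (translate g A) = difference_set A"
proof -
  have *: "(a - g) - (b - g) = a - b" for a b by (simp only: group_normalize)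
  have "difference_set (translate g A) = {(a - g) - (b - g) | a b. a \<in> A \<and> b \<in> A}"
    unfolding difference_set_def translate_def by blast
  then show ?thesis unfolding * difference_set_def .
qed

lemma difference_set_mono: "A \<subseteq> B \<Longrightarrow> difference_set A \<subseteq> difference_set B"
  unfolding difference_set_def by blast

lemma mem_translate: "x \<in> translate g A \<longleftrightarrow> x + g \<in> A"
  unfolding translate_def by (auto simp: image_iff intro!: bexI[of _ "x + g"])

lemma translate_translate: "translate g (translate h A) = translate (g + h) A"
  by (auto simp: mem_translate add.assoc)

lemma translate_0 [simp]: "translate 0 A = A"
  by (auto simp: mem_translate)

lemma image_add_left: "(\<lambda>x. a + x) ` (V :: 'g::group_add set) = (\<lambda>x. - a + x) -` V"
proof (intro Set.set_eqI iffI)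
  fix y assume "y \<in> (\<lambda>x. - a + x) -` V"
  then show "y \<in> (\<lambda>x. a + x) ` V"
    by (intro image_eqI[of _ _ "- a + y"]) (simp_all add: add.assoc[symmetric])
qed (auto simp: add.assoc[symmetric])

lemma image_add_right: "(\<lambda>x. x + a) ` (V :: 'g::group_add set) = (\<lambda>x. x - a) -` V"
proof (intro Set.set_eqI iffI)
  fix y assume "y \<in> (\<lambda>x. x - a) -` V"
  then show "y \<in> (\<lambda>x. x + a) ` V" by (intro image_eqI[of _ _ "y - a"]) simp_all
qed auto

lemma open_translate_left: "open V \<Longrightarrow> open ((\<lambda>x. a + x) ` (V :: 'g::topological_group_add set))"
  unfolding image_add_left by (intro open_vimage continuous_intros)

lemma open_translate_right: "open V \<Longrightarrow> open ((\<lambda>x. x + a) ` (V :: 'g::topological_group_add set))"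
  unfolding image_add_right by (intro open_vimage continuous_intros)

text \<open>Only an implication is asked, so that, in contrast to \<open>uniformly_discrete\<close>,
  the empty set qualifies and the property passes to subsets.\<close>

definition separated_by :: "'g::group_add set \<Rightarrow> 'g set \<Rightarrow> bool" where
  "separated_by U A \<longleftrightarrow> (\<forall>a\<in>A. \<forall>b\<in>A. a - b \<in> U \<longrightarrow> a = b)"

lemma small_neighbourhood:
  fixes U :: "'g::topological_group_add set"
  assumes "open U" "0 \<in> U"
  obtains W where "open W" "0 \<in> W" "\<And>v w. v \<in> W \<Longrightarrow> w \<in> W \<Longrightarrow> v - w \<in> U"
    "\<And>v w. v \<in> W \<Longrightarrow> w \<in> W \<Longrightarrow> - v + w \<in> U"
proof -
  have *: "\<exists>W. open W \<and> 0 \<in> W \<and> (\<forall>v\<in>W. \<forall>w\<in>W. f (v, w) \<in> U)"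
    if f: "continuous_on UNIV f" "f (0, 0) = 0" for f :: "'g \<times> 'g \<Rightarrow> 'g"
  proof -
    have "open (f -` U)" "(0, 0) \<in> f -` U"
      using f assms by (auto intro: open_vimage)
    then obtain A B where "open A" "open B" "(0, 0) \<in> A \<times> B" "A \<times> B \<subseteq> f -` U"
      by (rule open_prod_elim)
    then have "open (A \<inter> B)" "0 \<in> A \<inter> B" "\<forall>v\<in>A \<inter> B. \<forall>w\<in>A \<inter> B. f (v, w) \<in> U" by auto
    then show ?thesis by metis
  qed
  obtain W1 where W1: "open W1" "0 \<in> W1" "\<forall>v\<in>W1. \<forall>w\<in>W1. v - w \<in> U"
    using *[of "\<lambda>p. fst p - snd p"] by (force intro!: continuous_intros)
  obtain W2 where W2: "open W2" "0 \<in> W2" "\<forall>v\<in>W2. \<forall>w\<in>W2. - v + w \<in> U"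
    using *[of "\<lambda>p. - fst p + snd p"] by (force intro!: continuous_intros)
  show ?thesis by (rule that[of "W1 \<inter> W2"]) (use W1 W2 in auto)
qed

text \<open>On the right translate W + x the point x cancels from differences, so they lie in W - W
  and hence in \<open>U\<close>. Closedness, countability and finiteness on compact sets of
  separated sets all rest on these neighbourhoods.\<close>

lemma separated_by_neighbourhood:
  fixes U :: "'g::topological_group_add set"
  assumes "open U" "0 \<in> U" "separated_by U A"
  obtains N where "open N" "x \<in> N" "\<And>a b. a \<in> A \<Longrightarrow> b \<in> A \<Longrightarrow> a \<in> N \<Longrightarrow> b \<in> N \<Longrightarrow> a = b"
proof -
  obtain W where W: "open W" "0 \<in> W" "\<And>v w. v \<in> W \<Longrightarrow> w \<in> W \<Longrightarrow> v - w \<in> U"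
    using small_neighbourhood[OF assms(1,2)] by metis
  show ?thesis
  proof (rule that[of "(\<lambda>w. w + x) ` W"])
    show "open ((\<lambda>w. w + x) ` W)" using W(1) by (rule open_translate_right)
    show "x \<in> (\<lambda>w. w + x) ` W" using W(2) by force
    fix a b assume "a \<in> A" "b \<in> A" "a \<in> (\<lambda>w. w + x) ` W" "b \<in> (\<lambda>w. w + x) ` W"
    moreover from this obtain v w where "v \<in> W" "w \<in> W" "a = v + x" "b = w + x" by blast
    moreover from this have "a - b = v - w" by (simp only: group_normalize)
    ultimately show "a = b" using W(3) assms(3) unfolding separated_by_def by metis
  qed
qed

lemma separated_by_closed:
  fixes U :: "'g::{topological_group_add, t2_space} set"
  assumes "open U" "0 \<in> U" "separated_by U A"
  shows "closed A"
proof -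
  have "\<exists>T. open T \<and> x \<in> T \<and> T \<subseteq> - A" if x: "x \<in> - A" for x
  proof -
    obtain N where N: "open N" "x \<in> N" "\<And>a b. a \<in> A \<Longrightarrow> b \<in> A \<Longrightarrow> a \<in> N \<Longrightarrow> b \<in> N \<Longrightarrow> a = b"
      using separated_by_neighbourhood[OF assms] by metis
    show ?thesis
    proof (cases "A \<inter> N = {}")
      case True
      then show ?thesis using N by blast
    next
      case False
      then obtain a where a: "a \<in> A" "a \<in> N" by blast
      then have "N - {a} \<subseteq> - A" using N(3) by blast
      then show ?thesis using N(1,2) a x by (intro exI[of _ "N - {a}"]) auto
    qed
  qed
  then have "open (- A)" by (subst open_subopen) blast
  then show ?thesis by (simp add: closed_def)
qed

lemma separated_by_subset: "separated_by U A \<Longrightarrow> B \<subseteq> A \<Longrightarrow> separated_by U B"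
  unfolding separated_by_def by blast

lemma separated_by_countable:
  fixes U :: "'g::{topological_group_add, second_countable_topology} set"
  assumes "open U" "0 \<in> U" "separated_by U A"
  shows "countable A"
proof -
  obtain \<B> :: "'g set set" where \<B>: "countable \<B>" "topological_basis \<B>"
    using ex_countable_basis by blast
  have "\<exists>V\<in>\<B>. A \<inter> V = {a}" if a: "a \<in> A" for a
  proof -
    obtain N where N: "open N" "a \<in> N" "\<And>b c. b \<in> A \<Longrightarrow> c \<in> A \<Longrightarrow> b \<in> N \<Longrightarrow> c \<in> N \<Longrightarrow> b = c"
      using separated_by_neighbourhood[OF assms] by metis
    obtain V where "V \<in> \<B>" "a \<in> V" "V \<subseteq> N"
      using topological_basisE[OF \<B>(2) N(1,2)] by blast
    then have "A \<inter> V = {a}" using a N by blast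
    then show ?thesis using \<open>V \<in> \<B>\<close> by blast
  qed
  then have "\<exists>f. \<forall>a\<in>A. f a \<in> \<B> \<and> A \<inter> f a = {a}" by metis
  then obtain f where f: "\<And>a. a \<in> A \<Longrightarrow> f a \<in> \<B>" "\<And>a. a \<in> A \<Longrightarrow> A \<inter> f a = {a}" by blast
  have "inj_on f A" using f(2) by (intro inj_onI) (metis singleton_inject)
  moreover have "f ` A \<subseteq> \<B>" using f(1) by blast
  ultimately show ?thesis using \<B>(1) by (meson countable_image_inj_on countable_subset)
qed

lemma separated_by_finite:
  fixes U :: "'g::topological_group_add set"
  assumes "open U" "0 \<in> U" "separated_by U A" "compact K"
  shows "finite (A \<inter> K)"
proof -
  have "\<forall>x. \<exists>N. open N \<and> x \<in> N \<and> (\<forall>a\<in>A. \<forall>b\<in>A. a \<in> N \<longrightarrow> b \<in> N \<longrightarrow> a = b)"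
    using separated_by_neighbourhood[OF assms(1-3)] by metis
  then obtain N where N: "\<And>x. open (N x)" "\<And>x. x \<in> N x"
    "\<And>x a b. a \<in> A \<Longrightarrow> b \<in> A \<Longrightarrow> a \<in> N x \<Longrightarrow> b \<in> N x \<Longrightarrow> a = b" by metis
  have "K \<subseteq> (\<Union>x\<in>UNIV. N x)" using N(2) by blast
  then obtain T where T: "finite T" "K \<subseteq> (\<Union>x\<in>T. N x)"
    using compactE_image[OF assms(4), of UNIV N] N(1) by metis
  have "finite (A \<inter> N x)" for x
  proof (cases "A \<inter> N x = {}")
    case False
    then obtain a where "a \<in> A \<inter> N x" by blast
    then have "A \<inter> N x \<subseteq> {a}" using N(3) by blast
    then show ?thesis by (rule finite_subset) simp
  qed simp
  then have "finite (\<Union>x\<in>T. A \<inter> N x)" using T(1) by blast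
  then show ?thesis by (rule finite_subset[rotated]) (use T(2) in blast)
qed

section \<open>Sets with a given set of return times\<close>

locale return_set =
  fixes \<Lambda> :: "'g::{topological_group_add, second_countable_topology, t2_space} set"
  assumes zero_mem: "0 \<in> \<Lambda>" and uminus_mem: "\<And>a. a \<in> \<Lambda> \<Longrightarrow> - a \<in> \<Lambda>"
    and ud: "uniformly_discrete (\<Lambda> + \<Lambda> + \<Lambda>)"
begin

definition U :: "'g set" where
  "U = (SOME U. open U \<and> 0 \<in> U \<and> difference_set (\<Lambda> + \<Lambda> + \<Lambda>) \<inter> U = {0})"

lemma U: "open U" "0 \<in> U" "difference_set (\<Lambda> + \<Lambda> + \<Lambda>) \<inter> U = {0}"
  using someI_ex[OF ud[unfolded uniformly_discrete_def]] unfolding U_def by blast+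

text \<open>Small enough that \<open>unique_shift\<close> below holds.\<close>

definition B :: "'g set" where
  "B = (SOME W. open W \<and> 0 \<in> W \<and> (\<forall>v\<in>W. \<forall>w\<in>W. v - w \<in> U \<and> - v + w \<in> U))"

lemma B: "open B" "0 \<in> B" "\<And>v w. v \<in> B \<Longrightarrow> w \<in> B \<Longrightarrow> v - w \<in> U"
  "\<And>v w. v \<in> B \<Longrightarrow> w \<in> B \<Longrightarrow> - v + w \<in> U"
proof -
  obtain W where "open W" "0 \<in> W" "\<And>v w. v \<in> W \<Longrightarrow> w \<in> W \<Longrightarrow> v - w \<in> U"
    "\<And>v w. v \<in> W \<Longrightarrow> w \<in> W \<Longrightarrow> - v + w \<in> U"
    using small_neighbourhood[OF U(1,2)] by metis
  then have "\<exists>W. open W \<and> 0 \<in> W \<and> (\<forall>v\<in>W. \<forall>w\<in>W. v - w \<in> U \<and> - v + w \<in> U)" by metis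
  note * = someI_ex[OF this, folded B_def]
  show "open B" "0 \<in> B" "\<And>v w. v \<in> B \<Longrightarrow> w \<in> B \<Longrightarrow> v - w \<in> U"
    "\<And>v w. v \<in> B \<Longrightarrow> w \<in> B \<Longrightarrow> - v + w \<in> U" using * by metis+
qed

text \<open>Large enough to contain every member of \<open>X\<close> that meets
  \<open>\<Lambda>\<close>, see \<open>X_subset_L\<close>, and still countable.\<close>

definition L :: "'g set" where "L = \<Lambda> + \<Lambda>"

lemma add_mem_L: "a \<in> \<Lambda> \<Longrightarrow> b \<in> \<Lambda> \<Longrightarrow> a + b \<in> L"
  unfolding L_def by (rule set_plus_intro)

lemma add_mem_triple: "a \<in> \<Lambda> \<Longrightarrow> b \<in> \<Lambda> \<Longrightarrow> c \<in> \<Lambda> \<Longrightarrow> a + b + c \<in> \<Lambda> + \<Lambda> + \<Lambda>"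
  by (intro set_plus_intro)

lemma L_subset: "\<Lambda> \<subseteq> L" "L \<subseteq> \<Lambda> + \<Lambda> + \<Lambda>" "\<Lambda> \<subseteq> \<Lambda> + \<Lambda> + \<Lambda>"
proof -
  show 1: "\<Lambda> \<subseteq> L" using add_mem_L[OF _ zero_mem] by auto
  show 2: "L \<subseteq> \<Lambda> + \<Lambda> + \<Lambda>"
    unfolding L_def using set_plus_intro[OF _ zero_mem, of _ "\<Lambda> + \<Lambda>"] by auto
  show "\<Lambda> \<subseteq> \<Lambda> + \<Lambda> + \<Lambda>" using 1 2 by (rule subset_trans)
qed

lemma separated3: "separated_by U (\<Lambda> + \<Lambda> + \<Lambda>)"
  unfolding separated_by_def
proof (intro ballI impI)
  fix a b assume "a \<in> \<Lambda> + \<Lambda> + \<Lambda>" "b \<in> \<Lambda> + \<Lambda> + \<Lambda>" "a - b \<in> U"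
  then have "a - b \<in> difference_set (\<Lambda> + \<Lambda> + \<Lambda>) \<inter> U" by (simp add: difference_setI)
  then show "a = b" unfolding U(3) by simp
qed

lemma zero_mem3: "0 \<in> \<Lambda> + \<Lambda> + \<Lambda>" using zero_mem L_subset(3) by (rule subsetD[rotated])

text \<open>Separation applied to x and 0, both triple sums. The rigidity arguments below produce a
  small element of \<Lambda> + \<Lambda> + \<Lambda> and conclude with this.\<close>

lemma triple_small_eq_0:
  assumes "x \<in> \<Lambda> + \<Lambda> + \<Lambda>" "x \<in> U" shows "x = 0"
  using separated3[unfolded separated_by_def, rule_format, OF assms(1) zero_mem3] assms(2) by simp

lemma countable_return: "countable (\<Lambda> + \<Lambda> + \<Lambda>)" "countable L" "countable \<Lambda>"
proof -
  show 1: "countable (\<Lambda> + \<Lambda> + \<Lambda>)" by (rule separated_by_countable[OF U(1,2) separated3])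
  show "countable L" using countable_subset[OF L_subset(2) 1] .
  show "countable \<Lambda>" using countable_subset[OF L_subset(3) 1] .
qed

text \<open>A translation-invariant set that contains the hull of every P with difference set
  \<open>\<Lambda>\<close>. It is stable under taking subsets, so intersections of members of the
  hull stay in it.\<close>

definition X :: "'g set set" where "X = {Z. difference_set Z \<subseteq> \<Lambda>}"

lemma X_diff: "Z \<in> X \<Longrightarrow> a \<in> Z \<Longrightarrow> b \<in> Z \<Longrightarrow> a - b \<in> \<Lambda>"
  unfolding X_def using difference_setI by blast

lemma XI: "(\<And>a b. a \<in> Z \<Longrightarrow> b \<in> Z \<Longrightarrow> a - b \<in> \<Lambda>) \<Longrightarrow> Z \<in> X"
  unfolding X_def difference_set_def by blast

lemma X_separated: "Z \<in> X \<Longrightarrow> separated_by U Z"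
  unfolding separated_by_def
proof (intro ballI impI)
  fix a b assume "Z \<in> X" "a \<in> Z" "b \<in> Z" "a - b \<in> U"
  then have "a - b = 0" using X_diff L_subset(3) by (intro triple_small_eq_0) blast+
  then show "a = b" by simp
qed

lemma X_closed: "Z \<in> X \<Longrightarrow> closed Z"
  using separated_by_closed[OF U(1,2) X_separated] .

lemma X_subset: "Z \<in> X \<Longrightarrow> Y \<subseteq> Z \<Longrightarrow> Y \<in> X"
  unfolding X_def using difference_set_mono by blast

lemma X_translate [simp]: "translate g Z \<in> X \<longleftrightarrow> Z \<in> X"
  unfolding X_def by simp

lemma closed_return: "closed \<Lambda>"
  using separated_by_closed[OF U(1,2) separated_by_subset[OF separated3 L_subset(3)]] .

lemma X_subset_L:
  assumes "Z \<in> X" "a \<in> Z" "a \<in> \<Lambda>" shows "Z \<subseteq> L"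
proof
  fix z assume "z \<in> Z"
  then have "z - a \<in> \<Lambda>" using assms X_diff by blast
  then have "z - a + a \<in> L" using assms(3) by (rule add_mem_L)
  then show "z \<in> L" by simp
qed

lemma X_subset_Lambda: "Z \<in> X \<Longrightarrow> 0 \<in> Z \<Longrightarrow> Z \<subseteq> \<Lambda>"
  using X_diff[of Z _ 0] by auto

text \<open>As \<open>\<Lambda>\<close> is closed, a difference a - b outside
  \<open>\<Lambda>\<close> stays outside it when a and b vary in small open sets V and W. Hitting
  both V and W is an open condition that excludes membership in \<open>X\<close>.\<close>

lemma closedin_X: "closedin chabauty_fell X"
proof -
  have "\<exists>T. openin chabauty_fell T \<and> P \<in> T \<and> T \<subseteq> topspace chabauty_fell - X"
    if P: "P \<in> topspace chabauty_fell - X" for P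
  proof -
    have "closed P" using P by (simp add: topspace_chabauty_fell)
    have "\<exists>a b. a \<in> P \<and> b \<in> P \<and> a - b \<notin> \<Lambda>" using P XI by blast
    then obtain a b where ab: "a \<in> P" "b \<in> P" "a - b \<notin> \<Lambda>" by blast
    have "open ((\<lambda>p. fst p - snd p) -` (- \<Lambda>))"
      using closed_return by (intro open_vimage open_Compl continuous_intros)
    moreover have "(a, b) \<in> (\<lambda>p. fst p - snd p) -` (- \<Lambda>)" using ab by simp
    ultimately obtain V W where VW: "open V" "open W" "(a, b) \<in> V \<times> W"
      "V \<times> W \<subseteq> (\<lambda>p. fst p - snd p) -` (- \<Lambda>)"
      by (rule open_prod_elim)
    let ?T = "{Q. closed Q \<and> Q \<inter> V \<noteq> {}} \<inter> {Q. closed Q \<and> Q \<inter> W \<noteq> {}}"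
    have "openin chabauty_fell ?T" using VW by (intro openin_Int openin_hit)
    moreover have "P \<in> ?T" using \<open>closed P\<close> VW(3) ab by blast
    moreover have "?T \<subseteq> topspace chabauty_fell - X"
    proof
      fix Q assume Q: "Q \<in> ?T"
      then obtain v w where "v \<in> Q" "v \<in> V" "w \<in> Q" "w \<in> W" by blast
      moreover from this have "v - w \<notin> \<Lambda>" using VW(4) by force
      ultimately have "Q \<notin> X" using X_diff by blast
      then show "Q \<in> topspace chabauty_fell - X" using Q by (simp add: topspace_chabauty_fell)
    qed
    ultimately show ?thesis by (intro exI[of _ ?T] conjI)
  qed
  then have "openin chabauty_fell (topspace chabauty_fell - X)"
    by (subst openin_subopen) (rule ballI)
  moreover have "X \<subseteq> topspace chabauty_fell" using X_closed by (auto simp: topspace_chabauty_fell)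
  ultimately show ?thesis unfolding closedin_def by (rule conjI[rotated])
qed

lemma orbit_hull_subset:
  assumes "difference_set P = \<Lambda>" shows "orbit_hull P \<subseteq> X"
  unfolding orbit_hull_def
proof (rule closure_of_minimal[OF _ closedin_X])
  have "P \<in> X" using assms by (simp add: X_def)
  then show "range (\<lambda>g. translate g P) \<subseteq> X" by auto
qed

text \<open>The difference of the two points of P lies in \<open>\<Lambda>\<close>; flanked by - l
  and l' it becomes - b + b', a triple sum that is small by the choice of \<open>B\<close>.\<close>

lemma unique_shift:
  assumes "P \<in> X" "b \<in> B" "b' \<in> B" "l \<in> \<Lambda>" "l' \<in> \<Lambda>" "l - b \<in> P" "l' - b' \<in> P"
  shows "b = b'"
proof -
  have "(l - b) - (l' - b') \<in> \<Lambda>" using assms X_diff by blast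
  then have "- l + ((l - b) - (l' - b')) + l' \<in> \<Lambda> + \<Lambda> + \<Lambda>" using assms uminus_mem by (intro add_mem_triple)
  moreover have "- l + ((l - b) - (l' - b')) + l' = - b + b'" by (simp only: group_normalize)
  ultimately have "- b + b' = 0" using B(4)[OF assms(2,3)] by (intro triple_small_eq_0) simp_all
  then have "b + (- b + b') = b" by simp
  then show ?thesis by (simp only: group_normalize)
qed

text \<open>
  The translate of \<open>P\<close> by the unique \<open>b \<in> B\<close> for which it meets \<open>\<Lambda>\<close>, cut down to \<open>L\<close>; empty if there is
  no such \<open>b\<close>.
\<close>

definition shift_trace :: "'g set \<Rightarrow> 'g set" where
  "shift_trace P = {l \<in> L. \<exists>b\<in>B. \<exists>l'\<in>\<Lambda>. l' - b \<in> P \<and> l - b \<in> P}"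

text \<open>A priori different points of F could use different shifts; \<open>unique_shift\<close>
  makes them one. Conversely, a shifted copy of P that contains F meets \<open>\<Lambda>\<close> in
  l', as the definition of \<open>shift_trace\<close> requires.\<close>

lemma shift_trace_iff:
  assumes "P \<in> X" "F \<subseteq> L" "l' \<in> F" "l' \<in> \<Lambda>"
  shows "F \<subseteq> shift_trace P \<longleftrightarrow> (\<exists>b\<in>B. \<forall>x\<in>F. x - b \<in> P)"
proof
  assume F: "F \<subseteq> shift_trace P"
  then have "\<forall>x\<in>F. \<exists>b\<in>B. \<exists>l'\<in>\<Lambda>. l' - b \<in> P \<and> x - b \<in> P" unfolding shift_trace_def by blast
  then obtain b l where b: "\<And>x. x \<in> F \<Longrightarrow> b x \<in> B" "\<And>x. x \<in> F \<Longrightarrow> l x \<in> \<Lambda>"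
    "\<And>x. x \<in> F \<Longrightarrow> l x - b x \<in> P" "\<And>x. x \<in> F \<Longrightarrow> x - b x \<in> P" by metis
  have "b x = b l'" if "x \<in> F" for x
    using unique_shift[OF assms(1) b(1)[OF that] b(1)[OF assms(3)] b(2)[OF that] b(2)[OF assms(3)]
      b(3)[OF that] b(3)[OF assms(3)]] .
  then have "\<forall>x\<in>F. x - b l' \<in> P" using b(4) by metis
  then show "\<exists>b\<in>B. \<forall>x\<in>F. x - b \<in> P" using b(1)[OF assms(3)] by blast
next
  assume "\<exists>b\<in>B. \<forall>x\<in>F. x - b \<in> P"
  then show "F \<subseteq> shift_trace P" using assms unfolding shift_trace_def by blast
qed

lemma shift_trace_diff:
  assumes "P \<in> X" "a \<in> shift_trace P" "c \<in> shift_trace P" shows "a - c \<in> \<Lambda>"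
proof -
  obtain b l where 1: "b \<in> B" "l \<in> \<Lambda>" "l - b \<in> P" "a - b \<in> P"
    using assms(2) unfolding shift_trace_def by blast
  obtain b' l' where 2: "b' \<in> B" "l' \<in> \<Lambda>" "l' - b' \<in> P" "c - b' \<in> P"
    using assms(3) unfolding shift_trace_def by blast
  have "b = b'" using unique_shift[OF assms(1) 1(1) 2(1) 1(2) 2(2) 1(3) 2(3)] .
  then have "(a - b) - (c - b) \<in> \<Lambda>" using X_diff[OF assms(1) 1(4)] 2(4) by simp
  moreover have "(a - b) - (c - b) = a - c" by (simp only: group_normalize)
  ultimately show ?thesis by simp
qed

text \<open>The quantifier over the uncountable set \<open>B\<close> becomes countable by rigidity.
  If P hits a small open V at p and d + V at d + v, with d = l - l', then v - p = - d + ((d + v) -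
  p) + 0 is a small triple sum, so v = p and the two points have relative position exactly
  d.\<close>

lemma sets_pattern:
  assumes S: "S \<subseteq> X" and d: "l - l' \<in> \<Lambda>"
  shows "{P \<in> space (borel_of (subtopology chabauty_fell S)). \<exists>b\<in>B. l' - b \<in> P \<and> l - b \<in> P}
    \<in> sets (borel_of (subtopology chabauty_fell S))"
proof -
  let ?M = "borel_of (subtopology chabauty_fell S)"
  define d where "d = l - l'"
  obtain \<B> :: "'g set set" where \<B>: "countable \<B>" "topological_basis \<B>"
    using ex_countable_basis by blast
  \<comment> \<open>A point v = l' - b corresponds to b = - v + l', so the first condition says that
    every point of V comes from a shift in \<open>B\<close>; the second is the smallness that
    \<open>triple_small_eq_0\<close> needs.\<close>
  define \<O> where "\<O> = {V \<in> \<B>. (\<forall>v\<in>V. - v + l' \<in> B) \<and> (\<forall>v\<in>V. \<forall>w\<in>V. v - w \<in> U)}"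
  have op: "V \<in> \<O> \<Longrightarrow> open V" for V
    using topological_basis_open[OF \<B>(2)] unfolding \<O>_def by blast
  have eq: "(\<exists>b\<in>B. l' - b \<in> P \<and> l - b \<in> P) \<longleftrightarrow>
    (\<exists>V\<in>\<O>. P \<inter> V \<noteq> {} \<and> P \<inter> (\<lambda>x. d + x) ` V \<noteq> {})" if P: "P \<in> X" for P
  proof
    assume "\<exists>b\<in>B. l' - b \<in> P \<and> l - b \<in> P"
    then obtain b where b: "b \<in> B" "l' - b \<in> P" "l - b \<in> P" by blast
    let ?N = "(\<lambda>v. - v + l') -` B \<inter> (\<lambda>v. v - (l' - b)) -` B"
    have "open ?N" using B(1) by (intro open_Int open_vimage continuous_intros)
    moreover have "- (l' - b) + l' = b" by (simp only: group_normalize)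
    then have "l' - b \<in> ?N" using B(2) b(1) by simp
    ultimately obtain V where V: "V \<in> \<B>" "l' - b \<in> V" "V \<subseteq> ?N"
      using topological_basisE[OF \<B>(2)] by metis
    have "v - w \<in> U" if "v \<in> V" "w \<in> V" for v w
    proof -
      have "(v - (l' - b)) - (w - (l' - b)) \<in> U" using that V(3) by (intro B(3)) blast+
      moreover have "(v - (l' - b)) - (w - (l' - b)) = v - w" by (simp only: group_normalize)
      ultimately show ?thesis by simp
    qed
    then have "V \<in> \<O>" using V unfolding \<O>_def by blast
    moreover have "l - b = d + (l' - b)" unfolding d_def by (simp only: group_normalize)
    then have "l - b \<in> P \<inter> (\<lambda>x. d + x) ` V" using V(2) b(3) by blast
    ultimately show "\<exists>V\<in>\<O>. P \<inter> V \<noteq> {} \<and> P \<inter> (\<lambda>x. d + x) ` V \<noteq> {}" using b(2) V(2) by blast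
  next
    assume "\<exists>V\<in>\<O>. P \<inter> V \<noteq> {} \<and> P \<inter> (\<lambda>x. d + x) ` V \<noteq> {}"
    then obtain V p v where V: "V \<in> \<O>" "p \<in> P" "p \<in> V" "v \<in> V" "d + v \<in> P" by blast
    have "(d + v) - p \<in> \<Lambda>" using X_diff[OF P] V by blast
    then have "- d + ((d + v) - p) + 0 \<in> \<Lambda> + \<Lambda> + \<Lambda>"
      using uminus_mem[OF d] zero_mem unfolding d_def by (intro add_mem_triple)
    moreover have "- d + ((d + v) - p) + 0 = v - p" by (simp only: group_normalize)
    moreover have "v - p \<in> U" using V unfolding \<O>_def by blast
    ultimately have "v = p" using triple_small_eq_0[of "v - p"] by simp
    have "- p + l' \<in> B" using V unfolding \<O>_def by blast
    moreover have "l' - (- p + l') = p" by (simp only: group_normalize)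
    moreover have "l - (- p + l') = d + p" unfolding d_def by (simp only: group_normalize)
    ultimately show "\<exists>b\<in>B. l' - b \<in> P \<and> l - b \<in> P"
      using V(2,5) \<open>v = p\<close> by (intro bexI[of _ "- p + l'"]) simp_all
  qed
  have "{P \<in> space ?M. \<exists>b\<in>B. l' - b \<in> P \<and> l - b \<in> P} =
    (\<Union>V\<in>\<O>. {P \<in> space ?M. P \<inter> V \<noteq> {}} \<inter> {P \<in> space ?M. P \<inter> (\<lambda>x. d + x) ` V \<noteq> {}})"
  proof (intro Set.set_eqI iffI)
    fix P assume P: "P \<in> {P \<in> space ?M. \<exists>b\<in>B. l' - b \<in> P \<and> l - b \<in> P}"
    then have "P \<in> X" using S unfolding space_borel_of_fell by blast
    from eq[OF this] P obtain V where "V \<in> \<O>" "P \<inter> V \<noteq> {}" "P \<inter> (\<lambda>x. d + x) ` V \<noteq> {}" by blast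
    then show "P \<in> (\<Union>V\<in>\<O>. {P \<in> space ?M. P \<inter> V \<noteq> {}} \<inter>
      {P \<in> space ?M. P \<inter> (\<lambda>x. d + x) ` V \<noteq> {}})" using P by blast
  next
    fix P assume P: "P \<in> (\<Union>V\<in>\<O>. {P \<in> space ?M. P \<inter> V \<noteq> {}} \<inter>
      {P \<in> space ?M. P \<inter> (\<lambda>x. d + x) ` V \<noteq> {}})"
    then have "P \<in> X" using S unfolding space_borel_of_fell by blast
    moreover from P obtain V where "V \<in> \<O>" "P \<inter> V \<noteq> {}" "P \<inter> (\<lambda>x. d + x) ` V \<noteq> {}" by blast
    ultimately have "\<exists>b\<in>B. l' - b \<in> P \<and> l - b \<in> P" using eq by blast
    then show "P \<in> {P \<in> space ?M. \<exists>b\<in>B. l' - b \<in> P \<and> l - b \<in> P}" using P by blast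
  qed
  also have "\<dots> \<in> sets ?M"
  proof (intro sets.countable_UN'' sets.Int sets_borel_of_hit)
    show "countable \<O>" unfolding \<O>_def using \<B>(1) by simp
    show "open V" "open ((\<lambda>x. d + x) ` V)" if "V \<in> \<O>" for V
      using op[OF that] by (auto intro: open_translate_left)
  qed
  finally show ?thesis .
qed

end

section \<open>Pattern probabilities of the aligned random set\<close>

lemma distr_shift_emeasure:
  fixes m :: "'g::topological_group_add measure"
  assumes "sets m = sets borel" "distr m m (\<lambda>x. x + g) = m" "A \<in> sets borel"
  shows "emeasure m {x. x + g \<in> A} = emeasure m A"
proof -
  have "(\<lambda>x. x + g) \<in> borel \<rightarrow>\<^sub>M borel"
    by (intro borel_measurable_continuous_onI continuous_intros)
  then have me: "(\<lambda>x. x + g) \<in> m \<rightarrow>\<^sub>M m" using assms(1) measurable_cong_sets by blast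
  have sp: "space m = UNIV" using sets_eq_imp_space_eq[OF assms(1)] by simp
  have "emeasure m A = emeasure (distr m m (\<lambda>x. x + g)) A" using assms(2) by simp
  also have "\<dots> = emeasure m ((\<lambda>x. x + g) -` A \<inter> space m)"
    using assms by (intro emeasure_distr me) auto
  also have "(\<lambda>x. x + g) -` A \<inter> space m = {x. x + g \<in> A}" using sp by auto
  finally show ?thesis by simp
qed

lemma cylinder_measurable [measurable]:
  "finite F \<Longrightarrow> {Z \<in> Pow L. F \<subseteq> Z} \<in> sets (pow_measurable L)"
proof (induction F rule: finite_induct)
  case empty
  have "{Z \<in> Pow L. {} \<subseteq> Z} = space (pow_measurable L)" by auto
  then show ?case by (simp only: sets.top)
next
  case (insert x F)
  have "{Z \<in> Pow L. insert x F \<subseteq> Z} = {Z \<in> Pow L. x \<in> Z} \<inter> {Z \<in> Pow L. F \<subseteq> Z}" by blast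
  then show ?case using insert.IH by (simp only: sets.Int sets_pow_measurable_mem)
qed

text \<open>The events F \<subseteq> Z form a generating class closed under intersection, as two of
  them meet in the event for the union of the patterns. Only these events are tested because their
  probabilities multiply when independent random sets are intersected.\<close>

lemma pow_measure_eqI:
  assumes "sets M = sets (pow_measurable L)" "sets N = sets (pow_measurable L)" "finite_measure M"
    and eq: "\<And>F. finite F \<Longrightarrow> F \<subseteq> L \<Longrightarrow> emeasure M {Z \<in> Pow L. F \<subseteq> Z} = emeasure N {Z \<in> Pow L. F \<subseteq> Z}"
  shows "M = N"
proof -
  let ?E = "{{Z \<in> Pow L. F \<subseteq> Z} | F. finite F \<and> F \<subseteq> L}"
  have gen: "sets (pow_measurable L) = sigma_sets (Pow L) ?E"
  proof
    have "(\<lambda>l. {Z \<in> Pow L. l \<in> Z}) ` L \<subseteq> ?E"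
    proof safe
      fix l assume "l \<in> L"
      then show "\<exists>F. {Z \<in> Pow L. l \<in> Z} = {Z \<in> Pow L. F \<subseteq> Z} \<and> finite F \<and> F \<subseteq> L"
        by (intro exI[of _ "{l}"]) auto
    qed
    then show "sets (pow_measurable L) \<subseteq> sigma_sets (Pow L) ?E"
      unfolding sets_pow_measurable by (rule sigma_sets_mono')
    have "?E \<subseteq> sets (pow_measurable L)" using cylinder_measurable by blast
    then show "sigma_sets (Pow L) ?E \<subseteq> sets (pow_measurable L)"
      using sets.sigma_sets_subset[of ?E "pow_measurable L"] by simp
  qed
  interpret M: finite_measure M by fact
  show ?thesis
  proof (rule measure_eqI_generator_eq[where E = ?E and \<Omega> = "Pow L" and A = "\<lambda>_. Pow L"])
    show "Int_stable ?E"
    proof (rule Int_stableI)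
      fix a b assume "a \<in> ?E" "b \<in> ?E"
      then obtain F G where FG: "finite F" "F \<subseteq> L" "a = {Z \<in> Pow L. F \<subseteq> Z}"
        "finite G" "G \<subseteq> L" "b = {Z \<in> Pow L. G \<subseteq> Z}" by blast
      have "a \<inter> b = {Z \<in> Pow L. F \<union> G \<subseteq> Z}" unfolding FG by auto
      then show "a \<inter> b \<in> ?E" using FG by (intro CollectI exI[of _ "F \<union> G"]) simp
    qed
    show "emeasure M Y = emeasure N Y" if "Y \<in> ?E" for Y using that eq by auto
    show "range (\<lambda>_. Pow L) \<subseteq> ?E" by blast
  qed (use assms gen in auto)
qed

context return_set
begin

lemma measurable_shift_trace:
  assumes "S \<subseteq> X"
  shows "shift_trace \<in> borel_of (subtopology chabauty_fell S) \<rightarrow>\<^sub>M pow_measurable L"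
proof (rule measurable_pow_measurable)
  let ?M = "borel_of (subtopology chabauty_fell S)"
  show "shift_trace P \<subseteq> L" for P unfolding shift_trace_def by blast
  fix l assume l: "l \<in> L"
  have "{P \<in> space ?M. l \<in> shift_trace P} =
    (\<Union>l'\<in>{l' \<in> \<Lambda>. l - l' \<in> \<Lambda>}. {P \<in> space ?M. \<exists>b\<in>B. l' - b \<in> P \<and> l - b \<in> P})"
  proof (intro Set.set_eqI iffI)
    fix P assume P: "P \<in> {P \<in> space ?M. l \<in> shift_trace P}"
    then have PX: "P \<in> X" using assms unfolding space_borel_of_fell by blast
    obtain b l' where b: "b \<in> B" "l' \<in> \<Lambda>" "l' - b \<in> P" "l - b \<in> P"
      using P unfolding shift_trace_def by blast
    have "(l - b) - (l' - b) \<in> \<Lambda>" using X_diff[OF PX b(4,3)] .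
    moreover have "(l - b) - (l' - b) = l - l'" by (simp only: group_normalize)
    ultimately show "P \<in> (\<Union>l'\<in>{l' \<in> \<Lambda>. l - l' \<in> \<Lambda>}. {P \<in> space ?M. \<exists>b\<in>B. l' - b \<in> P \<and> l - b \<in> P})"
      using b P by (intro UN_I[of l']) auto
  next
    fix P assume "P \<in> (\<Union>l'\<in>{l' \<in> \<Lambda>. l - l' \<in> \<Lambda>}. {P \<in> space ?M. \<exists>b\<in>B. l' - b \<in> P \<and> l - b \<in> P})"
    then show "P \<in> {P \<in> space ?M. l \<in> shift_trace P}" using l unfolding shift_trace_def by blast
  qed
  also have "\<dots> \<in> sets ?M"
  proof (rule sets.countable_UN'')
    show "countable {l' \<in> \<Lambda>. l - l' \<in> \<Lambda>}" using countable_return(3) by simp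
    show "{P \<in> space ?M. \<exists>b\<in>B. l' - b \<in> P \<and> l - b \<in> P} \<in> sets ?M"
      if "l' \<in> {l' \<in> \<Lambda>. l - l' \<in> \<Lambda>}" for l'
      using that by (intro sets_pattern assms) blast
  qed
  finally show "{P \<in> space ?M. l \<in> shift_trace P} \<in> sets ?M" .
qed

text \<open>The defining formula of the transverse measure, for the test function that asks g + f to
  lie in \<open>B\<close> and F - f to be contained in Q. Exactly one point of P, namely f - b,
  contributes to the inner sum when the aligned set contains F, and none otherwise. The right-hand
  side sees F only through F - f, which is the source of the shift invariance of patterns.\<close>

lemma emeasure_shift_trace:
  assumes P0: "difference_set P0 = \<Lambda>" and m: "sets m = sets borel" "\<And>g. distr m m (\<lambda>x. x + g) = m"
    and \<mu>: "sets \<mu> = sets (borel_punctured_hull P0)" and tr: "is_transverse_measure m P0 \<mu> \<nu>"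
    and F: "finite F" "F \<subseteq> L" "l' \<in> F" "l' \<in> \<Lambda>" "f \<in> F"
  shows "emeasure \<mu> {P \<in> space \<mu>. F \<subseteq> shift_trace P} =
    emeasure m B * emeasure \<nu> {Q \<in> space \<nu>. \<forall>x\<in>F. x - f \<in> Q}"
proof -
  have hull: "punctured_hull P0 \<subseteq> X" "transversal P0 \<subseteq> X"
    using orbit_hull_subset[OF P0] unfolding punctured_hull_def transversal_def by blast+
  have sp\<mu>: "space \<mu> = {P \<in> punctured_hull P0. closed P}"
    using sets_eq_imp_space_eq[OF \<mu>] unfolding borel_punctured_hull_def space_borel_of_fell .
  then have \<mu>X: "P \<in> X" if "P \<in> space \<mu>" for P using that hull by blast
  have \<nu>s: "sets \<nu> = sets (borel_transversal P0)" and "finite_measure \<nu>"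
    using tr unfolding is_transverse_measure_def by auto
  interpret \<nu>: finite_measure \<nu> by fact
  have sp\<nu>: "space \<nu> = space (borel_transversal P0)" by (rule sets_eq_imp_space_eq[OF \<nu>s])
  let ?C = "{Q. \<forall>x\<in>F. x - f \<in> Q}"
  have C: "{Q \<in> space (borel_transversal P0). \<forall>x\<in>F. x - f \<in> Q} \<in> sets (borel_transversal P0)"
    unfolding borel_transversal_def using F(1) by (intro sets.sets_Collect_finite_All' sets_borel_of_mem) (use F in auto)
  have oB: "open {g. g + f \<in> B}"
    using open_vimage[OF B(1), of "\<lambda>g. g + f"] by (simp add: vimage_def continuous_intros)
  define h :: "'g \<times> 'g set \<Rightarrow> real" where
    "h = (\<lambda>(g, Q). indicator {g. g + f \<in> B} g * indicator ?C Q)"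
  have hm: "h \<in> borel_measurable (borel \<Otimes>\<^sub>M borel_transversal P0)"
  proof -
    have 1: "(indicator {g. g + f \<in> B} :: 'g \<Rightarrow> real) \<in> borel_measurable borel" using oB by (intro borel_measurable_indicator) simp
    have "?C \<inter> space (borel_transversal P0) = {Q \<in> space (borel_transversal P0). \<forall>x\<in>F. x - f \<in> Q}" by auto
    then have 2: "(indicator ?C :: 'g set \<Rightarrow> real) \<in> borel_measurable (borel_transversal P0)"
      using C by (subst borel_measurable_indicator_iff) simp
    show ?thesis unfolding h_def using 1 2 by (simp add: case_prod_beta')
  qed
  have "\<exists>C. \<forall>g. \<forall>Q\<in>transversal P0. 0 \<le> h (g, Q) \<and> h (g, Q) \<le> C"
    by (intro exI[of _ 1]) (auto simp: h_def indicator_def)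
  then have eq: "(\<integral>\<^sup>+ P. (\<integral>\<^sup>+ p. ennreal (h (- p, translate p P)) \<partial>count_space P) \<partial>\<mu>)
        = (\<integral>\<^sup>+ g. (\<integral>\<^sup>+ Q. ennreal (h (g, Q)) \<partial>\<nu>) \<partial>m)"
    using tr hm unfolding is_transverse_measure_def by blast
  have inner: "(\<integral>\<^sup>+ p. ennreal (h (- p, translate p P)) \<partial>count_space P) =
    indicator {P \<in> space \<mu>. F \<subseteq> shift_trace P} P" if P: "P \<in> space \<mu>" for P
  proof -
    \<comment> \<open>The points p of P that contribute to the sum: with b = - p + f the condition x
      - f + p \<in> P reads x - b \<in> P.\<close>
    define A where "A = {p \<in> P. - p + f \<in> B \<and> (\<forall>x\<in>F. x - f + p \<in> P)}"
    have "(\<integral>\<^sup>+ p. ennreal (h (- p, translate p P)) \<partial>count_space P) = (\<integral>\<^sup>+ p. indicator A p \<partial>count_space P)"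
      by (intro nn_integral_cong) (auto simp: h_def A_def mem_translate indicator_def)
    also have "\<dots> = emeasure (count_space P) A" by (intro nn_integral_indicator) (auto simp: A_def)
    also have "\<dots> = indicator {P \<in> space \<mu>. F \<subseteq> shift_trace P} P"
    proof (cases "F \<subseteq> shift_trace P")
      case True
      then obtain b where b: "b \<in> B" "\<And>x. x \<in> F \<Longrightarrow> x - b \<in> P"
        using shift_trace_iff[OF \<mu>X[OF P] F(2-4)] by blast
      have "A = {f - b}"
      proof (intro Set.set_eqI iffI)
        fix p assume "p \<in> {f - b}"
        then have p: "p = f - b" by simp
        have 1: "- p + f = b" "\<And>x. x - f + p = x - b" unfolding p by (simp_all only: group_normalize)
        have "p \<in> P" using b F(5) unfolding p by blast
        then have "p \<in> P \<and> - p + f \<in> B \<and> (\<forall>x\<in>F. x - f + p \<in> P)" unfolding 1 using b by blast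
        then show "p \<in> A" unfolding A_def by blast
      next
        fix p assume "p \<in> A"
        then have p: "- p + f \<in> B" "l' - f + p \<in> P" using F(3) unfolding A_def by blast+
        have "l' - f + p = l' - (- p + f)" by (simp only: group_normalize)
        then have "- p + f = b"
          using unique_shift[OF \<mu>X[OF P] p(1) b(1) F(4) F(4)] p(2) b(2)[OF F(3)] by simp
        moreover have "f - (- p + f) = p" by (simp only: group_normalize)
        ultimately show "p \<in> {f - b}" by simp
      qed
      moreover have "f - b \<in> P" using b F by blast
      ultimately show ?thesis using True P by (simp add: emeasure_count_space)
    next
      case False
      have "A = {}"
      proof (rule ccontr)
        assume "A \<noteq> {}"
        then obtain p where p: "- p + f \<in> B" "\<forall>x\<in>F. x - f + p \<in> P" unfolding A_def by blast
        have "x - f + p = x - (- p + f)" for x by (simp only: group_normalize)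
        then have "F \<subseteq> shift_trace P"
          using shift_trace_iff[OF \<mu>X[OF P] F(2-4)] p by auto
        then show False using False by simp
      qed
      then show ?thesis using False by simp
    qed
    finally show ?thesis .
  qed
  have meas: "{P \<in> space \<mu>. F \<subseteq> shift_trace P} \<in> sets \<mu>"
  proof -
    have "shift_trace \<in> \<mu> \<rightarrow>\<^sub>M pow_measurable L"
      using measurable_shift_trace[OF hull(1)] \<mu> unfolding borel_punctured_hull_def
      by (metis measurable_cong_sets)
    from measurable_sets[OF this cylinder_measurable[OF F(1), of L]]
    have "shift_trace -` {Z \<in> Pow L. F \<subseteq> Z} \<inter> space \<mu> \<in> sets \<mu>" .
    moreover have "shift_trace P \<subseteq> L" for P unfolding shift_trace_def by blast
    then have "shift_trace -` {Z \<in> Pow L. F \<subseteq> Z} \<inter> space \<mu> = {P \<in> space \<mu>. F \<subseteq> shift_trace P}" by blast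
    ultimately show ?thesis by simp
  qed
  have "emeasure \<mu> {P \<in> space \<mu>. F \<subseteq> shift_trace P} =
    (\<integral>\<^sup>+ P. indicator {P \<in> space \<mu>. F \<subseteq> shift_trace P} P \<partial>\<mu>)"
    using meas by simp
  also have "\<dots> = (\<integral>\<^sup>+ g. (\<integral>\<^sup>+ Q. ennreal (h (g, Q)) \<partial>\<nu>) \<partial>m)"
    unfolding eq[symmetric] by (intro nn_integral_cong) (simp only: inner)
  also have "\<dots> = (\<integral>\<^sup>+ g. indicator {g. g + f \<in> B} g * emeasure \<nu> {Q \<in> space \<nu>. \<forall>x\<in>F. x - f \<in> Q} \<partial>m)"
  proof (intro nn_integral_cong)
    fix g
    have "(\<integral>\<^sup>+ Q. ennreal (h (g, Q)) \<partial>\<nu>) =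
      (\<integral>\<^sup>+ Q. indicator {g. g + f \<in> B} g * indicator {Q \<in> space \<nu>. \<forall>x\<in>F. x - f \<in> Q} Q \<partial>\<nu>)"
      by (intro nn_integral_cong) (auto simp: h_def indicator_def)
    also have "\<dots> = indicator {g. g + f \<in> B} g * emeasure \<nu> {Q \<in> space \<nu>. \<forall>x\<in>F. x - f \<in> Q}"
      using C \<nu>s sp\<nu> by (subst nn_integral_cmult) (simp_all add: nn_integral_indicator)
    finally show "(\<integral>\<^sup>+ Q. ennreal (h (g, Q)) \<partial>\<nu>) =
      indicator {g. g + f \<in> B} g * emeasure \<nu> {Q \<in> space \<nu>. \<forall>x\<in>F. x - f \<in> Q}" .
  qed
  also have "\<dots> = emeasure m {g. g + f \<in> B} * emeasure \<nu> {Q \<in> space \<nu>. \<forall>x\<in>F. x - f \<in> Q}"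
  proof -
    have "{g. g + f \<in> B} \<in> sets m" using oB m(1) by simp
    then show ?thesis by (subst nn_integral_multc) (simp_all add: nn_integral_indicator)
  qed
  \<comment> \<open>Right invariance of \<open>m\<close>, available through unimodularity, removes
    the dependence on f.\<close>
  also have "emeasure m {g. g + f \<in> B} = emeasure m B"
    using B(1) by (intro distr_shift_emeasure m) simp
  finally show ?thesis .
qed

end

section \<open>Intersections of independent copies\<close>

lemma measurable_Inter_pow:
  assumes "finite I" "I \<noteq> {}" and "\<And>i. i \<in> I \<Longrightarrow> sets (M i) = sets N"
    and f: "\<And>x. x \<in> space N \<Longrightarrow> x \<subseteq> L" "\<And>l. l \<in> L \<Longrightarrow> {x \<in> space N. l \<in> x} \<in> sets N"
  shows "(\<lambda>P. \<Inter>i\<in>I. P i) \<in> PiM I M \<rightarrow>\<^sub>M pow_measurable L"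
proof (rule measurable_pow_measurable)
  have sp: "space (M i) = space N" if "i \<in> I" for i
    using assms(3)[OF that] by (rule sets_eq_imp_space_eq)
  fix P assume "P \<in> space (PiM I M)"
  then have "P i \<subseteq> L" if "i \<in> I" for i using f(1) sp that by (auto simp: space_PiM PiE_def Pi_def)
  then show "(\<Inter>i\<in>I. P i) \<subseteq> L" using assms(2) by blast
next
  have sp: "space (M i) = space N" if "i \<in> I" for i
    using assms(3)[OF that] by (rule sets_eq_imp_space_eq)
  fix l assume l: "l \<in> L"
  have "{P \<in> space (PiM I M). l \<in> (\<Inter>i\<in>I. P i)} = PiE I (\<lambda>i. {x \<in> space N. l \<in> x})"
    using sp by (auto simp: space_PiM PiE_def Pi_def)
  also have "\<dots> \<in> sets (PiM I M)"
    using f(2)[OF l] assms(1,3) by (intro sets_PiM_I_finite) auto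
  finally show "{P \<in> space (PiM I M). l \<in> (\<Inter>i\<in>I. P i)} \<in> sets (PiM I M)" .
qed

text \<open>F lies in the intersection iff it lies in every factor, so independence yields a power.
  \<open>N\<close> is kept general because the lemma serves both the law of the aligned set and
  \<open>\<nu>\<close> itself.\<close>

lemma emeasure_Inter_pow:
  fixes I :: "nat set"
  assumes "finite I" "I \<noteq> {}" and N: "finite_measure N"
    and f: "\<And>x. x \<in> space N \<Longrightarrow> x \<subseteq> L" "\<And>l. l \<in> L \<Longrightarrow> {x \<in> space N. l \<in> x} \<in> sets N"
    and F: "finite F" "F \<subseteq> L"
  shows "emeasure (distr (PiM I (\<lambda>_. N)) (pow_measurable L) (\<lambda>P. \<Inter>i\<in>I. P i)) {Z \<in> Pow L. F \<subseteq> Z}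
    = emeasure N {x \<in> space N. F \<subseteq> x} ^ card I"
proof -
  interpret N: finite_measure N by fact
  interpret product_sigma_finite "\<lambda>_ :: nat. N" ..
  let ?P = "PiM I (\<lambda>_. N)"
  have meas: "{x \<in> space N. F \<subseteq> x} \<in> sets N" using F
  proof (induction F rule: finite_induct)
    case (insert y F)
    have "{x \<in> space N. insert y F \<subseteq> x} = {x \<in> space N. y \<in> x} \<inter> {x \<in> space N. F \<subseteq> x}" by auto
    then show ?case using insert f(2) by simp
  qed simp
  have "(\<lambda>P. \<Inter>i\<in>I. P i) -` {Z \<in> Pow L. F \<subseteq> Z} \<inter> space ?P = PiE I (\<lambda>_. {x \<in> space N. F \<subseteq> x})"
  proof (intro Set.set_eqI iffI)
    fix P assume "P \<in> (\<lambda>P. \<Inter>i\<in>I. P i) -` {Z \<in> Pow L. F \<subseteq> Z} \<inter> space ?P"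
    then show "P \<in> PiE I (\<lambda>_. {x \<in> space N. F \<subseteq> x})" by (auto simp: space_PiM PiE_def Pi_def)
  next
    fix P assume P: "P \<in> PiE I (\<lambda>_. {x \<in> space N. F \<subseteq> x})"
    then have "P i \<subseteq> L \<and> F \<subseteq> P i" if "i \<in> I" for i using f(1) that by (auto simp: PiE_def Pi_def)
    then have "(\<Inter>i\<in>I. P i) \<subseteq> L" "F \<subseteq> (\<Inter>i\<in>I. P i)" using assms(2) by blast+
    then show "P \<in> (\<lambda>P. \<Inter>i\<in>I. P i) -` {Z \<in> Pow L. F \<subseteq> Z} \<inter> space ?P"
      using P by (auto simp: space_PiM PiE_def Pi_def)
  qed
  then have "emeasure (distr ?P (pow_measurable L) (\<lambda>P. \<Inter>i\<in>I. P i)) {Z \<in> Pow L. F \<subseteq> Z} =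
    emeasure ?P (PiE I (\<lambda>_. {x \<in> space N. F \<subseteq> x}))"
    using measurable_Inter_pow[OF assms(1,2), of "\<lambda>_. N" N L] f cylinder_measurable[OF F(1), of L]
    by (simp add: emeasure_distr)
  also have "\<dots> = (\<Prod>i\<in>I. emeasure N {x \<in> space N. F \<subseteq> x})"
    using meas assms(1) by (intro emeasure_PiM) auto
  finally show ?thesis by simp
qed

context return_set
begin

text \<open>Equalities between pattern probabilities, and their vanishing, survive the passage to
  r-th powers. The last claim holds because on the event 0 \<in> Z the measure \<open>\<rho>\<close>
  equals the law of the intersection under the r-fold power of \<open>\<nu>\<close>, up to the
  factor \<open>emeasure m B ^ r\<close>.\<close>

lemma exists_intersection_measure:
  fixes r :: nat
  assumes P0: "difference_set P0 = \<Lambda>" and m: "sets m = sets borel" "\<And>g. distr m m (\<lambda>x. x + g) = m"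
    and mB: "emeasure m B \<noteq> 0"
    and \<mu>: "sets \<mu> = sets (borel_punctured_hull P0)" "prob_space \<mu>"
    and tr: "is_transverse_measure m P0 \<mu> \<nu>" and r: "r \<ge> 1"
  obtains \<rho> where "sets \<rho> = sets (pow_measurable L)" "prob_space \<rho>"
    "\<And>a c. a \<in> L \<Longrightarrow> c \<in> L \<Longrightarrow> a - c \<notin> \<Lambda> \<Longrightarrow> emeasure \<rho> {Z \<in> Pow L. {a, c} \<subseteq> Z} = 0"
    "\<And>F c. finite F \<Longrightarrow> F \<subseteq> L \<Longrightarrow> F \<inter> \<Lambda> \<noteq> {} \<Longrightarrow> (\<lambda>x. x + c) ` F \<subseteq> L \<Longrightarrow>
      (\<lambda>x. x + c) ` F \<inter> \<Lambda> \<noteq> {} \<Longrightarrow>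
      emeasure \<rho> {Z \<in> Pow L. (\<lambda>x. x + c) ` F \<subseteq> Z} = emeasure \<rho> {Z \<in> Pow L. F \<subseteq> Z}"
    "\<And>A. A \<in> sets (pow_measurable L) \<Longrightarrow> A \<subseteq> {Z. 0 \<in> Z} \<Longrightarrow> emeasure \<rho> A = 0 \<Longrightarrow>
      AE Q in (\<Pi>\<^sub>M i\<in>{1..r}. \<nu>). (\<Inter>i\<in>{1..r}. Q i) \<notin> A"
proof -
  have hull: "punctured_hull P0 \<subseteq> X" "transversal P0 \<subseteq> X"
    using orbit_hull_subset[OF P0] unfolding punctured_hull_def transversal_def by blast+
  have \<nu>s: "sets \<nu> = sets (borel_transversal P0)" and fin\<nu>: "finite_measure \<nu>"
    using tr unfolding is_transverse_measure_def by auto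
  interpret \<nu>: finite_measure \<nu> by fact
  have "space \<nu> = space (borel_transversal P0)" by (rule sets_eq_imp_space_eq[OF \<nu>s])
  then have sp\<nu>: "space \<nu> = {Q \<in> transversal P0. closed Q}"
    unfolding borel_transversal_def space_borel_of_fell .
  have \<nu>mem: "{Q \<in> space \<nu>. l \<in> Q} \<in> sets \<nu>" for l
    using sets_borel_of_mem[of "transversal P0" l] \<nu>s \<open>space \<nu> = space (borel_transversal P0)\<close>
    unfolding borel_transversal_def by simp
  have \<nu>0: "0 \<in> Q" if "Q \<in> space \<nu>" for Q using that unfolding sp\<nu> transversal_def by simp
  have \<nu>L: "Q \<subseteq> L" if "Q \<in> space \<nu>" for Q
    using that hull(2) \<nu>0[OF that] X_subset_Lambda[of Q] L_subset(1) unfolding sp\<nu> by blast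
  have st: "shift_trace \<in> \<mu> \<rightarrow>\<^sub>M pow_measurable L"
    using measurable_shift_trace[OF hull(1)] \<mu>(1) unfolding borel_punctured_hull_def
    by (simp cong: measurable_cong_sets)
  have sp\<mu>: "space \<mu> = {P \<in> punctured_hull P0. closed P}"
    using sets_eq_imp_space_eq[OF \<mu>(1)] unfolding borel_punctured_hull_def space_borel_of_fell .
  define \<rho>1 where "\<rho>1 = distr \<mu> (pow_measurable L) shift_trace"
  interpret \<mu>: prob_space \<mu> by fact
  interpret \<rho>1: prob_space \<rho>1 unfolding \<rho>1_def by (rule \<mu>.prob_space_distr[OF st])
  have \<rho>1_cyl: "emeasure \<rho>1 {Z \<in> Pow L. F \<subseteq> Z} = emeasure \<mu> {P \<in> space \<mu>. F \<subseteq> shift_trace P}"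
    if "finite F" for F
  proof -
    have "shift_trace -` {Z \<in> Pow L. F \<subseteq> Z} \<inter> space \<mu> = {P \<in> space \<mu>. F \<subseteq> shift_trace P}"
      unfolding shift_trace_def by auto
    then show ?thesis
      unfolding \<rho>1_def using st cylinder_measurable[OF that, of L] by (simp add: emeasure_distr)
  qed
  have \<rho>1_val: "emeasure \<rho>1 {Z \<in> Pow L. F \<subseteq> Z} =
      emeasure m B * emeasure \<nu> {Q \<in> space \<nu>. \<forall>x\<in>F. x - f \<in> Q}"
    if F: "finite F" "F \<subseteq> L" "F \<inter> \<Lambda> \<noteq> {}" "f \<in> F" for F f
  proof -
    obtain l' where "l' \<in> F" "l' \<in> \<Lambda>" using F(3) by blast
    then show ?thesis
      unfolding \<rho>1_cyl[OF F(1)] using F by (intro emeasure_shift_trace[OF P0 m \<mu>(1) tr]) auto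
  qed
  define I where "I = {1..r}"
  have I: "finite I" "I \<noteq> {}" unfolding I_def using r by auto
  define \<rho> where "\<rho> = distr (PiM I (\<lambda>_. \<rho>1)) (pow_measurable L) (\<lambda>P. \<Inter>i\<in>I. P i)"
  define \<nu>' where "\<nu>' = distr (PiM I (\<lambda>_. \<nu>)) (pow_measurable L) (\<lambda>P. \<Inter>i\<in>I. P i)"
  have sp\<rho>1: "space \<rho>1 = Pow L" unfolding \<rho>1_def by simp
  have \<rho>1s: "sets \<rho>1 = sets (pow_measurable L)" unfolding \<rho>1_def by simp
  have \<rho>1f: "Z \<in> space \<rho>1 \<Longrightarrow> Z \<subseteq> L" "{Z \<in> space \<rho>1. l \<in> Z} \<in> sets \<rho>1" for Z l
    unfolding sp\<rho>1 \<rho>1s by (auto simp only: PowD sets_pow_measurable_mem)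
  have \<rho>_cyl: "emeasure \<rho> {Z \<in> Pow L. F \<subseteq> Z} = emeasure \<rho>1 {Z \<in> Pow L. F \<subseteq> Z} ^ card I"
    if "finite F" "F \<subseteq> L" for F
    unfolding \<rho>_def using emeasure_Inter_pow[OF I \<rho>1.finite_measure_axioms \<rho>1f that] unfolding sp\<rho>1 .
  have \<nu>'_cyl: "emeasure \<nu>' {Z \<in> Pow L. F \<subseteq> Z} = emeasure \<nu> {Q \<in> space \<nu>. F \<subseteq> Q} ^ card I"
    if "finite F" "F \<subseteq> L" for F
    unfolding \<nu>'_def by (rule emeasure_Inter_pow[OF I fin\<nu> \<nu>L \<nu>mem that])
  have meas\<rho>: "(\<lambda>P. \<Inter>i\<in>I. P i) \<in> PiM I (\<lambda>_. \<rho>1) \<rightarrow>\<^sub>M pow_measurable L"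
    by (rule measurable_Inter_pow[OF I refl \<rho>1f])
  have meas\<nu>: "(\<lambda>P. \<Inter>i\<in>I. P i) \<in> PiM I (\<lambda>_. \<nu>) \<rightarrow>\<^sub>M pow_measurable L"
    by (rule measurable_Inter_pow[OF I refl \<nu>L \<nu>mem])
  interpret P1: prob_space "PiM I (\<lambda>_. \<rho>1)"
    by (intro prob_space_PiM \<rho>1.prob_space_axioms)
  interpret \<rho>: prob_space \<rho> unfolding \<rho>_def by (rule P1.prob_space_distr[OF meas\<rho>])
  show ?thesis
  proof (rule that)
    show \<rho>s: "sets \<rho> = sets (pow_measurable L)" unfolding \<rho>_def by simp
    show "prob_space \<rho>" by (rule \<rho>.prob_space_axioms)
    show "emeasure \<rho> {Z \<in> Pow L. {a, c} \<subseteq> Z} = 0" if ac: "a \<in> L" "c \<in> L" "a - c \<notin> \<Lambda>" for a c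
    proof -
      have "emeasure \<rho>1 {Z \<in> Pow L. {a, c} \<subseteq> Z} = emeasure \<mu> {P \<in> space \<mu>. {a, c} \<subseteq> shift_trace P}"
        by (rule \<rho>1_cyl) simp
      also have "{P \<in> space \<mu>. {a, c} \<subseteq> shift_trace P} = {}"
      proof -
        have "\<not> {a, c} \<subseteq> shift_trace P" if "P \<in> space \<mu>" for P
          using shift_trace_diff[of P a c] ac(3) that hull(1) unfolding sp\<mu> by blast
        then show ?thesis by blast
      qed
      finally have "emeasure \<rho>1 {Z \<in> Pow L. {a, c} \<subseteq> Z} = 0" by (simp only: emeasure_empty)
      moreover have "card I \<noteq> 0" using I by simp
      ultimately show ?thesis using ac \<rho>_cyl[of "{a, c}"] by simp
    qed
    show "emeasure \<rho> {Z \<in> Pow L. (\<lambda>x. x + c) ` F \<subseteq> Z} = emeasure \<rho> {Z \<in> Pow L. F \<subseteq> Z}"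
      if F: "finite F" "F \<subseteq> L" "F \<inter> \<Lambda> \<noteq> {}" "(\<lambda>x. x + c) ` F \<subseteq> L" "(\<lambda>x. x + c) ` F \<inter> \<Lambda> \<noteq> {}" for F c
    proof -
      obtain f where f: "f \<in> F" using F(3) by blast
      \<comment> \<open>F + c based at f + c and F based at f give the same condition on Q, so
        \<open>\<rho>1_val\<close> assigns both patterns the same probability.\<close>
      have "x + c - (f + c) = x - f" for x by (simp only: group_normalize)
      then have "{Q \<in> space \<nu>. \<forall>x\<in>(\<lambda>x. x + c) ` F. x - (f + c) \<in> Q} = {Q \<in> space \<nu>. \<forall>x\<in>F. x - f \<in> Q}"
        by simp
      then have "emeasure \<rho>1 {Z \<in> Pow L. (\<lambda>x. x + c) ` F \<subseteq> Z} = emeasure \<rho>1 {Z \<in> Pow L. F \<subseteq> Z}"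
        using \<rho>1_val[OF F(1-3) f] \<rho>1_val[OF _ F(4,5), of "f + c"] F(1) f by simp
      then show ?thesis using \<rho>_cyl[OF F(1,2)] \<rho>_cyl[OF _ F(4)] F(1) by simp
    qed
    fix A assume A: "A \<in> sets (pow_measurable L)" "A \<subseteq> {Z. 0 \<in> Z}" "emeasure \<rho> A = 0"
    let ?V = "{Z \<in> Pow L. 0 \<in> Z}"
    have V: "?V \<in> sets (pow_measurable L)" by (rule sets_pow_measurable_mem)
    let ?M1 = "density \<rho> (indicator ?V)" and ?M2 = "density \<nu>' (\<lambda>_. emeasure m B ^ card I)"
    have \<nu>'s: "sets \<nu>' = sets (pow_measurable L)" unfolding \<nu>'_def by simp
    have e1: "emeasure ?M1 Y = emeasure \<rho> (?V \<inter> Y)" if "Y \<in> sets (pow_measurable L)" for Y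
      using that V \<rho>s by (subst emeasure_density) (simp_all add: nn_integral_indicator indicator_inter_arith[symmetric])
    have e2: "emeasure ?M2 Y = emeasure m B ^ card I * emeasure \<nu>' Y" if "Y \<in> sets (pow_measurable L)" for Y
      using that \<nu>'s by (subst emeasure_density) (simp_all add: nn_integral_cmult_indicator)
    \<comment> \<open>Both sides are compared on patterns. Adjoining 0 to F makes the pattern meet
      \<open>\<Lambda>\<close>, and 0 can serve as its base point.\<close>
    have "?M1 = ?M2"
    proof (rule pow_measure_eqI)
      show "sets ?M1 = sets (pow_measurable L)" "sets ?M2 = sets (pow_measurable L)" using \<rho>s \<nu>'s by simp_all
      have "emeasure ?M1 (space ?M1) \<noteq> \<infinity>"
        using e1[OF sets.top] sets_eq_imp_space_eq[OF \<rho>s] by simp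
      then show "finite_measure ?M1" by (rule finite_measureI)
      fix F :: "'g set" assume F: "finite F" "F \<subseteq> L"
      have zL: "0 \<in> L" using zero_mem L_subset(1) by blast
      have "?V \<inter> {Z \<in> Pow L. F \<subseteq> Z} = {Z \<in> Pow L. insert 0 F \<subseteq> Z}" by auto
      then have "emeasure ?M1 {Z \<in> Pow L. F \<subseteq> Z} = emeasure \<rho> {Z \<in> Pow L. insert 0 F \<subseteq> Z}"
        using e1[OF cylinder_measurable[OF F(1)]] by simp
      also have "\<dots> = (emeasure m B * emeasure \<nu> {Q \<in> space \<nu>. \<forall>x\<in>insert 0 F. x - 0 \<in> Q}) ^ card I"
        using F zL zero_mem \<rho>_cyl[of "insert 0 F"] \<rho>1_val[of "insert 0 F" 0] by simp
      also have "{Q \<in> space \<nu>. \<forall>x\<in>insert 0 F. x - 0 \<in> Q} = {Q \<in> space \<nu>. F \<subseteq> Q}"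
        using \<nu>0 by auto
      also have "(emeasure m B * emeasure \<nu> {Q \<in> space \<nu>. F \<subseteq> Q}) ^ card I = emeasure ?M2 {Z \<in> Pow L. F \<subseteq> Z}"
        using e2[OF cylinder_measurable[OF F(1)]] \<nu>'_cyl[OF F] by (simp add: power_mult_distrib)
      finally show "emeasure ?M1 {Z \<in> Pow L. F \<subseteq> Z} = emeasure ?M2 {Z \<in> Pow L. F \<subseteq> Z}" .
    qed
    moreover have "emeasure ?M1 A = 0"
    proof -
      have "A \<subseteq> Pow L" using sets.sets_into_space[OF A(1)] by simp
      then have "?V \<inter> A = A" using A(2) by blast
      then show ?thesis using e1[OF A(1)] A(3) by simp
    qed
    ultimately have "emeasure m B ^ card I * emeasure \<nu>' A = 0" using e2[OF A(1)] by simp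
    then have "emeasure \<nu>' A = 0" using mB by auto
    then have "AE Z in \<nu>'. Z \<notin> A" using A(1) \<nu>'s by (intro AE_not_in) (auto simp: null_sets_def)
    then show "AE Q in (\<Pi>\<^sub>M i\<in>{1..r}. \<nu>). (\<Inter>i\<in>{1..r}. Q i) \<notin> A"
      unfolding \<nu>'_def using AE_distrD[OF meas\<nu>, of "\<lambda>Z. Z \<notin> A"] unfolding I_def by blast
  qed
qed

end

section \<open>The cross-section and the partial translation action\<close>

lemma measure_eqI_cover:
  fixes A :: "nat \<Rightarrow> 'a set"
  assumes s: "sets M = sets N" and A: "range A \<subseteq> sets M" "space M \<subseteq> (\<Union>n. A n)"
    and eq: "\<And>n Y. Y \<in> sets M \<Longrightarrow> Y \<subseteq> A n \<Longrightarrow> emeasure M Y = emeasure N Y"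
  shows "M = N"
proof (rule measure_eqI[OF s])
  fix Y assume Y: "Y \<in> sets M"
  have d: "disjointed A n \<in> sets M" for n using sets.range_disjointed_sets[OF A(1)] by blast
  have "Y = (\<Union>n. Y \<inter> disjointed A n)"
    using sets.sets_into_space[OF Y] A(2) UN_disjointed_eq[of A] by blast
  moreover have disj: "disjoint_family (\<lambda>n. Y \<inter> disjointed A n)"
    using disjoint_family_disjointed[of A] unfolding disjoint_family_on_def by blast
  have "(\<Sum>n. emeasure M (Y \<inter> disjointed A n)) = emeasure M (\<Union>n. Y \<inter> disjointed A n)"
    using Y d disj by (intro suminf_emeasure) auto
  moreover have "(\<Sum>n. emeasure N (Y \<inter> disjointed A n)) = emeasure N (\<Union>n. Y \<inter> disjointed A n)"
    using Y d disj s by (intro suminf_emeasure) auto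
  moreover have "emeasure M (Y \<inter> disjointed A n) = emeasure N (Y \<inter> disjointed A n)" for n
    using Y d disjointed_subset[of A n] by (intro eq[of _ n]) auto
  ultimately show "emeasure M Y = emeasure N Y" by simp
qed

context return_set
begin

text \<open>Sets containing 0 are enlarged to sets that meet \<open>\<Lambda>\<close>: by relative
  density every nonempty member of \<open>X\<close> then enters \<open>S\<close> under a translation
  from a compact window, compare \<open>admissible_translate\<close>.\<close>

definition S :: "'g set set" where
  "S = {Z \<in> Pow L. Z \<in> X \<and> Z \<inter> \<Lambda> \<noteq> {}}"

lemma S_D: "Z \<in> S \<Longrightarrow> Z \<subseteq> L" "Z \<in> S \<Longrightarrow> Z \<in> X" "Z \<in> S \<Longrightarrow> Z \<noteq> {}"
  unfolding S_def by auto

lemma S_I: "Z \<in> X \<Longrightarrow> a \<in> Z \<Longrightarrow> a \<in> \<Lambda> \<Longrightarrow> Z \<in> S"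
  unfolding S_def using X_subset_L by blast

lemma S_E: assumes "Z \<in> S" obtains a where "a \<in> Z" "a \<in> \<Lambda>"
  using assms unfolding S_def by blast

lemma sets_X_L: "{Z \<in> Pow L. Z \<in> X} \<in> sets (pow_measurable L)"
proof -
  let ?J = "{(a, b). a \<in> L \<and> b \<in> L \<and> a - b \<notin> \<Lambda>}"
  have "{Z \<in> Pow L. Z \<in> X} = Pow L - (\<Union>p\<in>?J. {Z \<in> Pow L. {fst p, snd p} \<subseteq> Z})"
  proof (intro Set.set_eqI iffI)
    fix Z assume "Z \<in> {Z \<in> Pow L. Z \<in> X}"
    then show "Z \<in> Pow L - (\<Union>p\<in>?J. {Z \<in> Pow L. {fst p, snd p} \<subseteq> Z})"
      using X_diff[of Z] by auto
  next
    fix Z assume Z: "Z \<in> Pow L - (\<Union>p\<in>?J. {Z \<in> Pow L. {fst p, snd p} \<subseteq> Z})"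
    have "a - b \<in> \<Lambda>" if ab: "a \<in> Z" "b \<in> Z" for a b
    proof (rule ccontr)
      assume "a - b \<notin> \<Lambda>"
      then have "(a, b) \<in> ?J" using ab Z by auto
      then show False using Z ab by force
    qed
    then show "Z \<in> {Z \<in> Pow L. Z \<in> X}" using Z by (simp add: XI)
  qed
  also have "\<dots> \<in> sets (pow_measurable L)"
  proof (intro sets.Diff sets.countable_UN'')
    show "Pow L \<in> sets (pow_measurable L)" using sets.top[of "pow_measurable L"] by simp
    have "?J \<subseteq> L \<times> L" by auto
    then show "countable ?J" using countable_return(2) by (meson countable_SIGMA countable_subset)
  qed (intro cylinder_measurable, simp)
  finally show ?thesis .
qed

lemma sets_S [measurable]: "S \<in> sets (pow_measurable L)"
proof -
  have "S = {Z \<in> Pow L. Z \<in> X} \<inter> (\<Union>l\<in>\<Lambda>. {Z \<in> Pow L. l \<in> Z})" unfolding S_def by blast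
  also have "\<dots> \<in> sets (pow_measurable L)"
    by (intro sets.Int sets_X_L sets.countable_UN'' countable_return sets_pow_measurable_mem)
  finally show ?thesis .
qed

text \<open>With a in Z and b in Z + c, both in \<open>\<Lambda>\<close>, the difference a - (b - c)
  lies in \<open>\<Lambda>\<close>, and flanking it by - a and b leaves c.\<close>

lemma S_translate_return:
  assumes "Z \<in> S" "translate (- c) Z \<in> S" shows "c \<in> \<Lambda> + \<Lambda> + \<Lambda>"
proof -
  obtain a where a: "a \<in> Z" "a \<in> \<Lambda>" using S_E[OF assms(1)] .
  obtain b where b: "b \<in> translate (- c) Z" "b \<in> \<Lambda>" using S_E[OF assms(2)] .
  have "b + - c \<in> Z" using b(1) by (simp only: mem_translate)
  then have "a - (b + - c) \<in> \<Lambda>" using X_diff[OF S_D(2)[OF assms(1)] a(1)] by blast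
  then have "- a + (a - (b + - c)) + b \<in> \<Lambda> + \<Lambda> + \<Lambda>" using a b uminus_mem by (intro add_mem_triple)
  moreover have "- a + (a - (b + - c)) + b = c" by (simp only: group_normalize)
  ultimately show ?thesis by simp
qed

text \<open>Translation does not preserve \<open>Pow L\<close>, hence the cut with \<open>L\<close>;
  nothing is lost on \<open>S_shift c\<close>, where the translate lies in \<open>S\<close>.\<close>

lemma measurable_translate_L:
  "(\<lambda>Z. translate (- c) Z \<inter> L) \<in> pow_measurable L \<rightarrow>\<^sub>M pow_measurable L"
proof (rule measurable_pow_measurable)
  fix l
  have "{Z \<in> space (pow_measurable L). l \<in> translate (- c) Z \<inter> L} =
    (if l \<in> L then {Z \<in> Pow L. l - c \<in> Z} else {})"
    by (auto simp: mem_translate)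
  then show "{Z \<in> space (pow_measurable L). l \<in> translate (- c) Z \<inter> L} \<in> sets (pow_measurable L)"
    by (cases "l \<in> L") (simp_all only: sets_pow_measurable_mem sets.empty_sets if_True if_False)
qed simp

text \<open>The domain of the partial action of \<open>c\<close> on \<open>S\<close>.\<close>

definition S_shift :: "'g \<Rightarrow> 'g set set" where
  "S_shift c = {Z \<in> S. translate (- c) Z \<in> S}"

lemma sets_S_shift [measurable]: "S_shift c \<in> sets (pow_measurable L)"
proof -
  have "S_shift c = S \<inter> (\<Union>l\<in>\<Lambda>. {Z \<in> Pow L. l - c \<in> Z})"
  proof (intro Set.set_eqI iffI)
    fix Z assume Z: "Z \<in> S_shift c"
    then obtain a where "a \<in> translate (- c) Z" "a \<in> \<Lambda>" unfolding S_shift_def using S_E by blast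
    then show "Z \<in> S \<inter> (\<Union>l\<in>\<Lambda>. {Z \<in> Pow L. l - c \<in> Z})"
      using Z S_D(1) unfolding S_shift_def by (auto simp: mem_translate)
  next
    fix Z assume "Z \<in> S \<inter> (\<Union>l\<in>\<Lambda>. {Z \<in> Pow L. l - c \<in> Z})"
    then obtain l where l: "Z \<in> S" "l \<in> \<Lambda>" "l - c \<in> Z" by blast
    then have "translate (- c) Z \<in> S" using S_D(2) by (intro S_I[of _ l]) (auto simp: mem_translate)
    then show "Z \<in> S_shift c" using l unfolding S_shift_def by blast
  qed
  also have "\<dots> \<in> sets (pow_measurable L)"
    by (intro sets.Int sets_S sets.countable_UN'' countable_return sets_pow_measurable_mem)
  finally show ?thesis .
qed

lemma S_shift_translate: "Z \<in> S_shift c \<Longrightarrow> translate (- c) Z \<in> S_shift (- c)"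
  unfolding S_shift_def by (simp add: translate_translate)

end

text \<open>The last two assumptions say that \<open>\<rho>\<close> is carried by \<open>X\<close>
  and is invariant under the partial translations, both in terms of patterns only. The locale is
  interpreted for the law of the intersection and again for the extremal measure.\<close>

locale return_measure = return_set +
  fixes \<rho> :: "'a set measure"
  assumes sets_\<rho>: "sets \<rho> = sets (pow_measurable L)" and prob_\<rho>: "prob_space \<rho>"
    and \<rho>_X: "\<And>a c. a \<in> L \<Longrightarrow> c \<in> L \<Longrightarrow> a - c \<notin> \<Lambda> \<Longrightarrow> emeasure \<rho> {Z \<in> Pow L. {a, c} \<subseteq> Z} = 0"
    and \<rho>_cyl: "\<And>F c. finite F \<Longrightarrow> F \<subseteq> L \<Longrightarrow> F \<inter> \<Lambda> \<noteq> {} \<Longrightarrow> (\<lambda>x. x + c) ` F \<subseteq> L \<Longrightarrow>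
      (\<lambda>x. x + c) ` F \<inter> \<Lambda> \<noteq> {} \<Longrightarrow>
      emeasure \<rho> {Z \<in> Pow L. (\<lambda>x. x + c) ` F \<subseteq> Z} = emeasure \<rho> {Z \<in> Pow L. F \<subseteq> Z}"
begin

sublocale prob_space \<rho> by (rule prob_\<rho>)

lemma space_\<rho>: "space \<rho> = Pow L"
  using sets_eq_imp_space_eq[OF sets_\<rho>] by simp

lemma AE_X: "AE Z in \<rho>. Z \<in> X"
proof -
  let ?J = "{(a, b). a \<in> L \<and> b \<in> L \<and> a - b \<notin> \<Lambda>}"
  have "?J \<subseteq> L \<times> L" by auto
  then have J: "countable ?J" using countable_return(2) by (meson countable_SIGMA countable_subset)
  have "AE Z in \<rho>. \<forall>p\<in>?J. \<not> {fst p, snd p} \<subseteq> Z"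
  proof (subst AE_ball_countable[OF J], rule ballI)
    fix p assume "p \<in> ?J"
    then have "emeasure \<rho> {Z \<in> Pow L. {fst p, snd p} \<subseteq> Z} = 0" using \<rho>_X by force
    then have "{Z \<in> Pow L. {fst p, snd p} \<subseteq> Z} \<in> null_sets \<rho>"
      using cylinder_measurable[of "{fst p, snd p}" L] sets_\<rho> by (simp add: null_sets_def)
    then have "AE Z in \<rho>. Z \<notin> {Z \<in> Pow L. {fst p, snd p} \<subseteq> Z}" by (rule AE_not_in)
    then show "AE Z in \<rho>. \<not> {fst p, snd p} \<subseteq> Z"
      by (rule AE_mp) (rule AE_I2, simp add: space_\<rho>)
  qed
  then show ?thesis
  proof (rule AE_mp, intro AE_I2 impI)
    fix Z assume Z: "Z \<in> space \<rho>" "\<forall>p\<in>?J. \<not> {fst p, snd p} \<subseteq> Z"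
    show "Z \<in> X"
    proof (rule XI, rule ccontr)
      fix a b assume ab: "a \<in> Z" "b \<in> Z" "a - b \<notin> \<Lambda>"
      then have "(a, b) \<in> ?J" using Z(1) unfolding space_\<rho> by blast
      then show False using Z(2) ab by force
    qed
  qed
qed

lemma emeasure_cyl_X:
  assumes "finite F"
  shows "emeasure \<rho> {Z \<in> Pow L. Z \<in> X \<and> F \<subseteq> Z} = emeasure \<rho> {Z \<in> Pow L. F \<subseteq> Z}"
proof (rule emeasure_eq_AE)
  show "AE Z in \<rho>. (Z \<in> {Z \<in> Pow L. Z \<in> X \<and> F \<subseteq> Z}) = (Z \<in> {Z \<in> Pow L. F \<subseteq> Z})"
    using AE_X by (rule AE_mp) (rule AE_I2, simp)
  have "{Z \<in> Pow L. Z \<in> X \<and> F \<subseteq> Z} = {Z \<in> Pow L. Z \<in> X} \<inter> {Z \<in> Pow L. F \<subseteq> Z}" by blast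
  then show "{Z \<in> Pow L. Z \<in> X \<and> F \<subseteq> Z} \<in> sets \<rho>"
    unfolding sets_\<rho> by (simp only: sets.Int sets_X_L cylinder_measurable[OF assms])
  show "{Z \<in> Pow L. F \<subseteq> Z} \<in> sets \<rho>" unfolding sets_\<rho> by (rule cylinder_measurable[OF assms])
qed

text \<open>Here b is a point of \<open>\<Lambda>\<close> in F + c. If F or F + c leaves
  \<open>L\<close>, both events are empty: a set in \<open>X\<close> that contains either pattern
  meets \<open>\<Lambda>\<close>, and so does its translate, so both lie in
  \<open>L\<close>.\<close>

lemma shift_cyl:
  assumes F: "finite F" "a \<in> F" "a \<in> \<Lambda>" "b - c \<in> F" "b \<in> \<Lambda>"
  shows "emeasure \<rho> {Z \<in> Pow L. Z \<in> X \<and> (\<lambda>x. x + c) ` F \<subseteq> Z} = emeasure \<rho> {Z \<in> Pow L. Z \<in> X \<and> F \<subseteq> Z}"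
proof (cases "F \<subseteq> L \<and> (\<lambda>x. x + c) ` F \<subseteq> L")
  case True
  have "b - c + c = b" by simp
  then have "b \<in> (\<lambda>x. x + c) ` F" using F(4) by (metis imageI)
  then have "(\<lambda>x. x + c) ` F \<inter> \<Lambda> \<noteq> {}" using F(5) by blast
  moreover have "F \<inter> \<Lambda> \<noteq> {}" using F by blast
  ultimately show ?thesis
    using emeasure_cyl_X[OF F(1)] emeasure_cyl_X[of "(\<lambda>x. x + c) ` F"] F(1) True \<rho>_cyl by simp
next
  case False
  have "F \<subseteq> L \<and> (\<lambda>x. x + c) ` F \<subseteq> L" if Z: "Z \<in> Pow L" "Z \<in> X" "F \<subseteq> Z" for Z
  proof -
    have "b \<in> translate (- c) Z" using Z F(4) by (auto simp: mem_translate)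
    then have "translate (- c) Z \<subseteq> L" using X_subset_L[of "translate (- c) Z" b] Z F(5) by simp
    moreover have "(\<lambda>x. x + c) ` F \<subseteq> translate (- c) Z" using Z by (auto simp: mem_translate)
    ultimately show ?thesis using Z by blast
  qed
  moreover have "F \<subseteq> L \<and> (\<lambda>x. x + c) ` F \<subseteq> L" if Z: "Z \<in> Pow L" "Z \<in> X" "(\<lambda>x. x + c) ` F \<subseteq> Z" for Z
  proof -
    have sub: "F \<subseteq> translate c Z" using Z(3) by (auto simp: mem_translate)
    then have "translate c Z \<subseteq> L" using X_subset_L[of "translate c Z" a] Z F by auto
    then show ?thesis using Z sub by blast
  qed
  ultimately have "{Z \<in> Pow L. Z \<in> X \<and> F \<subseteq> Z} = {}" "{Z \<in> Pow L. Z \<in> X \<and> (\<lambda>x. x + c) ` F \<subseteq> Z} = {}"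
    using False by blast+
  then show ?thesis by (simp only:)
qed

text \<open>Invariance under the partial map Z \<mapsto> Z + c, lifted from patterns to all events.
  The pattern equations need fixed witnesses that Z and Z + c meet \<open>\<Lambda>\<close>, so the
  domain is cut into countably many pieces, one for each pair of witnesses, and the measures are
  compared on each piece.\<close>

lemma shift_distr:
  "distr (density \<rho> (indicator (S_shift c))) (pow_measurable L) (\<lambda>Z. translate (- c) Z \<inter> L)
    = density \<rho> (indicator (S_shift (- c)))" (is "?M = ?N")
proof -
  let ?T = "\<lambda>Z. translate (- c) Z \<inter> L"
  have T: "?T \<in> \<rho> \<rightarrow>\<^sub>M pow_measurable L"
    using measurable_translate_L sets_\<rho> by (simp cong: measurable_cong_sets)
  have Ms: "sets ?M = sets (pow_measurable L)" by simp
  have Ns: "sets ?N = sets (pow_measurable L)" using sets_\<rho> by simp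
  have vim: "?T -` Y \<inter> Pow L \<in> sets (pow_measurable L)" if "Y \<in> sets (pow_measurable L)" for Y
    using measurable_sets[OF measurable_translate_L that] by simp
  have Me: "emeasure ?M Y = emeasure \<rho> (S_shift c \<inter> (?T -` Y \<inter> Pow L))" if Y: "Y \<in> sets (pow_measurable L)" for Y
    using T Y vim[OF Y] sets_S_shift[of c] sets_\<rho> space_\<rho>
    by (simp add: emeasure_distr emeasure_density indicator_inter_arith[symmetric])
  have Ne: "emeasure ?N Y = emeasure \<rho> (S_shift (- c) \<inter> Y)" if Y: "Y \<in> sets (pow_measurable L)" for Y
    using Y sets_S_shift[of "- c"] sets_\<rho>
    by (simp add: emeasure_density indicator_inter_arith[symmetric])
  \<comment> \<open>On this piece a is the witness for the original set and b the witness for its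
    translate, which contains a + c and b.\<close>
  have key: "emeasure \<rho> (S_shift c \<inter> (?T -` Y \<inter> Pow L)) = emeasure \<rho> (S_shift (- c) \<inter> Y)"
    if ab: "a \<in> \<Lambda>" "b \<in> \<Lambda>" and Y: "Y \<in> sets (pow_measurable L)"
      "Y \<subseteq> {Z \<in> Pow L. {a + c, b} \<subseteq> Z}" for a b Y
  proof -
    let ?V = "{Z \<in> Pow L. Z \<in> X \<and> {a + c, b} \<subseteq> Z}" and ?W = "{Z \<in> Pow L. Z \<in> X \<and> {a, b - c} \<subseteq> Z}"
    have VW: "?V \<in> sets (pow_measurable L)" "?W \<in> sets (pow_measurable L)"
    proof -
      have "?V = {Z \<in> Pow L. Z \<in> X} \<inter> {Z \<in> Pow L. {a + c, b} \<subseteq> Z}"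
        "?W = {Z \<in> Pow L. Z \<in> X} \<inter> {Z \<in> Pow L. {a, b - c} \<subseteq> Z}" by blast+
      then show "?V \<in> sets (pow_measurable L)" "?W \<in> sets (pow_measurable L)"
        by (simp_all only: sets.Int sets_X_L cylinder_measurable finite.intros)
    qed
    have WS: "Z \<in> S_shift c" "translate (- c) Z \<subseteq> L" if Z: "Z \<in> ?W" for Z
    proof -
      have "translate (- c) Z \<in> S" using Z ab by (intro S_I[of _ b]) (auto simp: mem_translate)
      moreover have "Z \<in> S" using Z ab by (intro S_I[of _ a]) auto
      ultimately show "Z \<in> S_shift c" "translate (- c) Z \<subseteq> L" unfolding S_shift_def using S_D(1) by auto
    qed
    let ?M' = "distr (density \<rho> (indicator ?W)) (pow_measurable L) ?T"
    let ?N' = "density \<rho> (indicator ?V)"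
    have M'e: "emeasure ?M' Y = emeasure \<rho> (?W \<inter> (?T -` Y \<inter> Pow L))" if Y: "Y \<in> sets (pow_measurable L)" for Y
      using T Y vim[OF Y] VW sets_\<rho> space_\<rho>
      by (simp add: emeasure_distr emeasure_density indicator_inter_arith[symmetric])
    have N'e: "emeasure ?N' Y = emeasure \<rho> (?V \<inter> Y)" if Y: "Y \<in> sets (pow_measurable L)" for Y
      using Y VW sets_\<rho> by (simp add: emeasure_density indicator_inter_arith[symmetric])
    have "?M' = ?N'"
    proof (rule pow_measure_eqI)
      show "sets ?N' = sets (pow_measurable L)" using sets_\<rho> by simp
      have "emeasure ?M' (space ?M') \<noteq> \<infinity>" using M'e[OF sets.top] by simp
      then show "finite_measure ?M'" by (rule finite_measureI)
      fix F assume F: "finite F" "F \<subseteq> L"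
      define F' where "F' = {a, b - c} \<union> (\<lambda>x. x - c) ` F"
      have F'c: "(\<lambda>x. x + c) ` F' = {a + c, b} \<union> F" unfolding F'_def by (auto simp: image_Un image_image)
      have "?V \<inter> {Z \<in> Pow L. F \<subseteq> Z} = {Z \<in> Pow L. Z \<in> X \<and> (\<lambda>x. x + c) ` F' \<subseteq> Z}" unfolding F'c by blast
      moreover have "?W \<inter> (?T -` {Z \<in> Pow L. F \<subseteq> Z} \<inter> Pow L) = {Z \<in> Pow L. Z \<in> X \<and> F' \<subseteq> Z}"
      proof (intro Set.set_eqI iffI)
        fix Z assume "Z \<in> ?W \<inter> (?T -` {Z \<in> Pow L. F \<subseteq> Z} \<inter> Pow L)"
        then show "Z \<in> {Z \<in> Pow L. Z \<in> X \<and> F' \<subseteq> Z}" unfolding F'_def by (auto simp: mem_translate subset_iff)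
      next
        fix Z assume Z: "Z \<in> {Z \<in> Pow L. Z \<in> X \<and> F' \<subseteq> Z}"
        then have "Z \<in> ?W" unfolding F'_def by simp
        moreover have "F \<subseteq> translate (- c) Z" using Z unfolding F'_def by (auto simp: mem_translate)
        ultimately show "Z \<in> ?W \<inter> (?T -` {Z \<in> Pow L. F \<subseteq> Z} \<inter> Pow L)" using F(2) Z by auto
      qed
      moreover have "emeasure \<rho> {Z \<in> Pow L. Z \<in> X \<and> (\<lambda>x. x + c) ` F' \<subseteq> Z} = emeasure \<rho> {Z \<in> Pow L. Z \<in> X \<and> F' \<subseteq> Z}"
        using F ab by (intro shift_cyl[of F' a b]) (auto simp: F'_def)
      ultimately show "emeasure ?M' {Z \<in> Pow L. F \<subseteq> Z} = emeasure ?N' {Z \<in> Pow L. F \<subseteq> Z}"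
        using M'e N'e cylinder_measurable[OF F(1), of L] by simp
    qed simp
    then have "emeasure \<rho> (?W \<inter> (?T -` Y \<inter> Pow L)) = emeasure \<rho> (?V \<inter> Y)"
      using M'e[OF Y(1)] N'e[OF Y(1)] by simp
    moreover have "?W \<inter> (?T -` Y \<inter> Pow L) = S_shift c \<inter> (?T -` Y \<inter> Pow L)"
    proof (intro Set.set_eqI iffI)
      fix Z assume "Z \<in> ?W \<inter> (?T -` Y \<inter> Pow L)"
      then show "Z \<in> S_shift c \<inter> (?T -` Y \<inter> Pow L)" using WS by blast
    next
      fix Z assume Z: "Z \<in> S_shift c \<inter> (?T -` Y \<inter> Pow L)"
      then have "{a + c, b} \<subseteq> translate (- c) Z" using Y(2) by blast
      then have "{a, b - c} \<subseteq> Z" by (simp add: mem_translate)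
      then show "Z \<in> ?W \<inter> (?T -` Y \<inter> Pow L)" using Z S_D unfolding S_shift_def by blast
    qed
    moreover have "?V \<inter> Y = S_shift (- c) \<inter> Y"
    proof (intro Set.set_eqI iffI)
      fix Z assume Z: "Z \<in> ?V \<inter> Y"
      have "translate (- (- c)) Z \<in> S" using Z ab by (intro S_I[of _ a]) (auto simp: mem_translate)
      moreover have "Z \<in> S" using Z ab by (intro S_I[of _ b]) auto
      ultimately show "Z \<in> S_shift (- c) \<inter> Y" using Z unfolding S_shift_def by blast
    next
      fix Z assume "Z \<in> S_shift (- c) \<inter> Y"
      then show "Z \<in> ?V \<inter> Y" using Y(2) S_D unfolding S_shift_def by blast
    qed
    ultimately show ?thesis by simp
  qed
  obtain e :: "nat \<Rightarrow> 'a \<times> 'a" where e: "range e = \<Lambda> \<times> \<Lambda>"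
  proof -
    have "countable (\<Lambda> \<times> \<Lambda>)" "\<Lambda> \<times> \<Lambda> \<noteq> {}" using countable_return(3) zero_mem by blast+
    then show ?thesis by (intro that[OF range_from_nat_into])
  qed
  \<comment> \<open>\<open>A 0\<close> is the complement of the image of the partial map, a null set
    for both measures; the other pieces run through all pairs of witnesses.\<close>
  define A where "A n = (case n of 0 \<Rightarrow> Pow L - S_shift (- c)
    | Suc n \<Rightarrow> {Z \<in> Pow L. {fst (e n) + c, snd (e n)} \<subseteq> Z})" for n
  show ?thesis
  proof (rule measure_eqI_cover[of _ _ A])
    show "sets ?M = sets ?N" using Ms Ns by simp
    show "range A \<subseteq> sets ?M"
    proof safe
      fix n
      have "Pow L \<in> sets (pow_measurable L)" using sets.top[of "pow_measurable L"] by simp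
      then have "A n \<in> sets (pow_measurable L)"
        unfolding A_def using sets_S_shift[of "- c"] cylinder_measurable
        by (cases n) (simp_all only: nat.case sets.Diff cylinder_measurable finite.intros)
      then show "A n \<in> sets ?M" by simp
    qed
    show "space ?M \<subseteq> (\<Union>n. A n)"
    proof
      fix Z assume "Z \<in> space ?M"
      then have Z: "Z \<in> Pow L" by simp
      show "Z \<in> (\<Union>n. A n)"
      proof (cases "Z \<in> S_shift (- c)")
        case False
        then have "Z \<in> A 0" using Z unfolding A_def by simp
        then show ?thesis by blast
      next
        case True
        then obtain b where b: "b \<in> Z" "b \<in> \<Lambda>" unfolding S_shift_def using S_E by blast
        obtain a where a: "a \<in> translate (- (- c)) Z" "a \<in> \<Lambda>"
            using True S_E[of "translate (- (- c)) Z"] unfolding S_shift_def by blast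
        have "(a, b) \<in> range e" unfolding e using a b by simp
        then obtain n where n: "e n = (a, b)" by (elim rangeE) simp
        have "Z \<in> A (Suc n)" unfolding A_def using n a b Z by (simp add: mem_translate)
        then show ?thesis by blast
      qed
    qed
    fix n Y assume Y: "Y \<in> sets ?M" "Y \<subseteq> A n"
    then have Ys: "Y \<in> sets (pow_measurable L)" by simp
    show "emeasure ?M Y = emeasure ?N Y"
    proof (cases n)
      case 0
      then have "Y \<inter> S_shift (- c) = {}" using Y(2) unfolding A_def by auto
      moreover from this have "S_shift c \<inter> (?T -` Y \<inter> Pow L) = {}"
      proof -
        have "?T Z \<in> S_shift (- c)" if "Z \<in> S_shift c" for Z
        proof -
          have "translate (- c) Z \<in> S" using that unfolding S_shift_def by blast
          then have "?T Z = translate (- c) Z" using S_D(1) by blast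
          then show ?thesis using S_shift_translate[OF that] by simp
        qed
        then show ?thesis using \<open>Y \<inter> S_shift (- c) = {}\<close> by blast
      qed
      ultimately show ?thesis using Me[OF Ys] Ne[OF Ys] by (simp add: Int_commute)
    next
      case (Suc k)
      have "e k \<in> \<Lambda> \<times> \<Lambda>" unfolding e[symmetric] by simp
      then have "fst (e k) \<in> \<Lambda>" "snd (e k) \<in> \<Lambda>" by auto
      then show ?thesis unfolding Me[OF Ys] Ne[OF Ys]
        using Y(2) Suc unfolding A_def by (intro key[OF _ _ Ys]) auto
    qed
  qed
qed

lemma shift_nn_integral:
  assumes h: "h \<in> borel_measurable (pow_measurable L)"
  shows "(\<integral>\<^sup>+ Z. indicator (S_shift c) Z * h (translate (- c) Z) \<partial>\<rho>) =
    (\<integral>\<^sup>+ Z. indicator (S_shift (- c)) Z * h Z \<partial>\<rho>)"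
proof -
  let ?T = "\<lambda>Z. translate (- c) Z \<inter> L"
  have T: "?T \<in> \<rho> \<rightarrow>\<^sub>M pow_measurable L"
    using measurable_translate_L sets_\<rho> by (simp cong: measurable_cong_sets)
  have h\<rho>: "h \<in> borel_measurable \<rho>" using h sets_\<rho> by (simp cong: measurable_cong_sets)
  have hT: "(\<lambda>Z. h (?T Z)) \<in> borel_measurable \<rho>" using measurable_compose[OF T h] .
  have ind: "indicator (S_shift d) \<in> borel_measurable \<rho>" for d
    using sets_S_shift[of d] sets_\<rho> by (intro borel_measurable_indicator) simp
  have "(\<integral>\<^sup>+ Z. indicator (S_shift c) Z * h (translate (- c) Z) \<partial>\<rho>) =
    (\<integral>\<^sup>+ Z. indicator (S_shift c) Z * h (?T Z) \<partial>\<rho>)"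
  proof (intro nn_integral_cong)
    fix Z
    have "?T Z = translate (- c) Z" if "Z \<in> S_shift c"
      using that S_D(1) unfolding S_shift_def by blast
    then show "indicator (S_shift c) Z * h (translate (- c) Z) = indicator (S_shift c) Z * h (?T Z)"
      by (auto simp: indicator_def)
  qed
  also have "\<dots> = (\<integral>\<^sup>+ Z. h (?T Z) \<partial>density \<rho> (indicator (S_shift c)))"
    using ind hT by (subst nn_integral_density) auto
  also have "\<dots> = (\<integral>\<^sup>+ Z. h Z \<partial>distr (density \<rho> (indicator (S_shift c))) (pow_measurable L) ?T)"
    using T h by (subst nn_integral_distr) auto
  also have "\<dots> = (\<integral>\<^sup>+ Z. indicator (S_shift (- c)) Z * h Z \<partial>\<rho>)"
    unfolding shift_distr using ind h\<rho> by (subst nn_integral_density) auto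
  finally show ?thesis .
qed

end

section \<open>The Chabauty--Fell space is compact metrizable\<close>

text \<open>By the Alexander subbase theorem only covers by hitting and missing sets matter. The
  complement of the union W of all V whose hitting set occurs can only be covered by a missing set
  of some compact K. Then K lies in W, and finitely many V covering K give the subcover.\<close>

lemma compact_space_chabauty_fell:
  "compact_space (chabauty_fell :: 'g::topological_space set topology)"
proof -
  let ?miss = "\<lambda>K. {P :: 'g set. closed P \<and> P \<inter> K = {}}" and ?hit = "\<lambda>V. {P :: 'g set. closed P \<and> P \<inter> V \<noteq> {}}"
  define \<B> where "\<B> = {?miss K | K. compact K} \<union> {?hit V | V. open V}"
  have top: "\<Union>\<B> = {P. closed P}"
    using topspace_chabauty_fell unfolding chabauty_fell_def topology_generated_by_topspace \<B>_def .
  \<comment> \<open>The whole space is a member of the subbase, so the two conventions for finite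
    intersections, relative to the carrier or nonempty, generate the same sets.\<close>
  have "?miss {} \<in> \<B>"
    unfolding \<B>_def by (intro UnI1 CollectI exI[of _ "{}"] conjI refl compact_empty)
  then have topB: "\<Union>\<B> \<in> \<B>" unfolding top by simp
  have eq: "(finite intersection_of (\<lambda>x. x \<in> \<B>) relative_to \<Union>\<B>) V \<longleftrightarrow> (finite' intersection_of (\<lambda>x. x \<in> \<B>)) V" for V
  proof
    assume "(finite intersection_of (\<lambda>x. x \<in> \<B>) relative_to \<Union>\<B>) V"
    then obtain \<F> where F: "finite \<F>" "\<F> \<subseteq> \<B>" "V = \<Union>\<B> \<inter> \<Inter>\<F>"
      unfolding relative_to_def intersection_of_def by auto
    have "V = \<Inter>(insert (\<Union>\<B>) \<F>)" unfolding F(3) by simp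
    moreover have "insert (\<Union>\<B>) \<F> \<subseteq> \<B>" using F(2) topB by simp
    ultimately show "(finite' intersection_of (\<lambda>x. x \<in> \<B>)) V"
      unfolding intersection_of_def using F(1) by (intro exI[of _ "insert (\<Union>\<B>) \<F>"]) auto
  next
    assume "(finite' intersection_of (\<lambda>x. x \<in> \<B>)) V"
    then obtain \<F> where F: "finite \<F>" "\<F> \<noteq> {}" "\<F> \<subseteq> \<B>" "V = \<Inter>\<F>"
      unfolding intersection_of_def by auto
    then obtain W where "W \<in> \<F>" by blast
    then have "\<Inter>\<F> \<subseteq> \<Union>\<B>" using F(3) by blast
    then have "V = \<Union>\<B> \<inter> \<Inter>\<F>" using F(4) by blast
    then show "(finite intersection_of (\<lambda>x. x \<in> \<B>) relative_to \<Union>\<B>) V"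
      unfolding relative_to_def intersection_of_def using F by (intro exI[of _ "\<Inter>\<F>"]) auto
  qed
  show ?thesis
  proof (rule Alexander_subbase[of \<B>])
    have "(finite intersection_of (\<lambda>x. x \<in> \<B>) relative_to \<Union>\<B>) = (finite' intersection_of (\<lambda>x. x \<in> \<B>))"
      using eq by (rule ext)
    then show "topology (arbitrary union_of (finite intersection_of (\<lambda>x. x \<in> \<B>) relative_to \<Union>\<B>)) = chabauty_fell"
      unfolding chabauty_fell_def generate_topology_on_eq \<B>_def by simp
    fix \<C> assume C: "\<C> \<subseteq> \<B>" "\<Union>\<C> = topspace chabauty_fell"
    define W where "W = \<Union>{V. open V \<and> ?hit V \<in> \<C>}"
    have "open W" unfolding W_def by blast
    then have "- W \<in> \<Union>\<C>" unfolding C(2) topspace_chabauty_fell by (simp add: closed_Compl)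
    then obtain Q where Q: "Q \<in> \<C>" "- W \<in> Q" by blast
    have "\<exists>K. compact K \<and> Q = ?miss K"
    proof -
      have "\<not> (open V \<and> Q = ?hit V)" for V
      proof
        assume V: "open V \<and> Q = ?hit V"
        then have "V \<subseteq> W" using Q(1) unfolding W_def by blast
        moreover have "- W \<inter> V \<noteq> {}" using Q(2) V by blast
        ultimately show False by blast
      qed
      moreover have "Q \<in> \<B>" using Q(1) C(1) by blast
      ultimately show ?thesis unfolding \<B>_def by blast
    qed
    then obtain K where K: "compact K" "Q = ?miss K" by blast
    have "K \<subseteq> \<Union>{V. open V \<and> ?hit V \<in> \<C>}" using Q(2) unfolding K(2) W_def by blast
    then obtain \<V> where V: "\<V> \<subseteq> {V. open V \<and> ?hit V \<in> \<C>}" "finite \<V>" "K \<subseteq> \<Union>\<V>"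
      using compactE[OF K(1), of "{V. open V \<and> ?hit V \<in> \<C>}"] by blast
    have "\<Union>(insert Q (?hit ` \<V>)) = topspace chabauty_fell"
    proof
      show "\<Union>(insert Q (?hit ` \<V>)) \<subseteq> topspace chabauty_fell"
        unfolding topspace_chabauty_fell K(2) by blast
      show "topspace chabauty_fell \<subseteq> \<Union>(insert Q (?hit ` \<V>))"
      proof
        fix P :: "'g set" assume P: "P \<in> topspace chabauty_fell"
        show "P \<in> \<Union>(insert Q (?hit ` \<V>))"
        proof (cases "P \<inter> K = {}")
          case True
          then show ?thesis using P unfolding K(2) topspace_chabauty_fell by simp
        next
          case False
          then obtain x V' where x: "x \<in> P" "x \<in> V'" "V' \<in> \<V>" using V(3) by blast
          then have "P \<in> ?hit V'" using P unfolding topspace_chabauty_fell by blast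
          then show ?thesis using x(3) by blast
        qed
      qed
    qed
    moreover have "insert Q (?hit ` \<V>) \<subseteq> \<C>" using Q(1) V(1) by blast
    moreover have "finite (insert Q (?hit ` \<V>))" using V(2) by simp
    ultimately show "\<exists>\<C>'. finite \<C>' \<and> \<C>' \<subseteq> \<C> \<and> \<Union>\<C>' = topspace chabauty_fell"
      by (intro exI[of _ "insert Q (?hit ` \<V>)"] conjI)
  qed
qed

lemma compact_neighbourhood_within:
  fixes x :: "'g::t2_space"
  assumes "locally_compact_space (euclidean :: 'g topology)" "open V" "x \<in> V"
  obtains W C where "open W" "compact C" "x \<in> W" "W \<subseteq> C" "C \<subseteq> V"
proof -
  have h: "Hausdorff_space (euclidean :: 'g topology)"
    unfolding Hausdorff_space_def
  proof (intro allI impI)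
    fix x y :: 'g assume "x \<in> topspace euclidean \<and> y \<in> topspace euclidean \<and> x \<noteq> y"
    then have "x \<noteq> y" by simp
    from hausdorff[OF this] obtain U V where "open U" "open V" "x \<in> U" "y \<in> V" "U \<inter> V = {}" by blast
    then show "\<exists>U V. openin euclidean U \<and> openin euclidean V \<and> x \<in> U \<and> y \<in> V \<and> disjnt U V"
      by (intro exI[of _ U] exI[of _ V]) (simp add: disjnt_def)
  qed
  have "neighbourhood_base_of (compactin euclidean) (euclidean :: 'g topology)"
    by (intro locally_compact_imp_neighbourhood_base locally_compact_Hausdorff_imp_regular_space assms(1) h)
  then have "\<exists>W C. openin euclidean W \<and> compactin euclidean C \<and> x \<in> W \<and> W \<subseteq> C \<and> C \<subseteq> V"
    unfolding neighbourhood_base_of using assms(2,3) by auto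
  then show ?thesis using that by auto
qed

lemma compact_neighbourhood_compact:
  fixes K :: "'g::t2_space set"
  assumes "locally_compact_space (euclidean :: 'g topology)" "compact K" "K \<subseteq> V" "open V"
    and \<B>: "topological_basis \<B>"
  obtains \<F> where "finite \<F>" "\<F> \<subseteq> \<B>" "K \<subseteq> \<Union>\<F>" "compact (closure (\<Union>\<F>))" "closure (\<Union>\<F>) \<subseteq> V"
proof -
  let ?\<U> = "{U \<in> \<B>. compact (closure U) \<and> closure U \<subseteq> V}"
  have "K \<subseteq> \<Union>?\<U>"
  proof
    fix x assume "x \<in> K"
    then have "x \<in> V" using assms(3) by blast
    obtain W C where W: "open W" "compact C" "x \<in> W" "W \<subseteq> C" "C \<subseteq> V"
      using compact_neighbourhood_within[OF assms(1,4) \<open>x \<in> V\<close>] .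
    obtain U where U: "U \<in> \<B>" "x \<in> U" "U \<subseteq> W" using topological_basisE[OF \<B> W(1,3)] .
    have cl: "closure U \<subseteq> C"
      using U(3) W(2,4) by (intro closure_minimal compact_imp_closed) auto
    then have "compact (closure U)" using W(2) by (metis closed_closure compact_Int_closed inf.absorb2)
    then have "U \<in> ?\<U>" using U(1) cl W(5) by blast
    then show "x \<in> \<Union>?\<U>" using U(2) by blast
  qed
  moreover have "open U" if "U \<in> ?\<U>" for U using that topological_basis_open[OF \<B>] by blast
  ultimately obtain \<F> where F: "\<F> \<subseteq> ?\<U>" "finite \<F>" "K \<subseteq> \<Union>\<F>"
    using compactE[OF assms(2), of ?\<U>] by blast
  have "closure (\<Union>\<F>) = (\<Union>U\<in>\<F>. closure U)" using F(2) by (induction rule: finite_induct) simp_all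
  then show ?thesis using F by (intro that[of \<F>]) (auto intro!: compact_UN)
qed

text \<open>A point of P outside Q has a compact neighbourhood disjoint from Q; hitting its interior
  and missing it are disjoint open conditions.\<close>

lemma Hausdorff_space_chabauty_fell:
  assumes lc: "locally_compact_space (euclidean :: 'g::t2_space topology)"
  shows "Hausdorff_space (chabauty_fell :: 'g set topology)"
  unfolding Hausdorff_space_def
proof (intro allI impI)
  have *: "\<exists>U V. openin chabauty_fell U \<and> openin chabauty_fell V \<and> P \<in> U \<and> Q \<in> V \<and> disjnt U V"
    if P: "closed P" "closed Q" "x \<in> P" "x \<notin> Q" for P Q :: "'g set" and x
  proof -
    obtain W C where W: "open W" "compact C" "x \<in> W" "W \<subseteq> C" "C \<subseteq> - Q"
      using compact_neighbourhood_within[OF lc, of "- Q" x] P by blast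
    have "openin chabauty_fell {P. closed P \<and> P \<inter> W \<noteq> {}}" "openin chabauty_fell {P. closed P \<and> P \<inter> C = {}}"
      using W openin_hit openin_miss by blast+
    moreover have "P \<in> {P. closed P \<and> P \<inter> W \<noteq> {}}" "Q \<in> {P. closed P \<and> P \<inter> C = {}}" using P W by blast+
    moreover have "disjnt {P. closed P \<and> P \<inter> W \<noteq> {}} {P. closed P \<and> P \<inter> C = {}}"
      unfolding disjnt_def using W(4) by blast
    ultimately show ?thesis by (intro exI conjI)
  qed
  fix P Q :: "'g set"
  assume PQ: "P \<in> topspace chabauty_fell \<and> Q \<in> topspace chabauty_fell \<and> P \<noteq> Q"
  then have cl: "closed P" "closed Q" by (auto simp: topspace_chabauty_fell)
  from PQ consider x where "x \<in> P" "x \<notin> Q" | x where "x \<in> Q" "x \<notin> P" by blast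
  then show "\<exists>U V. openin chabauty_fell U \<and> openin chabauty_fell V \<and> P \<in> U \<and> Q \<in> V \<and> disjnt U V"
  proof cases
    case 1
    then show ?thesis using *[OF cl] by metis
  next
    case 2
    then show ?thesis using *[OF cl(2,1)] by (metis disjnt_sym)
  qed
qed

definition hit_miss_subbasis :: "'g::topological_space set set set \<Rightarrow> bool" where
  "hit_miss_subbasis \<G> \<longleftrightarrow> countable \<G> \<and>
    (\<forall>W\<in>\<G>. (\<exists>K. compact K \<and> W = {P. closed P \<and> P \<inter> K = {}}) \<or> (\<exists>V. open V \<and> W = {P. closed P \<and> P \<inter> V \<noteq> {}})) \<and>
    (\<forall>W P. openin chabauty_fell W \<longrightarrow> P \<in> W \<longrightarrow>
      (\<exists>\<F>. finite \<F> \<and> \<F> \<subseteq> \<G> \<and> \<F> \<noteq> {} \<and> P \<in> \<Inter>\<F> \<and> \<Inter>\<F> \<subseteq> W))"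

lemma hit_miss_subbasisD:
  assumes "hit_miss_subbasis \<G>"
  shows "countable \<G>"
    "\<And>W. W \<in> \<G> \<Longrightarrow> (\<exists>K. compact K \<and> W = {P. closed P \<and> P \<inter> K = {}}) \<or> (\<exists>V. open V \<and> W = {P. closed P \<and> P \<inter> V \<noteq> {}})"
    "\<And>W P. openin chabauty_fell W \<Longrightarrow> P \<in> W \<Longrightarrow> \<exists>\<F>. finite \<F> \<and> \<F> \<subseteq> \<G> \<and> \<F> \<noteq> {} \<and> P \<in> \<Inter>\<F> \<and> \<Inter>\<F> \<subseteq> W"
  using assms unfolding hit_miss_subbasis_def by simp_all

text \<open>Basic open sets suffice for hitting. For missing, a compact K disjoint from P is
  enlarged, by local compactness, to the compact closure of a finite union of basic sets that is
  still disjoint from P.\<close>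

lemma chabauty_fell_countable_subbasis:
  assumes lc: "locally_compact_space (euclidean :: 'g::{t2_space, second_countable_topology} topology)"
  shows "\<exists>\<G> :: 'g set set set. hit_miss_subbasis \<G>"
proof -
  let ?miss = "\<lambda>K. {P :: 'g set. closed P \<and> P \<inter> K = {}}" and ?hit = "\<lambda>V. {P :: 'g set. closed P \<and> P \<inter> V \<noteq> {}}"
  obtain \<B> :: "'g set set" where \<B>: "countable \<B>" "topological_basis \<B>"
    using ex_countable_basis by blast
  define \<G> where "\<G> = ?hit ` \<B> \<union>
    (\<lambda>\<F>. ?miss (closure (\<Union>\<F>))) ` {\<F>. finite \<F> \<and> \<F> \<subseteq> \<B> \<and> compact (closure (\<Union>\<F>))}"
  have "\<exists>\<F>. finite \<F> \<and> \<F> \<subseteq> \<G> \<and> \<F> \<noteq> {} \<and> P \<in> \<Inter>\<F> \<and> \<Inter>\<F> \<subseteq> W"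
    if W: "openin chabauty_fell W" "P \<in> W" for W P
  proof -
    have "generate_topology_on ({?miss K | K. compact K} \<union> {?hit V | V. open V}) W"
      using W(1) unfolding chabauty_fell_def openin_topology_generated_by_iff .
    then show ?thesis using W(2)
    proof (induction arbitrary: P rule: generate_topology_on.induct)
      case Empty
      then show ?case by blast
    next
      case (Int a b)
      then have P: "P \<in> a" "P \<in> b" by simp_all
      obtain \<F>1 where F1: "finite \<F>1" "\<F>1 \<subseteq> \<G>" "\<F>1 \<noteq> {}" "P \<in> \<Inter>\<F>1" "\<Inter>\<F>1 \<subseteq> a"
        using Int.IH(1)[OF P(1)] by (elim exE conjE)
      obtain \<F>2 where F2: "finite \<F>2" "\<F>2 \<subseteq> \<G>" "\<F>2 \<noteq> {}" "P \<in> \<Inter>\<F>2" "\<Inter>\<F>2 \<subseteq> b"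
        using Int.IH(2)[OF P(2)] by (elim exE conjE)
      have "\<Inter>(\<F>1 \<union> \<F>2) \<subseteq> a \<inter> b" unfolding Inter_Un_distrib using F1(5) F2(5) by (rule Int_mono)
      moreover have "P \<in> \<Inter>(\<F>1 \<union> \<F>2)" unfolding Inter_Un_distrib using F1(4) F2(4) by (rule IntI)
      moreover have "finite (\<F>1 \<union> \<F>2)" "\<F>1 \<union> \<F>2 \<subseteq> \<G>" "\<F>1 \<union> \<F>2 \<noteq> {}" using F1 F2 by simp_all
      ultimately show ?case by (intro exI[of _ "\<F>1 \<union> \<F>2"] conjI)
    next
      case (UN \<K>)
      then obtain k where k: "k \<in> \<K>" "P \<in> k" by blast
      obtain \<F> where F: "finite \<F>" "\<F> \<subseteq> \<G>" "\<F> \<noteq> {}" "P \<in> \<Inter>\<F>" "\<Inter>\<F> \<subseteq> k"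
        using UN.IH[OF k] by (elim exE conjE)
      have "\<Inter>\<F> \<subseteq> \<Union>\<K>" using F(5) k(1) by (rule subset_trans[OF _ Union_upper])
      with F(1-4) show ?case by (intro exI[of _ \<F>] conjI)
    next
      case (Basis s)
      have "(\<exists>K. compact K \<and> s = ?miss K) \<or> (\<exists>V. open V \<and> s = ?hit V)"
        using Basis.hyps by auto
      then consider K where "compact K" "s = ?miss K" | V where "open V" "s = ?hit V" by blast
      then show ?case
      proof cases
        case 1
        then have P: "closed P" "K \<subseteq> - P" using Basis.prems by auto
        obtain \<F> where F: "finite \<F>" "\<F> \<subseteq> \<B>" "K \<subseteq> \<Union>\<F>" "compact (closure (\<Union>\<F>))" "closure (\<Union>\<F>) \<subseteq> - P"
          using compact_neighbourhood_compact[OF lc 1(1) P(2) open_Compl[OF P(1)] \<B>(2)] .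
        have "?miss (closure (\<Union>\<F>)) \<in> \<G>" unfolding \<G>_def using F by blast
        moreover have "P \<in> ?miss (closure (\<Union>\<F>))" using P F(5) by blast
        moreover have "?miss (closure (\<Union>\<F>)) \<subseteq> s"
          unfolding 1(2) using F(3) closure_subset[of "\<Union>\<F>"] by blast
        ultimately show ?thesis by (intro exI[of _ "{?miss (closure (\<Union>\<F>))}"]) simp
      next
        case 2
        then obtain x where x: "closed P" "x \<in> P" "x \<in> V" using Basis.prems by auto
        obtain U where U: "U \<in> \<B>" "x \<in> U" "U \<subseteq> V" using topological_basisE[OF \<B>(2) 2(1) x(3)] .
        have "?hit U \<in> \<G>" unfolding \<G>_def using U by blast
        moreover have "P \<in> ?hit U" using x U by blast
        moreover have "?hit U \<subseteq> s" unfolding 2(2) using U(3) by blast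
        ultimately show ?thesis by (intro exI[of _ "{?hit U}"]) simp
      qed
    qed
  qed
  moreover have "(\<exists>K. compact K \<and> W = ?miss K) \<or> (\<exists>V. open V \<and> W = ?hit V)" if "W \<in> \<G>" for W
  proof -
    from that show ?thesis
      unfolding \<G>_def
    proof (elim UnE imageE)
      fix U assume "W = ?hit U" "U \<in> \<B>"
      then show ?thesis using topological_basis_open[OF \<B>(2)] by (intro disjI2 exI[of _ U] conjI)
    next
      fix \<F> assume "W = ?miss (closure (\<Union>\<F>))"
        "\<F> \<in> {\<F>. finite \<F> \<and> \<F> \<subseteq> \<B> \<and> compact (closure (\<Union>\<F>))}"
      then show ?thesis by (intro disjI1 exI[of _ "closure (\<Union>\<F>)"] conjI) simp_all
    qed
  qed
  moreover have "countable \<G>"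
  proof -
    have "countable {\<F>. finite \<F> \<and> \<F> \<subseteq> \<B>}" by (rule countable_Collect_finite_subset[OF \<B>(1)])
    then have "countable {\<F>. finite \<F> \<and> \<F> \<subseteq> \<B> \<and> compact (closure (\<Union>\<F>))}"
      by (rule countable_subset[rotated]) blast
    then show ?thesis unfolding \<G>_def using \<B>(1) by simp
  qed
  ultimately have "hit_miss_subbasis \<G>" unfolding hit_miss_subbasis_def by simp
  then show ?thesis ..
qed

lemma second_countable_chabauty_fell:
  assumes lc: "locally_compact_space (euclidean :: 'g::{t2_space, second_countable_topology} topology)"
  shows "second_countable (chabauty_fell :: 'g set topology)"
proof -
  obtain \<G> :: "'g set set set" where "hit_miss_subbasis \<G>"
    using chabauty_fell_countable_subbasis[OF lc] by blast
  note \<G> = hit_miss_subbasisD[OF this]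
  have op: "openin chabauty_fell W" if "W \<in> \<G>" for W
    using \<G>(2)[OF that] openin_hit openin_miss by blast
  let ?B = "Inter ` {\<F>. finite \<F> \<and> \<F> \<subseteq> \<G> \<and> \<F> \<noteq> {}}"
  have "countable {\<F>. finite \<F> \<and> \<F> \<subseteq> \<G>}" by (rule countable_Collect_finite_subset[OF \<G>(1)])
  then have "countable {\<F>. finite \<F> \<and> \<F> \<subseteq> \<G> \<and> \<F> \<noteq> {}}" by (rule countable_subset[rotated]) blast
  then have "countable ?B" by (rule countable_image)
  moreover have "openin chabauty_fell V" if "V \<in> ?B" for V
    using that op by (auto intro!: openin_Inter)
  moreover have "\<exists>V\<in>?B. P \<in> V \<and> V \<subseteq> W" if "openin chabauty_fell W \<and> P \<in> W" for W P
    using \<G>(3)[of W P] that by blast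
  ultimately show ?thesis unfolding second_countable_def by (intro exI[of _ ?B]) blast
qed

text \<open>Only hitting sets have to be tested: by local compactness f x misses K iff it misses one
  of the countably many finite unions of basic sets that cover K.\<close>

lemma measurable_chabauty_fell:
  assumes lc: "locally_compact_space (euclidean :: 'g::{t2_space, second_countable_topology} topology)"
    and f: "\<And>x. x \<in> space M \<Longrightarrow> f x \<in> S" "\<And>x. x \<in> space M \<Longrightarrow> closed (f x :: 'g set)"
    and hit: "\<And>V. open V \<Longrightarrow> {x \<in> space M. f x \<inter> V \<noteq> {}} \<in> sets M"
  shows "f \<in> M \<rightarrow>\<^sub>M borel_of (subtopology chabauty_fell S)"
proof -
  obtain \<G> :: "'g set set set" where "hit_miss_subbasis \<G>"
    using chabauty_fell_countable_subbasis[OF lc] by blast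
  note \<G> = hit_miss_subbasisD[OF this]
  obtain \<B> :: "'g set set" where \<B>: "countable \<B>" "topological_basis \<B>"
    using ex_countable_basis by blast
  have miss: "{x \<in> space M. f x \<inter> K = {}} \<in> sets M" if K: "compact K" for K
  proof -
    let ?J = "{\<F>. finite \<F> \<and> \<F> \<subseteq> \<B> \<and> K \<subseteq> \<Union>\<F>}"
    have "{x \<in> space M. f x \<inter> K = {}} = (\<Union>\<F>\<in>?J. space M - {x \<in> space M. f x \<inter> \<Union>\<F> \<noteq> {}})"
    proof (intro Set.set_eqI iffI)
      fix x assume x: "x \<in> {x \<in> space M. f x \<inter> K = {}}"
      then have "K \<subseteq> - f x" "open (- f x)" using f(2) by (auto intro: open_Compl)
      then obtain \<F> where F: "finite \<F>" "\<F> \<subseteq> \<B>" "K \<subseteq> \<Union>\<F>" "closure (\<Union>\<F>) \<subseteq> - f x"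
        using compact_neighbourhood_compact[OF lc K _ _ \<B>(2), of "- f x"] by metis
      then have "f x \<inter> \<Union>\<F> = {}" using closure_subset[of "\<Union>\<F>"] by blast
      then show "x \<in> (\<Union>\<F>\<in>?J. space M - {x \<in> space M. f x \<inter> \<Union>\<F> \<noteq> {}})"
        using x F by (intro UN_I[of \<F>]) auto
    next
      fix x assume "x \<in> (\<Union>\<F>\<in>?J. space M - {x \<in> space M. f x \<inter> \<Union>\<F> \<noteq> {}})"
      then show "x \<in> {x \<in> space M. f x \<inter> K = {}}" by auto
    qed
    also have "\<dots> \<in> sets M"
    proof (intro sets.countable_UN'' sets.Diff sets.top hit)
      have "countable {\<F>. finite \<F> \<and> \<F> \<subseteq> \<B>}" by (rule countable_Collect_finite_subset[OF \<B>(1)])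
      then show "countable ?J" by (rule countable_subset[rotated]) blast
      show "open (\<Union>\<F>)" if "\<F> \<in> ?J" for \<F>
        using that topological_basis_open[OF \<B>(2)] by (intro open_Union) blast
    qed
    finally show ?thesis .
  qed
  have G: "f -` W \<inter> space M \<in> sets M" if W: "W \<in> \<G>" for W
  proof -
    have "{x \<in> space M. f x \<inter> K = {}} = f -` {P. closed P \<and> P \<inter> K = {}} \<inter> space M"
      "{x \<in> space M. f x \<inter> V \<noteq> {}} = f -` {P. closed P \<and> P \<inter> V \<noteq> {}} \<inter> space M" for K V
      using f(2) by auto
    note eqs = this
    from \<G>(2)[OF W] show ?thesis
    proof (elim disjE exE conjE)
      fix K assume "compact K" "W = {P. closed P \<and> P \<inter> K = {}}"
      then show ?thesis using miss[of K] eqs(1)[of K] by (simp only:)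
    next
      fix V :: "'g set" assume "open V" "W = {P. closed P \<and> P \<inter> V \<noteq> {}}"
      then show ?thesis using hit[of V] eqs(2)[of V] by (simp only:)
    qed
  qed
  have sp: "f x \<in> topspace chabauty_fell" if "x \<in> space M" for x
    using f(2)[OF that] by (simp add: topspace_chabauty_fell)
  let ?J = "{\<F>. finite \<F> \<and> \<F> \<subseteq> \<G> \<and> \<F> \<noteq> {}}"
  have J: "countable ?J"
  proof -
    have "countable {\<F>. finite \<F> \<and> \<F> \<subseteq> \<G>}" by (rule countable_Collect_finite_subset[OF \<G>(1)])
    then show ?thesis by (rule countable_subset[rotated]) blast
  qed
  have fop: "f -` W \<inter> space M \<in> sets M" if W: "openin chabauty_fell W" for W
  proof -
    have "f -` W \<inter> space M = (\<Union>\<F>\<in>{\<F> \<in> ?J. \<Inter>\<F> \<subseteq> W}. \<Inter>V\<in>\<F>. f -` V \<inter> space M)"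
    proof (intro Set.set_eqI iffI)
      fix x assume x: "x \<in> f -` W \<inter> space M"
      then obtain \<F> where "finite \<F> \<and> \<F> \<subseteq> \<G> \<and> \<F> \<noteq> {} \<and> f x \<in> \<Inter>\<F> \<and> \<Inter>\<F> \<subseteq> W"
        using \<G>(3)[OF W, of "f x"] by blast
      then show "x \<in> (\<Union>\<F>\<in>{\<F> \<in> ?J. \<Inter>\<F> \<subseteq> W}. \<Inter>V\<in>\<F>. f -` V \<inter> space M)"
        using x by (intro UN_I[of \<F>]) auto
    next
      fix x assume "x \<in> (\<Union>\<F>\<in>{\<F> \<in> ?J. \<Inter>\<F> \<subseteq> W}. \<Inter>V\<in>\<F>. f -` V \<inter> space M)"
      then obtain \<F> where F: "\<F> \<noteq> {}" "\<Inter>\<F> \<subseteq> W" "\<And>V. V \<in> \<F> \<Longrightarrow> x \<in> f -` V \<inter> space M" by blast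
      then have "f x \<in> \<Inter>\<F>" "x \<in> space M" by blast+
      then show "x \<in> f -` W \<inter> space M" using F(2) by blast
    qed
    also have "\<dots> \<in> sets M"
    proof (rule sets.countable_UN'')
      show "countable {\<F> \<in> ?J. \<Inter>\<F> \<subseteq> W}" using J by (rule countable_subset[rotated]) blast
      show "(\<Inter>V\<in>\<F>. f -` V \<inter> space M) \<in> sets M" if "\<F> \<in> {\<F> \<in> ?J. \<Inter>\<F> \<subseteq> W}" for \<F>
        using that G by (intro sets.finite_INT) auto
    qed
    finally show ?thesis .
  qed
  show ?thesis
    unfolding borel_of_def
  proof (rule measurable_sigma_sets)
    show "sets (sigma (topspace (subtopology chabauty_fell S)) {U. openin (subtopology chabauty_fell S) U}) =
      sigma_sets (topspace (subtopology chabauty_fell S)) {U. openin (subtopology chabauty_fell S) U}"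
      using sets_borel_of unfolding borel_of_def .
    show "{U. openin (subtopology chabauty_fell S) U} \<subseteq> Pow (topspace (subtopology chabauty_fell S))"
      using openin_subset[of "subtopology chabauty_fell S"] by blast
    show "f \<in> space M \<rightarrow> topspace (subtopology chabauty_fell S)" using f(1) sp by auto
    fix y assume "y \<in> {U. openin (subtopology chabauty_fell S) U}"
    then obtain W where W: "openin chabauty_fell W" "y = W \<inter> S" by (auto simp: openin_subtopology)
    have "f -` y \<inter> space M = f -` W \<inter> space M" unfolding W(2) using f(1) by blast
    then show "f -` y \<inter> space M \<in> sets M" using fop[OF W(1)] by simp
  qed
qed

text \<open>Urysohn metrization. Functions that separate the pairs of basic sets with disjoint
  closures embed T into a countable power of the line; by compactness the image is closed, so
  complete metrizability is inherited.\<close>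

lemma compact_Hausdorff_second_countable_imp_completely_metrizable:
  assumes c: "compact_space T" and h: "Hausdorff_space T" and s: "second_countable T"
  shows "completely_metrizable_space T"
proof -
  have n: "normal_space T" using c h by (simp add: compact_Hausdorff_or_regular_imp_normal_space)
  obtain \<B> where \<B>: "countable \<B>" "\<And>V. V \<in> \<B> \<Longrightarrow> openin T V"
    "\<And>U x. openin T U \<Longrightarrow> x \<in> U \<Longrightarrow> \<exists>V\<in>\<B>. x \<in> V \<and> V \<subseteq> U"
    using s unfolding second_countable_def by metis
  define J where "J = {(V, W). V \<in> \<B> \<and> W \<in> \<B> \<and> disjnt (T closure_of V) (T closure_of W)}"
  have "\<exists>f. continuous_map T euclideanreal f \<and> f ` (T closure_of V) \<subseteq> {0} \<and> f ` (T closure_of W) \<subseteq> {1}"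
    if VW: "(V, W) \<in> J" for V W
  proof -
    have "disjnt (T closure_of V) (T closure_of W)" using VW unfolding J_def by blast
    then obtain f where "continuous_map T (top_of_set {0..1::real}) f"
      "f ` (T closure_of V) \<subseteq> {0}" "f ` (T closure_of W) \<subseteq> {1}"
      using Urysohn_lemma[OF n closedin_closure_of closedin_closure_of, of V W 0 1] by auto
    then show ?thesis by (auto simp: continuous_map_in_subtopology)
  qed
  then have "\<forall>p\<in>J. \<exists>f. continuous_map T euclideanreal f \<and> f ` (T closure_of fst p) \<subseteq> {0} \<and> f ` (T closure_of snd p) \<subseteq> {1}"
    by auto
  then obtain f where f: "\<And>p. p \<in> J \<Longrightarrow> continuous_map T euclideanreal (f p)"
    "\<And>p. p \<in> J \<Longrightarrow> f p ` (T closure_of fst p) \<subseteq> {0}" "\<And>p. p \<in> J \<Longrightarrow> f p ` (T closure_of snd p) \<subseteq> {1}"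
    by metis
  have cJ: "countable J"
  proof -
    have "J \<subseteq> \<B> \<times> \<B>" unfolding J_def by auto
    then show ?thesis using \<B>(1) by (meson countable_SIGMA countable_subset)
  qed
  let ?Y = "product_topology (\<lambda>_. euclideanreal) J"
  define e where "e x = (\<lambda>p\<in>J. f p x)" for x
  have cont: "continuous_map T ?Y e"
    unfolding continuous_map_componentwise e_def using f(1) by (auto simp: eta_contract_eq)
  have inj: "inj_on e (topspace T)"
  proof (rule inj_onI, rule ccontr)
    fix x y assume xy: "x \<in> topspace T" "y \<in> topspace T" "e x = e y" "x \<noteq> y"
    obtain U W where UW: "openin T U" "openin T W" "x \<in> U" "y \<in> W" "disjnt (T closure_of U) (T closure_of W)"
    proof -
      have cl: "closedin T {x}" "closedin T {y}" "disjnt {x} {y}"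
        using xy h by (auto simp: closedin_Hausdorff_singleton)
      have "\<exists>U V. openin T U \<and> openin T V \<and> {x} \<subseteq> U \<and> {y} \<subseteq> V \<and> disjnt (T closure_of U) (T closure_of V)"
        using n[unfolded normal_space_disjoint_closures, rule_format, of "{x}" "{y}"] cl by simp
      then show ?thesis using that by simp blast
    qed
    obtain V1 V2 where V: "V1 \<in> \<B>" "x \<in> V1" "V1 \<subseteq> U" "V2 \<in> \<B>" "y \<in> V2" "V2 \<subseteq> W"
      using \<B>(3)[OF UW(1,3)] \<B>(3)[OF UW(2,4)] by blast
    have "disjnt (T closure_of V1) (T closure_of V2)"
      using UW(5) closure_of_mono[OF V(3), of T] closure_of_mono[OF V(6), of T] unfolding disjnt_def by blast
    then have p: "(V1, V2) \<in> J" using V unfolding J_def by blast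
    have "x \<in> T closure_of V1" "y \<in> T closure_of V2"
      using closure_of_subset[of V1 T] closure_of_subset[of V2 T] V openin_subset[OF \<B>(2)] by blast+
    then have "f (V1, V2) x = 0" "f (V1, V2) y = 1" using f(2,3)[OF p] by auto
    moreover have "e x (V1, V2) = f (V1, V2) x" "e y (V1, V2) = f (V1, V2) y" using p by (auto simp: e_def)
    ultimately show False using xy(3) by simp
  qed
  have hY: "Hausdorff_space ?Y" by (simp add: Hausdorff_space_product_topology)
  have "closed_map T ?Y e" using cont c hY by (rule continuous_imp_closed_map)
  then have hom: "T homeomorphic_space subtopology ?Y (e ` topspace T)"
    using cont inj by (intro embedding_map_imp_homeomorphic_space injective_closed_imp_embedding_map)
  have "completely_metrizable_space ?Y"
    unfolding completely_metrizable_space_product_topology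
    using cJ by (auto simp: completely_metrizable_space_euclidean)
  moreover have "closedin ?Y (e ` topspace T)"
    using \<open>closed_map T ?Y e\<close> unfolding closed_map_def by blast
  ultimately show ?thesis
    using homeomorphic_completely_metrizable_space[OF hom] completely_metrizable_space_closedin by blast
qed

lemma standard_borel_closedin_chabauty_fell:
  assumes lc: "locally_compact_space (euclidean :: 'g::{t2_space, second_countable_topology} topology)"
    and S: "closedin (chabauty_fell :: 'g set topology) S"
  shows "completely_metrizable_space (subtopology chabauty_fell S)" "second_countable (subtopology chabauty_fell S)"
proof -
  show s: "second_countable (subtopology chabauty_fell S)"
    by (intro second_countable_subtopology second_countable_chabauty_fell lc)
  have "compact_space (subtopology chabauty_fell S)"
    using closedin_compact_space[OF compact_space_chabauty_fell S] by (simp add: compact_space_subtopology)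
  then show "completely_metrizable_space (subtopology chabauty_fell S)"
    by (intro compact_Hausdorff_second_countable_imp_completely_metrizable s
      Hausdorff_space_subtopology Hausdorff_space_chabauty_fell lc)
qed

lemma borel_measurable_nn_integral_countable:
  fixes f :: "'b \<Rightarrow> 'c \<Rightarrow> ennreal"
  assumes I: "countable I" and f: "\<And>i. f i \<in> borel_measurable M"
  shows "(\<lambda>x. \<integral>\<^sup>+ i. f i x \<partial>count_space I) \<in> borel_measurable M"
proof -
  interpret sigma_finite_measure "count_space I"
    using I by (rule sigma_finite_measure_count_space_countable)
  have "(\<lambda>(i, x). f i x) \<in> borel_measurable (count_space I \<Otimes>\<^sub>M M)"
    using I f by (intro measurable_pair_measure_countable1) simp_all
  from measurable_pair_swap[OF this] have "(\<lambda>(x, i). f i x) \<in> borel_measurable (M \<Otimes>\<^sub>M count_space I)"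
    by simp
  then show ?thesis by (rule borel_measurable_nn_integral)
qed

section \<open>The induced invariant measure\<close>

locale haar_return_measure = return_measure +
  fixes m :: "'a measure" and K :: "'a set"
  assumes lc: "locally_compact_space (euclidean :: 'a topology)"
    and sets_m: "sets m = sets borel"
    and m_left: "\<And>g. distr m m (\<lambda>x. g + x) = m"
    and m_right: "\<And>g. distr m m (\<lambda>x. x + g) = m"
    and m_compact: "\<And>C. compact C \<Longrightarrow> emeasure m C < \<infinity>"
    and m_nonzero: "emeasure m UNIV \<noteq> 0"
    and K: "compact K" "K + \<Lambda> = UNIV"
begin

lemma space_m: "space m = UNIV"
  using sets_eq_imp_space_eq[OF sets_m] by simp

lemma borel_measurable_shift:
  "(\<lambda>x. g + x) \<in> m \<rightarrow>\<^sub>M m" "(\<lambda>x. x + g) \<in> m \<rightarrow>\<^sub>M m"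
proof -
  have "(\<lambda>x. g + x) \<in> (borel :: 'a measure) \<rightarrow>\<^sub>M borel" "(\<lambda>x. x + g) \<in> (borel :: 'a measure) \<rightarrow>\<^sub>M borel"
    by (intro borel_measurable_continuous_onI continuous_intros)+
  then show "(\<lambda>x. g + x) \<in> m \<rightarrow>\<^sub>M m" "(\<lambda>x. x + g) \<in> m \<rightarrow>\<^sub>M m"
    using sets_m by (simp_all cong: measurable_cong_sets)
qed

lemma nn_integral_left: "f \<in> borel_measurable m \<Longrightarrow> (\<integral>\<^sup>+ k. f (g + k) \<partial>m) = (\<integral>\<^sup>+ k. f k \<partial>m)"
  using nn_integral_distr[OF borel_measurable_shift(1)[of g], of f] unfolding m_left by simp

lemma nn_integral_right: "f \<in> borel_measurable m \<Longrightarrow> (\<integral>\<^sup>+ k. f (k + g) \<partial>m) = (\<integral>\<^sup>+ k. f k \<partial>m)"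
  using nn_integral_distr[OF borel_measurable_shift(2)[of g], of f] unfolding m_right by simp

sublocale m: sigma_finite_measure m
proof
  obtain \<B> :: "'a set set" where \<B>: "countable \<B>" "topological_basis \<B>"
    using ex_countable_basis by blast
  let ?A = "{V \<in> \<B>. emeasure m V \<noteq> \<infinity>}"
  have "\<Union>?A = UNIV"
  proof (intro Set.set_eqI iffI UNIV_I)
    fix x :: 'a
    obtain W C where W: "open W" "compact C" "x \<in> W" "W \<subseteq> C" "C \<subseteq> UNIV"
      using compact_neighbourhood_within[OF lc open_UNIV UNIV_I] .
    obtain V where V: "V \<in> \<B>" "x \<in> V" "V \<subseteq> W" using topological_basisE[OF \<B>(2) W(1,3)] .
    have "emeasure m V \<le> emeasure m C"
      using V(3) W(4) sets_m borel_compact[OF W(2)] by (intro emeasure_mono) auto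
    then have "emeasure m V \<noteq> \<infinity>" using m_compact[OF W(2)] by (auto simp: top_unique)
    then show "x \<in> \<Union>?A" using V by blast
  qed
  moreover have "?A \<subseteq> sets m" using topological_basis_open[OF \<B>(2)] sets_m by auto
  moreover have "countable ?A" using \<B>(1) by simp
  ultimately show "\<exists>A. countable A \<and> A \<subseteq> sets m \<and> \<Union>A = space m \<and> (\<forall>a\<in>A. emeasure m a \<noteq> \<infinity>)"
    unfolding space_m by (intro exI[of _ ?A]) auto
qed

sublocale pair_sigma_finite \<rho> m ..

abbreviation XM :: "'a set measure" where "XM \<equiv> borel_of (subtopology chabauty_fell X)"

lemma space_XM: "space XM = X"
  unfolding space_borel_of_fell using X_closed by blast

lemma measurable_XM:
  assumes "\<And>x. x \<in> space M \<Longrightarrow> f x \<in> X" "\<And>V. open V \<Longrightarrow> {x \<in> space M. f x \<inter> V \<noteq> {}} \<in> sets M"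
  shows "f \<in> M \<rightarrow>\<^sub>M XM"
  using assms X_closed by (intro measurable_chabauty_fell lc) auto

lemma sets_rho_S: "S \<in> sets \<rho>" unfolding sets_\<rho> by (rule sets_S)

text \<open>The orbit map of the cross-section. The default value {} lies in \<open>X\<close>, so
  the map is total into \<open>X\<close>.\<close>

definition emb :: "'a set \<times> 'a \<Rightarrow> 'a set" where
  "emb = (\<lambda>(Z, k). if Z \<in> S then translate k Z else {})"

lemma measurable_emb: "emb \<in> \<rho> \<Otimes>\<^sub>M m \<rightarrow>\<^sub>M XM"
proof (rule measurable_XM)
  have "{} \<in> X" by (rule XI) auto
  then show "emb x \<in> X" for x unfolding emb_def using S_D(2) by (auto split: prod.splits)
  fix V :: "'a set" assume V: "open V"
  have "{x \<in> space (\<rho> \<Otimes>\<^sub>M m). emb x \<inter> V \<noteq> {}} =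
    (\<Union>l\<in>L. (S \<inter> {Z \<in> Pow L. l \<in> Z}) \<times> (\<lambda>k. l - k) -` V)"
  proof (intro Set.set_eqI iffI)
    fix x assume "x \<in> {x \<in> space (\<rho> \<Otimes>\<^sub>M m). emb x \<inter> V \<noteq> {}}"
    then obtain Z k y where x: "x = (Z, k)" "Z \<in> S" "y \<in> translate k Z" "y \<in> V"
      unfolding emb_def by (cases x) (auto split: if_splits)
    then have "y + k \<in> L" "y + k - k \<in> V" "y + k \<in> Z" using S_D(1)[OF x(2)] by (auto simp: mem_translate)
    then show "x \<in> (\<Union>l\<in>L. (S \<inter> {Z \<in> Pow L. l \<in> Z}) \<times> (\<lambda>k. l - k) -` V)"
      using x S_D(1)[OF x(2)] by (intro UN_I[of "y + k"]) auto
  next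
    fix x assume "x \<in> (\<Union>l\<in>L. (S \<inter> {Z \<in> Pow L. l \<in> Z}) \<times> (\<lambda>k. l - k) -` V)"
    then obtain l Z k where x: "x = (Z, k)" "l \<in> Z" "Z \<in> S" "l - k \<in> V" by auto
    then have "l - k \<in> translate k Z \<inter> V" by (simp add: mem_translate)
    then show "x \<in> {x \<in> space (\<rho> \<Otimes>\<^sub>M m). emb x \<inter> V \<noteq> {}}"
      using x S_D(1)[OF x(3)] by (auto simp: emb_def space_pair_measure space_m space_\<rho>)
  qed
  also have "\<dots> \<in> sets (\<rho> \<Otimes>\<^sub>M m)"
  proof (rule sets.countable_UN''[OF countable_return(2)])
    fix l
    have "open ((\<lambda>k. l - k) -` V)" using V by (intro open_vimage continuous_intros)
    then have "(\<lambda>k. l - k) -` V \<in> sets m" using sets_m by simp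
    moreover have "S \<inter> {Z \<in> Pow L. l \<in> Z} \<in> sets \<rho>"
      unfolding sets_\<rho> by (intro sets.Int sets_S sets_pow_measurable_mem)
    ultimately show "(S \<inter> {Z \<in> Pow L. l \<in> Z}) \<times> (\<lambda>k. l - k) -` V \<in> sets (\<rho> \<Otimes>\<^sub>M m)" by simp
  qed
  finally show "{x \<in> space (\<rho> \<Otimes>\<^sub>M m). emb x \<inter> V \<noteq> {}} \<in> sets (\<rho> \<Otimes>\<^sub>M m)" .
qed

text \<open>
  \<open>S\<close> plays the role of a cross-section of the action: \<open>visits\<close> counts the returns of an orbit to it
  inside a window.  Normalising by this count makes the induced measure independent of the window
  (\<open>mass_transport\<close>), hence invariant.
\<close>

definition visits :: "'a set \<Rightarrow> 'a set \<Rightarrow> ennreal" where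
  "visits H y = emeasure (count_space UNIV) {k \<in> H. translate (- k) y \<in> S}"

definition admissible :: "'a set \<Rightarrow> bool" where
  "admissible H \<longleftrightarrow> H \<in> sets m \<and> (\<forall>Z\<in>S. \<forall>k. 1 \<le> visits H (translate k Z) \<and> visits H (translate k Z) < \<infinity>)"

text \<open>Let p be a point of y. Writing - (p + g) = k0 + l0 gives p + (g + k0) = - l0 in
  \<open>\<Lambda>\<close>, hence at least one visit. Every visiting time k moves p into
  \<open>L\<close>, and p + k ranges over a compact set, which contains finitely many points of
  \<open>L\<close>.\<close>

lemma admissible_translate: "admissible ((\<lambda>x. g + x) ` K)"
  unfolding admissible_def
proof (intro conjI ballI allI)
  have cK: "compact ((\<lambda>x. g + x) ` K)"
    by (intro compact_continuous_image continuous_intros K)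
  then show "(\<lambda>x. g + x) ` K \<in> sets m" using sets_m borel_compact[OF cK] by simp
  fix Z k assume Z: "Z \<in> S"
  define y where "y = translate k Z"
  have yX: "y \<in> X" unfolding y_def using S_D(2)[OF Z] by simp
  obtain z where "z \<in> Z" using S_D(3)[OF Z] by blast
  then have p: "z - k \<in> y" unfolding y_def by (simp add: mem_translate)
  define p where "p = z - k"
  let ?A = "{k \<in> (\<lambda>x. g + x) ` K. translate (- k) y \<in> S}"
  have "- (p + g) \<in> K + \<Lambda>" unfolding K(2) by simp
  then obtain k0 l0 where k0: "k0 \<in> K" "l0 \<in> \<Lambda>" "- (p + g) = k0 + l0" by (auto elim: set_plus_elim)
  have "p + (g + k0) = - l0"
  proof -
    have "p + (g + k0) = - (- (p + g)) + (k0 + l0) + - l0" by (simp only: group_normalize)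
    also have "\<dots> = - l0" unfolding k0(3)[symmetric] by (simp only: group_normalize)
    finally show ?thesis .
  qed
  moreover have "p + (g + k0) \<in> translate (- (g + k0)) y"
    using p unfolding p_def mem_translate by (simp only: group_normalize)
  ultimately have "translate (- (g + k0)) y \<in> S"
    using k0(2) uminus_mem yX by (intro S_I[of _ "- l0"]) auto
  then have A1: "g + k0 \<in> ?A" using k0(1) by blast
  have "?A \<subseteq> {k. p + k \<in> L \<inter> (\<lambda>x. p + x) ` ((\<lambda>x. g + x) ` K)}"
  proof
    fix k' assume k': "k' \<in> ?A"
    then have "p + k' \<in> translate (- k') y" using p unfolding p_def mem_translate by (simp only: group_normalize)
    then have "p + k' \<in> L" using S_D(1) k' by blast
    then show "k' \<in> {k. p + k \<in> L \<inter> (\<lambda>x. p + x) ` ((\<lambda>x. g + x) ` K)}" using k' by blast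
  qed
  moreover have "finite (L \<inter> (\<lambda>x. p + x) ` ((\<lambda>x. g + x) ` K))"
  proof (rule separated_by_finite[OF U(1,2) separated_by_subset[OF separated3 L_subset(2)]])
    show "compact ((\<lambda>x. p + x) ` ((\<lambda>x. g + x) ` K))"
      by (intro compact_continuous_image continuous_intros cK)
  qed
  then have "finite {k. p + k \<in> L \<inter> (\<lambda>x. p + x) ` ((\<lambda>x. g + x) ` K)}"
    using finite_vimageI[of "L \<inter> (\<lambda>x. p + x) ` ((\<lambda>x. g + x) ` K)" "\<lambda>k. p + k"]
    by (simp add: vimage_def inj_on_def)
  ultimately have fin: "finite ?A" by (rule finite_subset)
  have v: "visits ((\<lambda>x. g + x) ` K) y = of_nat (card ?A)"
    unfolding visits_def using fin by (subst emeasure_count_space_finite) auto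
  have "card ?A \<ge> 1" using fin A1 by (metis (no_types, lifting) One_nat_def Suc_leI card_gt_0_iff empty_iff)
  then have "(of_nat 1 :: ennreal) \<le> of_nat (card ?A)" by (rule of_nat_mono)
  then show "1 \<le> visits ((\<lambda>x. g + x) ` K) (translate k Z)"
    unfolding y_def[symmetric] v by simp
  show "visits ((\<lambda>x. g + x) ` K) (translate k Z) < \<infinity>"
    unfolding y_def[symmetric] v by (simp add: of_nat_less_top)
qed

lemma admissible_K: "admissible K"
  using admissible_translate[of 0] by simp

text \<open>Return times of \<open>S\<close> lie in the countable set \<open>\<Lambda> + \<Lambda> + \<Lambda>\<close>; this makes \<open>visits\<close> a countable sum.\<close>

lemma visits_eq:
  assumes "Z \<in> S"
  shows "visits H (translate k Z) =
    (\<integral>\<^sup>+ c. indicator H (k + c) * indicator (S_shift c) Z \<partial>count_space (\<Lambda> + \<Lambda> + \<Lambda>))"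
proof -
  have tr: "translate (- (k + c)) (translate k Z) = translate (- c) Z" for c
    by (simp add: translate_translate minus_add add.assoc)
  have "bij_betw (\<lambda>c. k + c) {c. k + c \<in> H \<and> Z \<in> S_shift c} {k' \<in> H. translate (- k') (translate k Z) \<in> S}"
  proof (rule bij_betw_byWitness[where f' = "\<lambda>k'. - k + k'"])
    show "(\<lambda>c. k + c) ` {c. k + c \<in> H \<and> Z \<in> S_shift c} \<subseteq> {k' \<in> H. translate (- k') (translate k Z) \<in> S}"
      using tr unfolding S_shift_def by auto
    have "Z \<in> S_shift (- k + k')" if "translate (- k') (translate k Z) \<in> S" for k'
      using that assms tr[of "- k + k'"] unfolding S_shift_def by (simp add: add.assoc[symmetric])
    then show "(\<lambda>k'. - k + k') ` {k' \<in> H. translate (- k') (translate k Z) \<in> S} \<subseteq> {c. k + c \<in> H \<and> Z \<in> S_shift c}"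
      by (auto simp: add.assoc[symmetric])
  qed (auto simp: add.assoc[symmetric])
  note bij = this
  have "visits H (translate k Z) = emeasure (count_space UNIV) {c. k + c \<in> H \<and> Z \<in> S_shift c}"
    unfolding visits_def using bij_betw_finite[OF bij] bij_betw_same_card[OF bij]
    by (cases "finite {c. k + c \<in> H \<and> Z \<in> S_shift c}") (simp_all add: emeasure_count_space)
  also have "{c. k + c \<in> H \<and> Z \<in> S_shift c} \<subseteq> \<Lambda> + \<Lambda> + \<Lambda>"
    using S_translate_return unfolding S_shift_def by blast
  then have "emeasure (count_space UNIV) {c. k + c \<in> H \<and> Z \<in> S_shift c} =
    emeasure (count_space (\<Lambda> + \<Lambda> + \<Lambda>)) {c. k + c \<in> H \<and> Z \<in> S_shift c}"
    by (simp add: emeasure_count_space)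
  also have "\<dots> = (\<integral>\<^sup>+ c. indicator {c. k + c \<in> H \<and> Z \<in> S_shift c} c \<partial>count_space (\<Lambda> + \<Lambda> + \<Lambda>))"
    using \<open>_ \<subseteq> \<Lambda> + \<Lambda> + \<Lambda>\<close> by (intro nn_integral_indicator[symmetric]) simp
  also have "\<dots> = (\<integral>\<^sup>+ c. indicator H (k + c) * indicator (S_shift c) Z \<partial>count_space (\<Lambda> + \<Lambda> + \<Lambda>))"
    by (intro nn_integral_cong) (auto simp: indicator_def)
  finally show ?thesis .
qed

lemma measurable_indicator_shift:
  assumes "H \<in> sets m"
  shows "(\<lambda>k. indicator H (k + c) :: ennreal) \<in> borel_measurable m"
  by (rule measurable_compose[OF borel_measurable_shift(2) borel_measurable_indicator[OF assms]])

lemma measurable_visits: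
  assumes H: "H \<in> sets m"
  shows "(\<lambda>(Z, k). indicator S Z * visits H (translate k Z)) \<in> borel_measurable (\<rho> \<Otimes>\<^sub>M m)"
proof -
  have "(\<lambda>(Z, k). indicator S Z * visits H (translate k Z)) =
    (\<lambda>(Z, k). indicator S Z * (\<integral>\<^sup>+ c. indicator H (k + c) * indicator (S_shift c) Z \<partial>count_space (\<Lambda> + \<Lambda> + \<Lambda>)))"
    using visits_eq by (auto simp: fun_eq_iff indicator_def)
  also have "\<dots> \<in> borel_measurable (\<rho> \<Otimes>\<^sub>M m)"
  proof -
    have S: "indicator S \<in> borel_measurable \<rho>" "\<And>c. indicator (S_shift c) \<in> borel_measurable \<rho>"
      using sets_rho_S sets_S_shift sets_\<rho> by (auto intro!: borel_measurable_indicator)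
    have ind: "(\<lambda>k. indicator H (k + c) :: ennreal) \<in> borel_measurable m" for c
      by (rule measurable_indicator_shift[OF H])
    have c1: "(\<lambda>x. indicator H (snd x + c) * indicator (S_shift c) (fst x) :: ennreal) \<in> borel_measurable (\<rho> \<Otimes>\<^sub>M m)" for c
      using measurable_compose[OF measurable_snd[of \<rho> m] ind[of c]] measurable_compose[OF measurable_fst[of \<rho> m] S(2)[of c]]
      by (intro borel_measurable_times_ennreal) auto
    have "(\<lambda>x. \<integral>\<^sup>+ c. indicator H (snd x + c) * indicator (S_shift c) (fst x) \<partial>count_space (\<Lambda> + \<Lambda> + \<Lambda>))
      \<in> borel_measurable (\<rho> \<Otimes>\<^sub>M m)"
      using c1 by (intro borel_measurable_nn_integral_countable countable_return(1))
    moreover have "(\<lambda>x. indicator S (fst x) :: ennreal) \<in> borel_measurable (\<rho> \<Otimes>\<^sub>M m)"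
      using measurable_compose[OF measurable_fst[of \<rho> m] S(1)] by simp
    ultimately show ?thesis by (simp add: case_prod_beta')
  qed
  finally show ?thesis .
qed

text \<open>The factor \<open>indicator S\<close> makes this jointly measurable; where it vanishes,
  the later quotients by \<open>vis\<close> are multiplied by 0.\<close>

definition vis :: "'a set \<Rightarrow> 'a set \<times> 'a \<Rightarrow> ennreal" where
  "vis H = (\<lambda>(Z, k). indicator S Z * visits H (translate k Z))"

lemma measurable_vis: "H \<in> sets m \<Longrightarrow> vis H \<in> borel_measurable (\<rho> \<Otimes>\<^sub>M m)"
  unfolding vis_def by (rule measurable_visits)

lemma measurable_ind_S: "(\<lambda>x. indicator S (fst x) :: ennreal) \<in> borel_measurable (\<rho> \<Otimes>\<^sub>M m)"
  by (rule measurable_compose[OF measurable_fst borel_measurable_indicator[OF sets_rho_S]])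

lemma measurable_ind_shift:
  "(\<lambda>x. indicator (S_shift c) (fst x) :: ennreal) \<in> borel_measurable (\<rho> \<Otimes>\<^sub>M m)"
  by (rule measurable_compose[OF measurable_fst borel_measurable_indicator]) (simp only: sets_\<rho> sets_S_shift)

lemma measurable_ind_snd: "H \<in> sets m \<Longrightarrow> (\<lambda>x. indicator H (snd x + c) :: ennreal) \<in> borel_measurable (\<rho> \<Otimes>\<^sub>M m)"
  by (rule measurable_compose[OF measurable_snd measurable_indicator_shift])

text \<open>Its integral is the integral of \<open>\<theta>\<close> against the induced measure,
  computed with the window \<open>H\<close>.\<close>

definition integrand :: "'a set \<Rightarrow> ('a set \<Rightarrow> ennreal) \<Rightarrow> 'a set \<times> 'a \<Rightarrow> ennreal" where
  "integrand H \<theta> x = indicator S (fst x) * (\<theta> (emb x) * (indicator H (snd x) / vis H x))"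

lemma measurable_integrand:
  assumes "H \<in> sets m" "\<theta> \<in> borel_measurable XM"
  shows "integrand H \<theta> \<in> borel_measurable (\<rho> \<Otimes>\<^sub>M m)"
proof -
  have "(\<lambda>x. \<theta> (emb x)) \<in> borel_measurable (\<rho> \<Otimes>\<^sub>M m)"
    by (rule measurable_compose[OF measurable_emb assms(2)])
  moreover have "(\<lambda>x. indicator H (snd x) :: ennreal) \<in> borel_measurable (\<rho> \<Otimes>\<^sub>M m)"
    using measurable_ind_snd[OF assms(1), of 0] by simp
  ultimately show ?thesis
    unfolding integrand_def using measurable_ind_S measurable_vis[OF assms(1)]
    by (intro borel_measurable_times_ennreal borel_measurable_divide_ennreal)
qed

lemma uminus_mem3: "c \<in> \<Lambda> + \<Lambda> + \<Lambda> \<Longrightarrow> - c \<in> \<Lambda> + \<Lambda> + \<Lambda>"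
proof -
  assume "c \<in> \<Lambda> + \<Lambda> + \<Lambda>"
  then obtain x y z where "x \<in> \<Lambda>" "y \<in> \<Lambda>" "z \<in> \<Lambda>" "c = x + y + z" by (elim set_plus_elim) simp
  moreover from this have "- c = - z + - y + - x" by (simp only: group_normalize)
  ultimately show ?thesis by (simp only: add_mem_triple uminus_mem)
qed

text \<open>Insert the factor vis H2 / vis H2 and expand the numerator as a sum over return times c.
  The change of variables (Z, k) \<mapsto> (Z + c, k + c) preserves \<open>\<rho>\<close> times
  \<open>m\<close> on its domain and does not change the translate of Z by k, so it turns the term
  for (H1, H2, c) into the term for (H2, H1, - c). Summing over c exchanges the windows.\<close>

lemma mass_transport:
  assumes H: "admissible H1" "admissible H2" and \<theta>: "\<theta> \<in> borel_measurable XM"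
  shows "(\<integral>\<^sup>+ x. integrand H1 \<theta> x \<partial>(\<rho> \<Otimes>\<^sub>M m)) = (\<integral>\<^sup>+ x. integrand H2 \<theta> x \<partial>(\<rho> \<Otimes>\<^sub>M m))"
proof -
  let ?P = "\<rho> \<Otimes>\<^sub>M m" and ?R = "\<Lambda> + \<Lambda> + \<Lambda>"
  \<comment> \<open>The part of the summands that is symmetric in the two windows and depends on (Z,
    k) only through membership in \<open>S\<close> and the translated set.\<close>
  define \<Gamma> where "\<Gamma> x = indicator S (fst x) * (\<theta> (emb x) / (vis H1 x * vis H2 x))" for x
  have Hs: "H1 \<in> sets m" "H2 \<in> sets m" using H unfolding admissible_def by auto
  have \<Gamma>m: "\<Gamma> \<in> borel_measurable ?P"
    unfolding \<Gamma>_def using measurable_compose[OF measurable_emb \<theta>] measurable_vis[OF Hs(1)]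
      measurable_vis[OF Hs(2)] measurable_ind_S
    by (intro borel_measurable_times_ennreal borel_measurable_divide_ennreal)
  define T where "T G H c x = indicator G (snd x) * indicator H (snd x + c) * indicator (S_shift c) (fst x) * \<Gamma> x"
    for G H c and x :: "'a set \<times> 'a"
  have Tm: "T G H c \<in> borel_measurable ?P" if "G \<in> sets m" "H \<in> sets m" for G H c
    unfolding T_def using measurable_ind_snd[OF that(1), of 0] measurable_ind_snd[OF that(2), of c]
      measurable_ind_shift[of c] \<Gamma>m
    by (intro borel_measurable_times_ennreal) simp_all
  have expand: "integrand G \<theta> x = (\<integral>\<^sup>+ c. T G H c x \<partial>count_space ?R)"
    if GH: "admissible G" "admissible H" "\<And>x. vis G x * vis H x = vis H1 x * vis H2 x" for G H x
  proof (cases "fst x \<in> S")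
    case False
    then show ?thesis by (simp add: integrand_def T_def \<Gamma>_def)
  next
    case True
    obtain Z k where x: "x = (Z, k)" by (cases x)
    have Z: "Z \<in> S" using True x by simp
    have v: "vis G x = visits G (translate k Z)" "vis H x = visits H (translate k Z)"
      using Z x by (simp_all add: vis_def)
    have pos: "vis H x \<noteq> 0" "vis H x < top" "vis G x \<noteq> 0" "vis G x < top"
    proof -
      have "1 \<le> vis H x \<and> vis H x < \<infinity>" "1 \<le> vis G x \<and> vis G x < \<infinity>"
        unfolding v using GH(1,2) Z unfolding admissible_def by blast+
      then show "vis H x \<noteq> 0" "vis H x < top" "vis G x \<noteq> 0" "vis G x < top" by auto
    qed
    have "(\<integral>\<^sup>+ c. T G H c x \<partial>count_space ?R) =
      (\<integral>\<^sup>+ c. (indicator G k * \<Gamma> x) * (indicator H (k + c) * indicator (S_shift c) Z) \<partial>count_space ?R)"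
      by (intro nn_integral_cong) (simp add: T_def x mult_ac)
    also have "\<dots> = (indicator G k * \<Gamma> x) * visits H (translate k Z)"
      unfolding visits_eq[OF Z] by (intro nn_integral_cmult) simp
    also have "\<dots> = indicator G k * (\<theta> (emb x) / (vis G x * vis H x) * vis H x)"
      unfolding v(2)[symmetric] \<Gamma>_def GH(3) using True by (simp add: mult_ac)
    also have "\<theta> (emb x) / (vis G x * vis H x) * vis H x = \<theta> (emb x) / vis G x"
    proof -
      have "\<theta> (emb x) / (vis G x * vis H x) * vis H x = (\<theta> (emb x) * vis H x) / (vis G x * vis H x)"
        by (simp add: divide_ennreal_def mult_ac)
      also have "\<dots> = \<theta> (emb x) / vis G x" using pos by (intro divide_mult_eq) auto
      finally show ?thesis .
    qed
    finally show ?thesis using True x by (simp add: integrand_def divide_ennreal_def mult_ac)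
  qed
  have swap: "(\<integral>\<^sup>+ x. T H1 H2 c x \<partial>?P) = (\<integral>\<^sup>+ x. T H2 H1 (- c) x \<partial>?P)" for c
  proof -
    define h where "h Z = (\<integral>\<^sup>+ k. indicator H2 k * indicator H1 (k + - c) * \<Gamma> (Z, k) \<partial>m)" for Z
    have hm': "(\<lambda>x. indicator H2 (snd x) * indicator H1 (snd x + - c) * \<Gamma> x) \<in> borel_measurable ?P"
      using measurable_ind_snd[OF Hs(2), of 0] measurable_ind_snd[OF Hs(1), of "- c"] \<Gamma>m
      by (intro borel_measurable_times_ennreal) simp_all
    have "h \<in> borel_measurable \<rho>"
      unfolding h_def using m.borel_measurable_nn_integral_fst[OF hm'] by simp
    then have hm: "h \<in> borel_measurable (pow_measurable L)" using sets_\<rho> by (simp cong: measurable_cong_sets)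
    \<comment> \<open>Both pairs represent the same translated set, and both base points lie in
      \<open>S\<close>.\<close>
    have \<Gamma>_shift: "\<Gamma> (Z, k) = \<Gamma> (translate (- c) Z, k + c)" if "Z \<in> S_shift c" for Z k
    proof -
      have "Z \<in> S" "translate (- c) Z \<in> S" using that unfolding S_shift_def by auto
      moreover have "translate (k + c) (translate (- c) Z) = translate k Z"
        by (simp add: translate_translate add.assoc)
      ultimately show ?thesis by (simp add: \<Gamma>_def emb_def vis_def)
    qed
    have "(\<integral>\<^sup>+ x. T H1 H2 c x \<partial>?P) = (\<integral>\<^sup>+ Z. (\<integral>\<^sup>+ k. T H1 H2 c (Z, k) \<partial>m) \<partial>\<rho>)"
      using m.nn_integral_fst[OF Tm[OF Hs]] by simp
    also have "\<dots> = (\<integral>\<^sup>+ Z. indicator (S_shift c) Z * h (translate (- c) Z) \<partial>\<rho>)"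
    proof (intro nn_integral_cong)
      fix Z assume "Z \<in> space \<rho>"
      show "(\<integral>\<^sup>+ k. T H1 H2 c (Z, k) \<partial>m) = indicator (S_shift c) Z * h (translate (- c) Z)"
      proof (cases "Z \<in> S_shift c")
        case False
        then show ?thesis by (simp add: T_def)
      next
        case True
        then have "translate (- c) Z \<in> space \<rho>"
          unfolding S_shift_def space_\<rho> using S_D(1) by blast
        then have fm: "(\<lambda>k. indicator H2 k * indicator H1 (k + - c) * \<Gamma> (translate (- c) Z, k)) \<in> borel_measurable m"
          using measurable_compose[OF measurable_Pair1'[of "translate (- c) Z" \<rho> m] hm'] by simp
        have "(\<integral>\<^sup>+ k. T H1 H2 c (Z, k) \<partial>m) =
          (\<integral>\<^sup>+ k. indicator H2 (k + c) * indicator H1 (k + c + - c) * \<Gamma> (translate (- c) Z, k + c) \<partial>m)"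
          using True \<Gamma>_shift[OF True] by (intro nn_integral_cong) (simp add: T_def add.assoc mult_ac)
        also have "\<dots> = h (translate (- c) Z)"
          unfolding h_def by (rule nn_integral_right[OF fm])
        finally show ?thesis using True by simp
      qed
    qed
    also have "\<dots> = (\<integral>\<^sup>+ Z. indicator (S_shift (- c)) Z * h Z \<partial>\<rho>)" by (rule shift_nn_integral[OF hm])
    also have "\<dots> = (\<integral>\<^sup>+ Z. (\<integral>\<^sup>+ k. T H2 H1 (- c) (Z, k) \<partial>m) \<partial>\<rho>)"
    proof (intro nn_integral_cong)
      fix Z assume Z: "Z \<in> space \<rho>"
      have fm: "(\<lambda>k. indicator H2 k * indicator H1 (k + - c) * \<Gamma> (Z, k)) \<in> borel_measurable m"
        using measurable_compose[OF measurable_Pair1'[of Z \<rho> m] hm'] Z by simp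
      show "indicator (S_shift (- c)) Z * h Z = (\<integral>\<^sup>+ k. T H2 H1 (- c) (Z, k) \<partial>m)"
        unfolding h_def nn_integral_cmult[OF fm, symmetric] by (intro nn_integral_cong) (simp add: T_def mult_ac)
    qed
    also have "\<dots> = (\<integral>\<^sup>+ x. T H2 H1 (- c) x \<partial>?P)"
      using m.nn_integral_fst[OF Tm[OF Hs(2,1)]] by simp
    finally show ?thesis .
  qed
  have "(\<integral>\<^sup>+ x. integrand H1 \<theta> x \<partial>?P) = (\<integral>\<^sup>+ x. (\<integral>\<^sup>+ c. T H1 H2 c x \<partial>count_space ?R) \<partial>?P)"
    by (intro nn_integral_cong expand H refl)
  also have "\<dots> = (\<integral>\<^sup>+ c. (\<integral>\<^sup>+ x. T H1 H2 c x \<partial>?P) \<partial>count_space ?R)"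
    by (intro nn_integral_count_space_nn_integral countable_return(1) Tm Hs)
  also have "\<dots> = (\<integral>\<^sup>+ c. (\<integral>\<^sup>+ x. T H2 H1 (- c) x \<partial>?P) \<partial>count_space ?R)"
    by (intro nn_integral_cong swap)
  also have "\<dots> = (\<integral>\<^sup>+ c. (\<integral>\<^sup>+ x. T H2 H1 c x \<partial>?P) \<partial>count_space ?R)"
  proof (rule nn_integral_bij_count_space)
    show "bij_betw uminus ?R ?R"
      by (rule bij_betw_byWitness[where f' = uminus]) (use uminus_mem3 in auto)
  qed
  also have "\<dots> = (\<integral>\<^sup>+ x. (\<integral>\<^sup>+ c. T H2 H1 c x \<partial>count_space ?R) \<partial>?P)"
    by (intro nn_integral_count_space_nn_integral[symmetric] countable_return(1) Tm Hs)
  also have "\<dots> = (\<integral>\<^sup>+ x. integrand H2 \<theta> x \<partial>?P)"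
    by (intro nn_integral_cong expand[symmetric] H mult.commute)
  finally show ?thesis .
qed

text \<open>A set y has \<open>visits K y\<close> representations by a member of \<open>S\<close>
  and a time in \<open>K\<close>; the weight in \<open>integrand\<close> divides by this number, so
  that every set is counted once.\<close>

definition induced :: "'a set measure" where
  "induced = distr (density (\<rho> \<Otimes>\<^sub>M m) (integrand K (\<lambda>_. 1))) XM emb"

lemma sets_induced [simp]: "sets induced = sets XM"
  unfolding induced_def by simp

lemma space_induced: "space induced = X"
  using sets_eq_imp_space_eq[OF sets_induced] space_XM by simp

lemma sets_K: "K \<in> sets m"
  using sets_m borel_compact[OF K(1)] by simp

lemma emb_X: "emb x \<in> X"
proof -
  have "{} \<in> X" by (rule XI) auto
  then show ?thesis unfolding emb_def using S_D(2) by (auto split: prod.splits)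
qed

lemma emeasure_induced:
  assumes A: "A \<in> sets XM"
  shows "emeasure induced A = (\<integral>\<^sup>+ x. integrand K (indicator A) x \<partial>(\<rho> \<Otimes>\<^sub>M m))"
proof -
  let ?P = "\<rho> \<Otimes>\<^sub>M m"
  have i1: "integrand K (\<lambda>_. 1) \<in> borel_measurable ?P" by (intro measurable_integrand sets_K) simp
  have vs: "emb -` A \<inter> space ?P \<in> sets ?P" by (rule measurable_sets[OF measurable_emb A])
  have "emb \<in> density ?P (integrand K (\<lambda>_. 1)) \<rightarrow>\<^sub>M XM" using measurable_emb by simp
  then have "emeasure induced A = emeasure (density ?P (integrand K (\<lambda>_. 1))) (emb -` A \<inter> space ?P)"
    unfolding induced_def using A by (subst emeasure_distr) auto
  also have "\<dots> = (\<integral>\<^sup>+ x. integrand K (\<lambda>_. 1) x * indicator (emb -` A \<inter> space ?P) x \<partial>?P)"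
    by (rule emeasure_density[OF i1 vs])
  also have "\<dots> = (\<integral>\<^sup>+ x. integrand K (indicator A) x \<partial>?P)"
    by (intro nn_integral_cong) (simp add: integrand_def indicator_def)
  finally show ?thesis .
qed

lemma visits_translate: "visits ((\<lambda>x. g + x) ` H) (translate g y) = visits H y"
proof -
  have *: "- (g + k) + g = - k" for k by (simp only: group_normalize)
  have "bij_betw (\<lambda>x. g + x) {k \<in> H. translate (- k) y \<in> S} {k \<in> (\<lambda>x. g + x) ` H. translate (- k) (translate g y) \<in> S}"
    unfolding translate_translate
    by (rule bij_betw_imageI) (auto simp: inj_on_def * image_iff)
  note bij = this
  show ?thesis
    unfolding visits_def using bij_betw_finite[OF bij] bij_betw_same_card[OF bij]
    by (cases "finite {k \<in> H. translate (- k) y \<in> S}") (simp_all add: emeasure_count_space)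
qed

text \<open>The pairs (g, z) with z - g in V form an open set, hence a countable union of boxes; the
  translate by g hits V iff for some box g lies in the first factor and Z hits the second.\<close>

lemma measurable_translate_joint:
  "(\<lambda>(g, Z). translate g Z) \<in> (borel :: 'a measure) \<Otimes>\<^sub>M XM \<rightarrow>\<^sub>M XM"
proof (rule measurable_XM)
  let ?P = "(borel :: 'a measure) \<Otimes>\<^sub>M XM"
  show "(case x of (g, Z) \<Rightarrow> translate g Z) \<in> X" if "x \<in> space ?P" for x
    using that by (auto simp: space_pair_measure space_XM)
  fix V :: "'a set" assume V: "open V"
  obtain \<B> :: "'a set set" where \<B>: "countable \<B>" "topological_basis \<B>"
    using ex_countable_basis by blast
  let ?W = "(\<lambda>p. snd p - fst p) -` V"
  have W: "open ?W" using V by (intro open_vimage continuous_intros)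
  let ?J = "{(O1, O2). O1 \<in> \<B> \<and> O2 \<in> \<B> \<and> O1 \<times> O2 \<subseteq> ?W}"
  have "?J \<subseteq> \<B> \<times> \<B>" by auto
  then have J: "countable ?J" using \<B>(1) by (meson countable_SIGMA countable_subset)
  have "{x \<in> space ?P. (case x of (g, Z) \<Rightarrow> translate g Z) \<inter> V \<noteq> {}} =
    (\<Union>p\<in>?J. fst p \<times> {Z \<in> space XM. Z \<inter> snd p \<noteq> {}})"
  proof (intro Set.set_eqI iffI)
    fix x assume x: "x \<in> {x \<in> space ?P. (case x of (g, Z) \<Rightarrow> translate g Z) \<inter> V \<noteq> {}}"
    obtain g Z where gZ: "x = (g, Z)" by (cases x)
    obtain y where y: "y \<in> translate g Z" "y \<in> V" using x gZ by auto
    have Z: "Z \<in> space XM" using x gZ by (simp add: space_pair_measure)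
    have "(g, y + g) \<in> ?W" using y(2) by simp
    then obtain A1 A2 where A: "open A1" "open A2" "(g, y + g) \<in> A1 \<times> A2" "A1 \<times> A2 \<subseteq> ?W"
      using W by (elim open_prod_elim)
    have gA: "g \<in> A1" "y + g \<in> A2" using A(3) by simp_all
    obtain O1 where O1: "O1 \<in> \<B>" "g \<in> O1" "O1 \<subseteq> A1" using topological_basisE[OF \<B>(2) A(1) gA(1)] .
    obtain O2 where O2: "O2 \<in> \<B>" "y + g \<in> O2" "O2 \<subseteq> A2" using topological_basisE[OF \<B>(2) A(2) gA(2)] .
    have "O1 \<times> O2 \<subseteq> ?W" using A(4) O1(3) O2(3) by (meson Sigma_mono order_trans)
    then have "(O1, O2) \<in> ?J" using O1 O2 by simp
    moreover have "x \<in> fst (O1, O2) \<times> {Z \<in> space XM. Z \<inter> snd (O1, O2) \<noteq> {}}"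
      using gZ O1(2) O2(2) Z y(1) by (auto simp: mem_translate)
    ultimately show "x \<in> (\<Union>p\<in>?J. fst p \<times> {Z \<in> space XM. Z \<inter> snd p \<noteq> {}})" by (rule UN_I)
  next
    fix x assume "x \<in> (\<Union>p\<in>?J. fst p \<times> {Z \<in> space XM. Z \<inter> snd p \<noteq> {}})"
    then obtain p where p: "p \<in> ?J" "x \<in> fst p \<times> {Z \<in> space XM. Z \<inter> snd p \<noteq> {}}" by blast
    obtain g Z where gZ: "x = (g, Z)" by (cases x)
    have sub: "fst p \<times> snd p \<subseteq> ?W" using p(1) by auto
    obtain z where x: "x = (g, Z)" "g \<in> fst p" "Z \<in> space XM" "z \<in> Z" "z \<in> snd p" using p(2) gZ by auto
    then have "(g, z) \<in> ?W" using sub by blast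
    then have "z - g \<in> translate g Z \<inter> V" using x by (simp add: mem_translate)
    then show "x \<in> {x \<in> space ?P. (case x of (g, Z) \<Rightarrow> translate g Z) \<inter> V \<noteq> {}}"
      using x by (auto simp: space_pair_measure)
  qed
  also have "\<dots> \<in> sets ?P"
  proof (rule sets.countable_UN''[OF J])
    fix p assume "p \<in> ?J"
    then have op: "open (fst p)" "open (snd p)" using topological_basis_open[OF \<B>(2)] by auto
    then have "fst p \<in> sets borel" "{Z \<in> space XM. Z \<inter> snd p \<noteq> {}} \<in> sets XM"
      using sets_borel_of_hit[OF op(2)] by simp_all
    then show "fst p \<times> {Z \<in> space XM. Z \<inter> snd p \<noteq> {}} \<in> sets ?P" by simp
  qed
  finally show "{x \<in> space ?P. (case x of (g, Z) \<Rightarrow> translate g Z) \<inter> V \<noteq> {}} \<in> sets ?P" .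
qed

lemma measurable_translate_XM: "translate g \<in> XM \<rightarrow>\<^sub>M XM"
proof -
  have "g \<in> space borel" by simp
  from measurable_compose[OF measurable_Pair1'[OF this] measurable_translate_joint]
  show ?thesis by simp
qed

text \<open>Left invariance of \<open>m\<close> trades the translation by g for a translation of the
  window from K to g + K, and \<open>mass_transport\<close> changes the window back.\<close>

lemma induced_invariant: "distr induced induced (translate g) = induced"
proof (rule measure_eqI)
  let ?P = "\<rho> \<Otimes>\<^sub>M m" and ?H = "(\<lambda>x. g + x) ` K"
  show "sets (distr induced induced (translate g)) = sets induced" by simp
  fix A assume "A \<in> sets (distr induced induced (translate g))"
  then have A: "A \<in> sets XM" by simp
  have Hs: "?H \<in> sets m" using admissible_translate unfolding admissible_def by blast
  have ind: "indicator A \<in> borel_measurable XM" using A by simp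
  have tr: "translate g \<in> induced \<rightarrow>\<^sub>M induced"
    using measurable_translate_XM by (simp cong: measurable_cong_sets)
  let ?A' = "translate g -` A \<inter> X"
  have A': "?A' \<in> sets XM" using measurable_sets[OF measurable_translate_XM A] space_XM by simp
  have i2: "integrand K (indicator ?A') \<in> borel_measurable ?P"
    using A' by (intro measurable_integrand sets_K) simp
  have i3: "integrand ?H (indicator A) \<in> borel_measurable ?P"
    by (intro measurable_integrand Hs ind)
  have "emeasure (distr induced induced (translate g)) A = emeasure induced ?A'"
    using A by (subst emeasure_distr[OF tr]) (simp_all add: space_induced)
  also have "\<dots> = (\<integral>\<^sup>+ Z. (\<integral>\<^sup>+ k. integrand K (indicator ?A') (Z, k) \<partial>m) \<partial>\<rho>)"
    unfolding emeasure_induced[OF A'] using m.nn_integral_fst[OF i2] by simp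
  also have "\<dots> = (\<integral>\<^sup>+ Z. (\<integral>\<^sup>+ k. integrand ?H (indicator A) (Z, k) \<partial>m) \<partial>\<rho>)"
  proof (rule nn_integral_cong)
    fix Z assume Z: "Z \<in> space \<rho>"
    have fm: "(\<lambda>k. integrand ?H (indicator A) (Z, k)) \<in> borel_measurable m"
      using measurable_compose[OF measurable_Pair1'[of Z \<rho> m] i3] Z by simp
    have "integrand K (indicator ?A') (Z, k) = integrand ?H (indicator A) (Z, g + k)" for k
    proof (cases "Z \<in> S")
      case True
      have 1: "emb (Z, g + k) = translate g (emb (Z, k))"
        using True by (simp add: emb_def translate_translate)
      have "indicator ?A' (emb (Z, k)) = (indicator A (emb (Z, g + k)) :: ennreal)"
        unfolding 1 using emb_X by (simp add: indicator_def)
      moreover have "indicator K k = (indicator ?H (g + k) :: ennreal)"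
        by (auto simp: indicator_def)
      moreover have "vis K (Z, k) = vis ?H (Z, g + k)"
        using visits_translate[of g K "translate k Z"] by (simp add: vis_def translate_translate)
      ultimately show ?thesis by (simp add: integrand_def)
    qed (simp add: integrand_def)
    then have "(\<integral>\<^sup>+ k. integrand K (indicator ?A') (Z, k) \<partial>m) = (\<integral>\<^sup>+ k. integrand ?H (indicator A) (Z, g + k) \<partial>m)"
      by simp
    also have "\<dots> = (\<integral>\<^sup>+ k. integrand ?H (indicator A) (Z, k) \<partial>m)" by (rule nn_integral_left[OF fm])
    finally show "(\<integral>\<^sup>+ k. integrand K (indicator ?A') (Z, k) \<partial>m) = (\<integral>\<^sup>+ k. integrand ?H (indicator A) (Z, k) \<partial>m)" .
  qed
  also have "\<dots> = (\<integral>\<^sup>+ x. integrand ?H (indicator A) x \<partial>?P)" using m.nn_integral_fst[OF i3] by simp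
  also have "\<dots> = (\<integral>\<^sup>+ x. integrand K (indicator A) x \<partial>?P)"
    by (rule mass_transport[OF admissible_translate admissible_K ind])
  also have "\<dots> = emeasure induced A" by (rule emeasure_induced[OF A, symmetric])
  finally show "emeasure (distr induced induced (translate g)) A = emeasure induced A" .
qed

text \<open>Every visit count is at least 1, so the total mass is at most that of the compact
  window.\<close>

lemma induced_finite: "emeasure induced X < \<infinity>"
proof -
  let ?P = "\<rho> \<Otimes>\<^sub>M m"
  have XX: "X \<in> sets XM" using sets.top[of XM] space_XM by simp
  have Km: "(\<lambda>x. indicator K (snd x) :: ennreal) \<in> borel_measurable ?P"
    using measurable_ind_snd[OF sets_K, of 0] by simp
  have "integrand K (indicator X) x \<le> indicator K (snd x)" for x
  proof (cases "fst x \<in> S")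
    case True
    obtain Z k where x: "x = (Z, k)" by (cases x)
    have v: "1 \<le> vis K x" using True admissible_K x unfolding admissible_def vis_def by simp
    have "(indicator K (snd x) :: ennreal) * 1 \<le> indicator K (snd x) * vis K x"
      using v by (rule mult_left_mono) simp
    then have "indicator K (snd x) / vis K x \<le> indicator K (snd x)"
      using v by (intro divide_le_posI_ennreal) (auto simp: mult.commute intro: less_le_trans[OF zero_less_one])
    then show ?thesis using True emb_X by (simp add: integrand_def)
  qed (simp add: integrand_def)
  then have "emeasure induced X \<le> (\<integral>\<^sup>+ x. indicator K (snd x) \<partial>?P)"
    unfolding emeasure_induced[OF XX] by (intro nn_integral_mono)
  also have "\<dots> = (\<integral>\<^sup>+ Z. (\<integral>\<^sup>+ k. indicator K k \<partial>m) \<partial>\<rho>)"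
    using m.nn_integral_fst[OF Km] by simp
  also have "\<dots> = emeasure m K"
    using sets_K emeasure_space_1 by (simp add: nn_integral_indicator)
  also have "\<dots> < \<infinity>" by (rule m_compact[OF K(1)])
  finally show ?thesis .
qed

text \<open>The countably many right translates of \<open>K\<close> by elements of
  \<open>\<Lambda>\<close> cover the group and all have the measure of \<open>K\<close>.\<close>

lemma emeasure_K_pos: "emeasure m K \<noteq> 0"
proof
  assume 0: "emeasure m K = 0"
  have "emeasure m ((\<lambda>x. x - l) -` K) = 0" for l
  proof -
    have "(\<lambda>x. x + - l) -` K \<inter> space m = (\<lambda>x. x - l) -` K" by (simp add: space_m)
    then have "emeasure m ((\<lambda>x. x - l) -` K) = emeasure (distr m m (\<lambda>x. x + - l)) K"
      using emeasure_distr[OF borel_measurable_shift(2)[of "- l"] sets_K] by simp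
    then show ?thesis unfolding m_right using 0 by simp
  qed
  moreover have "(\<lambda>x. x - l) -` K \<in> sets m" for l
    using measurable_sets[OF borel_measurable_shift(2)[of "- l"] sets_K] by (simp add: space_m)
  ultimately have "(\<Union>l\<in>\<Lambda>. (\<lambda>x. x - l) -` K) \<in> null_sets m"
    using countable_return(3) by (intro null_sets_UN') (auto simp: null_sets_def)
  moreover have "(\<Union>l\<in>\<Lambda>. (\<lambda>x. x - l) -` K) = UNIV"
  proof -
    have "x \<in> (\<Union>l\<in>\<Lambda>. (\<lambda>x. x - l) -` K)" for x
    proof -
      have "x \<in> K + \<Lambda>" unfolding K(2) by simp
      then obtain k l where "k \<in> K" "l \<in> \<Lambda>" "x = k + l" by (elim set_plus_elim)
      then show ?thesis by (intro UN_I[of l]) simp_all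
    qed
    then show ?thesis by blast
  qed
  ultimately have "UNIV \<in> null_sets m" by simp
  then have "emeasure m UNIV = 0" by (rule null_setsD1)
  then show False using m_nonzero by simp
qed

text \<open>For invariant A, membership of the translate in A does not depend on k. On a fibre with
  Z in \<open>S\<close> and in A the weight is strictly positive on \<open>K\<close>, because visit
  counts are finite, and \<open>K\<close> has positive measure.\<close>

lemma induced_null_iff:
  assumes A: "A \<in> sets XM" and inv: "\<And>k Z. Z \<in> X \<Longrightarrow> translate k Z \<in> A \<longleftrightarrow> Z \<in> A"
  shows "emeasure induced A = 0 \<longleftrightarrow> (AE Z in \<rho>. Z \<in> S \<longrightarrow> Z \<notin> A)"
proof -
  let ?P = "\<rho> \<Otimes>\<^sub>M m"
  have im: "integrand K (indicator A) \<in> borel_measurable ?P" using A by (intro measurable_integrand sets_K) simp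
  have zero: "(\<integral>\<^sup>+ k. integrand K (indicator A) (Z, k) \<partial>m) = 0 \<longleftrightarrow> (Z \<in> S \<longrightarrow> Z \<notin> A)" if Z: "Z \<in> space \<rho>" for Z
  proof (cases "Z \<in> S \<and> Z \<in> A")
    case False
    then have "integrand K (indicator A) (Z, k) = 0" for k
      using inv[of Z k] S_D(2)[of Z] by (auto simp: integrand_def emb_def)
    then show ?thesis using False by simp
  next
    case True
    have fm: "(\<lambda>k. integrand K (indicator A) (Z, k)) \<in> borel_measurable m"
      using measurable_compose[OF measurable_Pair1'[of Z \<rho> m] im] Z by simp
    have nz: "integrand K (indicator A) (Z, k) \<noteq> 0" if "k \<in> K" for k
    proof -
      have "vis K (Z, k) < \<infinity>" using True admissible_K unfolding admissible_def vis_def by simp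
      then have "1 / vis K (Z, k) \<noteq> 0" by (simp add: ennreal_divide_eq_0_iff)
      then show ?thesis using True that inv[of Z k] S_D(2)[of Z] by (simp add: integrand_def emb_def)
    qed
    have "\<not> (AE k in m. integrand K (indicator A) (Z, k) = 0)"
    proof
      assume "AE k in m. integrand K (indicator A) (Z, k) = 0"
      then have "AE k in m. k \<notin> K" by (rule AE_mp) (use nz in \<open>auto intro!: AE_I2\<close>)
      then have "emeasure m {k \<in> space m. k \<in> K} = 0"
        using sets_K by (subst (asm) AE_iff_measurable[of K]) (auto simp: space_m)
      then show False using emeasure_K_pos by (simp add: space_m)
    qed
    then show ?thesis using True nn_integral_0_iff_AE[OF fm] by simp
  qed
  have eq: "emeasure induced A = (\<integral>\<^sup>+ Z. (\<integral>\<^sup>+ k. integrand K (indicator A) (Z, k) \<partial>m) \<partial>\<rho>)"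
    unfolding emeasure_induced[OF A] using m.nn_integral_fst[OF im] by simp
  have "(\<lambda>Z. \<integral>\<^sup>+ k. integrand K (indicator A) (Z, k) \<partial>m) \<in> borel_measurable \<rho>"
    using m.borel_measurable_nn_integral_fst[OF im] by simp
  then have "emeasure induced A = 0 \<longleftrightarrow> (AE Z in \<rho>. (\<integral>\<^sup>+ k. integrand K (indicator A) (Z, k) \<partial>m) = 0)"
    unfolding eq by (rule nn_integral_0_iff_AE)
  also have "\<dots> \<longleftrightarrow> (AE Z in \<rho>. Z \<in> S \<longrightarrow> Z \<notin> A)"
    by (rule AE_cong) (rule zero)
  finally show ?thesis .
qed

lemma measurable_incl: "(\<lambda>Z. if Z \<in> X then Z else {}) \<in> pow_measurable L \<rightarrow>\<^sub>M XM"
proof (rule measurable_XM)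
  have "{} \<in> X" by (rule XI) auto
  then show "(if Z \<in> X then Z else {}) \<in> X" for Z by simp
  fix V :: "'a set" assume "open V"
  have "{Z \<in> space (pow_measurable L). (if Z \<in> X then Z else {}) \<inter> V \<noteq> {}} =
    {Z \<in> Pow L. Z \<in> X} \<inter> (\<Union>l\<in>L \<inter> V. {Z \<in> Pow L. l \<in> Z})" by auto
  also have "\<dots> \<in> sets (pow_measurable L)"
    using countable_return(2) by (intro sets.Int sets_X_L sets.countable_UN'' sets_pow_measurable_mem) simp
  finally show "{Z \<in> space (pow_measurable L). (if Z \<in> X then Z else {}) \<inter> V \<noteq> {}} \<in> sets (pow_measurable L)" .
qed

lemma sets_trace:
  assumes "A \<in> sets XM" shows "{Z \<in> Pow L. Z \<in> X \<and> Z \<in> A} \<in> sets (pow_measurable L)"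
proof -
  have "{Z \<in> Pow L. Z \<in> X \<and> Z \<in> A} =
    {Z \<in> Pow L. Z \<in> X} \<inter> ((\<lambda>Z. if Z \<in> X then Z else {}) -` A \<inter> space (pow_measurable L))" by auto
  also have "\<dots> \<in> sets (pow_measurable L)"
    by (intro sets.Int sets_X_L measurable_sets[OF measurable_incl assms])
  finally show ?thesis .
qed

text \<open>An invariant A leaves on \<open>Pow L\<close> a trace D that is stable under the partial
  translations, so translation by c matches the two pattern events cut with D. Extremality makes D
  trivial for \<open>\<rho>\<close>, and \<open>induced_null_iff\<close> carries this back to
  A.\<close>

lemma induced_ergodic:
  assumes ext: "\<And>D. D \<in> sets (pow_measurable L) \<Longrightarrow>
      (\<And>F c. finite F \<Longrightarrow> F \<subseteq> L \<Longrightarrow> F \<inter> \<Lambda> \<noteq> {} \<Longrightarrow> (\<lambda>x. x + c) ` F \<subseteq> L \<Longrightarrow>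
        (\<lambda>x. x + c) ` F \<inter> \<Lambda> \<noteq> {} \<Longrightarrow>
        emeasure \<rho> ({Z \<in> Pow L. (\<lambda>x. x + c) ` F \<subseteq> Z} \<inter> D) = emeasure \<rho> ({Z \<in> Pow L. F \<subseteq> Z} \<inter> D)) \<Longrightarrow>
      emeasure \<rho> D = 0 \<or> emeasure \<rho> (Pow L - D) = 0"
    and A: "A \<in> sets XM" and inv: "\<And>k Z. Z \<in> X \<Longrightarrow> translate k Z \<in> A \<longleftrightarrow> Z \<in> A"
  shows "emeasure induced A = 0 \<or> emeasure induced (X - A) = 0"
proof -
  define D where "D = {Z \<in> Pow L. Z \<in> X \<and> Z \<in> A}"
  have D: "D \<in> sets (pow_measurable L)" unfolding D_def by (rule sets_trace[OF A])
  have "emeasure \<rho> D = 0 \<or> emeasure \<rho> (Pow L - D) = 0"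
  proof (rule ext[OF D])
    fix F c assume F: "finite F" "F \<subseteq> L" "F \<inter> \<Lambda> \<noteq> {}" "(\<lambda>x. x + c) ` F \<subseteq> L" "(\<lambda>x. x + c) ` F \<inter> \<Lambda> \<noteq> {}"
    let ?Fc = "(\<lambda>x. x + c) ` F"
    define C1 where "C1 = {Z \<in> Pow L. F \<subseteq> Z} \<inter> D"
    define C2 where "C2 = {Z \<in> Pow L. ?Fc \<subseteq> Z} \<inter> D"
    have C2s: "C2 \<in> sets (pow_measurable L)" unfolding C2_def using F(1) by (intro sets.Int cylinder_measurable D) simp
    have C1s: "C1 \<in> sets (pow_measurable L)" unfolding C1_def using F(1) by (intro sets.Int cylinder_measurable D)
    have sub1: "Z \<in> S_shift c \<and> translate (- c) Z \<in> C2" if Z: "Z \<in> C1" for Z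
    proof -
      obtain a b where ab: "a \<in> F" "a \<in> \<Lambda>" "b \<in> ?Fc" "b \<in> \<Lambda>" using F(3,5) by blast
      have ZX: "Z \<in> X" "F \<subseteq> Z" "Z \<in> A" using Z unfolding C1_def D_def by blast+
      have Fc: "?Fc \<subseteq> translate (- c) Z" using ZX(2) by (auto simp: mem_translate)
      have "Z \<in> S" using ZX ab by (intro S_I[of _ a]) auto
      moreover have tS: "translate (- c) Z \<in> S" using ZX ab Fc by (intro S_I[of _ b]) auto
      ultimately have "Z \<in> S_shift c" unfolding S_shift_def by simp
      moreover have "translate (- c) Z \<in> C2"
        unfolding C2_def D_def using S_D(1)[OF tS] Fc ZX inv[OF ZX(1)] by simp
      ultimately show ?thesis by simp
    qed
    have sub2: "Z \<in> S_shift (- c) \<and> translate c Z \<in> C1" if Z: "Z \<in> C2" for Z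
    proof -
      obtain a b where ab: "a \<in> F" "a \<in> \<Lambda>" "b \<in> ?Fc" "b \<in> \<Lambda>" using F(3,5) by blast
      have ZX: "Z \<in> X" "?Fc \<subseteq> Z" "Z \<in> A" using Z unfolding C2_def D_def by blast+
      have Fc: "F \<subseteq> translate c Z" using ZX(2) by (auto simp: mem_translate)
      have "Z \<in> S" using ZX ab by (intro S_I[of _ b]) auto
      moreover have tS: "translate c Z \<in> S" using ZX ab Fc by (intro S_I[of _ a]) auto
      ultimately have "Z \<in> S_shift (- c)" unfolding S_shift_def by simp
      moreover have "translate c Z \<in> C1"
        unfolding C1_def D_def using S_D(1)[OF tS] Fc ZX inv[OF ZX(1)] by simp
      ultimately show ?thesis by simp
    qed
    have e1: "Z \<in> S_shift c \<and> translate (- c) Z \<in> C2 \<longleftrightarrow> Z \<in> C1" for Z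
    proof
      assume "Z \<in> S_shift c \<and> translate (- c) Z \<in> C2"
      then have "translate c (translate (- c) Z) \<in> C1" using sub2 by blast
      then show "Z \<in> C1" by (simp add: translate_translate)
    qed (rule sub1)
    \<comment> \<open>By \<open>e1\<close> the event \<open>C1\<close> is exactly the preimage of
      \<open>C2\<close> under the partial translation, so the invariance of \<open>\<rho>\<close>
      applies to the indicator of \<open>C2\<close>.\<close>
    have "(\<integral>\<^sup>+ Z. indicator (S_shift c) Z * indicator C2 (translate (- c) Z) \<partial>\<rho>) = (\<integral>\<^sup>+ Z. indicator C1 Z \<partial>\<rho>)"
    proof (intro nn_integral_cong)
      fix Z show "indicator (S_shift c) Z * indicator C2 (translate (- c) Z) = (indicator C1 Z :: ennreal)"
        using e1[of Z] by (auto simp: indicator_def)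
    qed
    moreover have "(\<integral>\<^sup>+ Z. indicator (S_shift (- c)) Z * indicator C2 Z \<partial>\<rho>) = (\<integral>\<^sup>+ Z. indicator C2 Z \<partial>\<rho>)"
    proof (intro nn_integral_cong)
      fix Z show "indicator (S_shift (- c)) Z * indicator C2 Z = (indicator C2 Z :: ennreal)"
        using sub2[of Z] by (auto simp: indicator_def)
    qed
    ultimately have "(\<integral>\<^sup>+ Z. indicator C1 Z \<partial>\<rho>) = (\<integral>\<^sup>+ Z. indicator C2 Z \<partial>\<rho>)"
      using shift_nn_integral[of "indicator C2" c] C2s by simp
    then have "emeasure \<rho> C2 = emeasure \<rho> C1" using C1s C2s sets_\<rho> by (simp add: nn_integral_indicator)
    then show "emeasure \<rho> ({Z \<in> Pow L. ?Fc \<subseteq> Z} \<inter> D) = emeasure \<rho> ({Z \<in> Pow L. F \<subseteq> Z} \<inter> D)"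
      unfolding C1_def C2_def .
  qed
  then show ?thesis
  proof
    assume "emeasure \<rho> D = 0"
    then have "AE Z in \<rho>. Z \<notin> D" using D sets_\<rho> by (intro AE_not_in) (simp add: null_sets_def)
    then have "AE Z in \<rho>. Z \<in> S \<longrightarrow> Z \<notin> A"
      by (rule AE_mp) (rule AE_I2, use S_D in \<open>auto simp: D_def\<close>)
    then show ?thesis using induced_null_iff[OF A inv] by simp
  next
    assume 0: "emeasure \<rho> (Pow L - D) = 0"
    have XX: "X - A \<in> sets XM" using sets.compl_sets[OF A] space_XM by simp
    have "Pow L - D \<in> sets \<rho>" using sets.compl_sets[OF D] sets_\<rho> by simp
    then have "AE Z in \<rho>. Z \<notin> Pow L - D" using 0 by (intro AE_not_in) (simp add: null_sets_def)
    then have "AE Z in \<rho>. Z \<in> S \<longrightarrow> Z \<notin> X - A"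
      by (rule AE_mp) (rule AE_I2, use S_D in \<open>auto simp: D_def space_\<rho>\<close>)
    moreover have "translate k Z \<in> X - A \<longleftrightarrow> Z \<in> X - A" if "Z \<in> X" for k Z using inv[OF that] that by simp
    ultimately show ?thesis using induced_null_iff[OF XX] by simp
  qed
qed

text \<open>By the Lindelof property, an invariant measure giving mass zero to the sets that hit \<open>V\<close> is
  carried by the empty set.\<close>

lemma induced_hit_pos:
  assumes V: "open V" "0 \<in> V" and S: "emeasure \<rho> S > 0"
  shows "emeasure induced {Z \<in> space XM. Z \<inter> V \<noteq> {}} \<noteq> 0"
proof
  assume 0: "emeasure induced {Z \<in> space XM. Z \<inter> V \<noteq> {}} = 0"
  let ?h = "\<lambda>W. {Z \<in> space XM. Z \<inter> W \<noteq> {}}"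
  let ?T = "\<lambda>g. (\<lambda>x. x + g) ` V"
  have hs: "?h W \<in> sets induced" if "open W" for W using sets_borel_of_hit[OF that] by simp
  have tr: "translate g \<in> induced \<rightarrow>\<^sub>M induced" for g
    using measurable_translate_XM by (simp cong: measurable_cong_sets)
  have "emeasure induced (?h (?T g)) = 0" for g
  proof -
    have "Z \<inter> ?T g \<noteq> {} \<longleftrightarrow> translate g Z \<inter> V \<noteq> {}" for Z
    proof
      assume "Z \<inter> ?T g \<noteq> {}"
      then obtain v where "v \<in> V" "v + g \<in> Z" by blast
      then have "v \<in> translate g Z \<inter> V" by (simp add: mem_translate)
      then show "translate g Z \<inter> V \<noteq> {}" by blast
    next
      assume "translate g Z \<inter> V \<noteq> {}"
      then obtain v where "v \<in> V" "v + g \<in> Z" by (auto simp: mem_translate)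
      then show "Z \<inter> ?T g \<noteq> {}" by blast
    qed
    then have "?h (?T g) = translate g -` ?h V \<inter> space induced"
      unfolding space_XM space_induced by auto
    then have "emeasure induced (?h (?T g)) = emeasure (distr induced induced (translate g)) (?h V)"
      using emeasure_distr[OF tr hs[OF V(1)]] by simp
    then show ?thesis unfolding induced_invariant using 0 by simp
  qed
  then have null: "?h (?T g) \<in> null_sets induced" for g
    using hs[OF open_translate_right[OF V(1)]] by (simp add: null_sets_def)
  obtain \<F> where F: "\<F> \<subseteq> range ?T" "countable \<F>" "\<Union>\<F> = \<Union>(range ?T)"
    using Lindelof[of "range ?T"] open_translate_right[OF V(1)] by (metis (no_types, lifting) imageE)
  have "g \<in> ?T g" for g using V(2) by (intro image_eqI[of _ _ 0]) simp_all
  then have cover: "\<Union>\<F> = UNIV" unfolding F(3) by blast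
  have "(\<Union>W\<in>\<F>. ?h W) \<in> null_sets induced"
    using F(1,2) null by (intro null_sets_UN') blast+
  moreover have "(\<Union>W\<in>\<F>. ?h W) = ?h UNIV" using cover by blast
  ultimately have "emeasure induced (?h UNIV) = 0" by (simp add: null_sets_def)
  moreover have inv: "translate k Z \<in> ?h UNIV \<longleftrightarrow> Z \<in> ?h UNIV" if "Z \<in> X" for k Z
  proof -
    have "translate k Z = {} \<longleftrightarrow> Z = {}" by (simp add: translate_def)
    then show ?thesis using that by (simp add: space_XM)
  qed
  moreover have hU: "?h UNIV \<in> sets XM" using hs[OF open_UNIV] by simp
  ultimately have "AE Z in \<rho>. Z \<in> S \<longrightarrow> Z \<notin> ?h UNIV"
    by (intro iffD1[OF induced_null_iff[OF hU inv]])
  then have "AE Z in \<rho>. Z \<notin> S"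
    by (rule AE_mp) (rule AE_I2, use S_D in \<open>auto simp: space_XM\<close>)
  then have "emeasure \<rho> S = 0"
  proof (subst (asm) AE_iff_measurable[OF sets_rho_S])
    show "{x \<in> space \<rho>. \<not> x \<notin> S} = S" using sets.sets_into_space[OF sets_rho_S] by auto
  qed
  then show False using S by simp
qed

end

section \<open>Ergodic averages on spaces that are not carried by reals\<close>

lemma measurable_borel_of_continuous_map:
  assumes "continuous_map S T f"
  shows "f \<in> borel_of S \<rightarrow>\<^sub>M borel_of T"
proof -
  have "f \<in> borel_of S \<rightarrow>\<^sub>M sigma (topspace T) {U. openin T U}"
  proof (rule measurable_sigma_sets)
    show "sets (sigma (topspace T) {U. openin T U}) = sigma_sets (topspace T) {U. openin T U}"
      using sets_borel_of unfolding borel_of_def .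
    show "{U. openin T U} \<subseteq> Pow (topspace T)" using openin_subset by blast
    show "f \<in> space (borel_of S) \<rightarrow> topspace T"
      unfolding space_borel_of using assms continuous_map_image_subset_topspace by blast
    fix U assume "U \<in> {U. openin T U}"
    then have "openin S {x \<in> topspace S. f x \<in> U}" using assms by (simp add: continuous_map_def)
    moreover have "f -` U \<inter> space (borel_of S) = {x \<in> topspace S. f x \<in> U}"
      unfolding space_borel_of by auto
    ultimately show "f -` U \<inter> space (borel_of S) \<in> sets (borel_of S)" by (simp add: borel_of_open)
  qed
  then show ?thesis unfolding borel_of_def[of T] .
qed

text \<open>\<open>convenient_sequence\<close> speaks about spaces of reals only, so the action is
  transported along an injection J into the reals. The set \<open>Gd\<close> is chosen before any
  measure \<open>\<eta>\<close>: the extremal measure to which it is applied is constructed later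
  and depends on it.\<close>

lemma convenient_sequence_good_set:
  fixes T :: "'x topology" and J :: "'x \<Rightarrow> real" and act :: "'g::{group_add,topological_space} \<Rightarrow> 'x \<Rightarrow> 'x"
  assumes conv: "convenient_sequence m G"
    and T: "completely_metrizable_space T" "second_countable T" and J: "inj_on J (topspace T)"
    and act: "borel_action (borel_of T) act"
    and \<phi>: "\<phi> \<in> borel_measurable (borel_of T)" "\<And>x. \<bar>\<phi> x\<bar> \<le> C"
  obtains Gd where "Gd \<in> sets (borel_of T)"
    "\<And>x. x \<in> Gd \<Longrightarrow> \<exists>l>0. ((\<lambda>t. window_average m G act \<phi> t x) \<longlongrightarrow> l) at_top"
    "\<And>\<eta>. sets \<eta> = sets (borel_of T) \<Longrightarrow> prob_space \<eta> \<Longrightarrow> (\<And>g. distr \<eta> \<eta> (act g) = \<eta>) \<Longrightarrow>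
      (\<And>A. A \<in> sets (borel_of T) \<Longrightarrow> (\<And>g x. x \<in> topspace T \<Longrightarrow> act g x \<in> A \<longleftrightarrow> x \<in> A) \<Longrightarrow>
        emeasure \<eta> A = 0 \<or> emeasure \<eta> (topspace T - A) = 0) \<Longrightarrow>
      (\<integral>y. \<phi> y \<partial>\<eta>) > 0 \<Longrightarrow>
      \<exists>E\<in>sets (borel_of T). E \<subseteq> Gd \<and> (\<forall>g. \<forall>x\<in>topspace T. act g x \<in> E \<longleftrightarrow> x \<in> E) \<and>
        emeasure \<eta> (topspace T - E) = 0"
proof -
  define Y where "Y = topspace T"
  define K where "K = inv_into Y J"
  \<comment> \<open>The image carries the topology transported from T, which makes the arbitrary
    injection J a homeomorphism; it is not the subspace topology of the reals.\<close>
  define TR where "TR = pullback_topology (J ` Y) K T"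
  have KJ: "K (J x) = x" if "x \<in> Y" for x
    unfolding K_def using J that by (simp add: Y_def)
  have JK: "J (K r) = r" "K r \<in> Y" if "r \<in> J ` Y" for r
    using that by (auto simp: KJ)
  have tTR: "topspace TR = J ` Y"
    unfolding TR_def topspace_pullback_topology Y_def[symmetric] using JK by blast
  have cK: "continuous_map TR T K"
    using continuous_map_pullback[OF continuous_map_id, of "J ` Y" K T] unfolding TR_def by simp
  have cJ: "continuous_map T TR J"
    unfolding TR_def
  proof (rule continuous_map_pullback')
    have "continuous_map T T id" by (rule continuous_map_id)
    then show "continuous_map T T (K \<circ> J)"
      by (rule continuous_map_eq) (simp add: KJ Y_def)
    show "topspace T \<subseteq> J -` J ` Y" by (auto simp: Y_def)
  qed
  have hom: "T homeomorphic_space TR"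
    unfolding homeomorphic_space_def homeomorphic_maps_def
    using cJ cK KJ JK tTR by (intro exI[of _ J] exI[of _ K]) (auto simp: Y_def)
  have TR: "completely_metrizable_space TR" "second_countable TR"
    using T homeomorphic_completely_metrizable_space[OF hom] homeomorphic_space_second_countability[OF hom] by simp_all
  let ?X = "borel_of T" and ?XR = "borel_of TR"
  have spX: "space ?X = Y" and spXR: "space ?XR = J ` Y"
    using tTR by (simp_all add: space_borel_of Y_def)
  have Jm: "J \<in> ?X \<rightarrow>\<^sub>M ?XR" and Km: "K \<in> ?XR \<rightarrow>\<^sub>M ?X"
    using cJ cK by (simp_all add: measurable_borel_of_continuous_map)
  define actR where "actR g r = J (act g (K r))" for g r
  define \<phi>R where "\<phi>R r = \<phi> (K r)" for r
  have actm: "(\<lambda>(g, x). act g x) \<in> borel \<Otimes>\<^sub>M ?X \<rightarrow>\<^sub>M ?X"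
    and act0: "\<And>x. x \<in> Y \<Longrightarrow> act 0 x = x"
    and actadd: "\<And>g h x. x \<in> Y \<Longrightarrow> act (g + h) x = act g (act h x)"
    using act unfolding borel_action_def spX by auto
  have actY: "act g x \<in> Y" if "x \<in> Y" for g x
    using measurable_space[OF actm, of "(g, x)"] that by (simp add: space_pair_measure spX)
  have actgm: "act g \<in> ?X \<rightarrow>\<^sub>M ?X" for g
  proof -
    have "g \<in> space borel" by simp
    from measurable_compose[OF measurable_Pair1'[OF this] actm] show ?thesis by simp
  qed
  have "standard_borel_space ?XR"
    unfolding standard_borel_space_def using TR by (intro exI[of _ TR]) (simp add: space_borel_of)
  moreover have "borel_action ?XR actR"
    unfolding borel_action_def
  proof (intro conjI ballI allI)
    have "(\<lambda>x. (fst x, K (snd x))) \<in> borel \<Otimes>\<^sub>M ?XR \<rightarrow>\<^sub>M borel \<Otimes>\<^sub>M ?X"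
      by (intro measurable_Pair measurable_fst measurable_compose[OF measurable_snd Km])
    from measurable_compose[OF measurable_compose[OF this actm] Jm]
    show "(\<lambda>(g, x). actR g x) \<in> borel \<Otimes>\<^sub>M ?XR \<rightarrow>\<^sub>M ?XR"
      by (simp add: actR_def case_prod_beta')
    fix r assume "r \<in> space ?XR"
    then have r: "r \<in> J ` Y" using spXR by simp
    show "actR 0 r = r" using JK[OF r] act0 by (simp add: actR_def)
    show "actR (g + h) r = actR g (actR h r)" for g h
      using JK[OF r] actadd actY KJ by (simp add: actR_def)
  qed
  moreover have \<phi>Rm: "\<phi>R \<in> borel_measurable ?XR"
    unfolding \<phi>R_def by (rule measurable_compose[OF Km \<phi>(1)])
  moreover have "\<exists>C. \<forall>x\<in>space ?XR. \<bar>\<phi>R x\<bar> \<le> C" using \<phi>(2) unfolding \<phi>R_def by blast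
  ultimately have eac: "ergodic_averages_converge m G ?XR actR \<phi>R"
    using conv unfolding convenient_sequence_def by blast
  define E where "E = convergence_set m G ?XR actR \<phi>R"
  have E: "E \<in> sets ?XR" and lm: "limit_average m G actR \<phi>R \<in> borel_measurable (restrict_space ?XR E)"
    and erg: "\<And>\<mu>. sets \<mu> = sets ?XR \<Longrightarrow> prob_space \<mu> \<Longrightarrow> invariant_measure actR \<mu> \<Longrightarrow> ergodic_measure actR \<mu> \<Longrightarrow>
      \<exists>E'\<in>sets ?XR. E' \<subseteq> E \<and> invariant_set actR E' \<and> space ?XR - E' \<in> null_sets \<mu> \<and>
        (\<forall>x\<in>E'. limit_average m G actR \<phi>R x = (\<integral>y. \<phi>R y \<partial>\<mu>))"
    using eac unfolding ergodic_averages_converge_def Let_def E_def by blast+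
  define GR where "GR = {r \<in> E. limit_average m G actR \<phi>R r > 0}"
  have GR: "GR \<in> sets ?XR"
  proof -
    have "E \<inter> space ?XR = E" using sets.sets_into_space[OF E] by blast
    then have "GR = {r \<in> space (restrict_space ?XR E). limit_average m G actR \<phi>R r > 0}"
      unfolding GR_def space_restrict_space by simp
    moreover have "{r \<in> space (restrict_space ?XR E). limit_average m G actR \<phi>R r > 0} \<in> sets (restrict_space ?XR E)"
      using lm by (rule borel_measurable_less[OF borel_measurable_const])
    ultimately show ?thesis using E by (subst (asm) sets_restrict_space_iff) simp_all
  qed
  have win: "window_average m G actR \<phi>R t (J x) = window_average m G act \<phi> t x" if "x \<in> Y" for t x
    unfolding window_average_def \<phi>R_def actR_def using that actY KJ by simp
  \<comment> \<open>Invariance as an equality of images in the definitions becomes an equivalence of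
    memberships; the backward direction applies the inverse - g.\<close>
  have inv_pull: "act g x \<in> J -` A \<inter> Y \<longleftrightarrow> x \<in> J -` A \<inter> Y"
    if A: "invariant_set actR A" and x: "x \<in> Y" for A g x
  proof -
    have *: "actR h r \<in> A" if "r \<in> A" for h r using A that unfolding invariant_set_def by blast
    have 1: "actR g (J x) = J (act g x)" using KJ[OF x] by (simp add: actR_def)
    have 2: "actR (- g) (J (act g x)) = J x"
      using KJ[OF actY[OF x]] actadd[OF x, of "- g" g] act0[OF x] by (simp add: actR_def)
    show ?thesis using *[of "J x" g] *[of "J (act g x)" "- g"] 1 2 x actY[OF x] by auto
  qed
  show ?thesis
  proof (rule that[of "J -` GR \<inter> Y"])
    show "J -` GR \<inter> Y \<in> sets ?X" using measurable_sets[OF Jm GR] spX by simp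
    show "\<exists>l>0. ((\<lambda>t. window_average m G act \<phi> t x) \<longlongrightarrow> l) at_top" if x: "x \<in> J -` GR \<inter> Y" for x
    proof -
      have "J x \<in> E" "limit_average m G actR \<phi>R (J x) > 0" using x unfolding GR_def by auto
      then obtain l where l: "((\<lambda>t. window_average m G actR \<phi>R t (J x)) \<longlongrightarrow> l) at_top"
        unfolding E_def convergence_set_def by blast
      then have "limit_average m G actR \<phi>R (J x) = l"
        unfolding limit_average_def by (intro tendsto_Lim) simp_all
      then have "l > 0" using \<open>limit_average m G actR \<phi>R (J x) > 0\<close> by simp
      moreover have "((\<lambda>t. window_average m G act \<phi> t x) \<longlongrightarrow> l) at_top" using l win x by simp
      ultimately show ?thesis by blast
    qed
    fix \<eta> assume \<eta>: "sets \<eta> = sets ?X" "prob_space \<eta>" "\<And>g. distr \<eta> \<eta> (act g) = \<eta>"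
      and \<eta>erg: "\<And>A. A \<in> sets ?X \<Longrightarrow> (\<And>g x. x \<in> topspace T \<Longrightarrow> act g x \<in> A \<longleftrightarrow> x \<in> A) \<Longrightarrow>
        emeasure \<eta> A = 0 \<or> emeasure \<eta> (topspace T - A) = 0"
      and pos: "(\<integral>y. \<phi> y \<partial>\<eta>) > 0"
    have sp\<eta>: "space \<eta> = Y" using sets_eq_imp_space_eq[OF \<eta>(1)] spX by simp
    have Jm\<eta>: "J \<in> \<eta> \<rightarrow>\<^sub>M ?XR" using Jm \<eta>(1) by (simp cong: measurable_cong_sets)
    define \<mu> where "\<mu> = distr \<eta> ?XR J"
    have \<mu>s: "sets \<mu> = sets ?XR" unfolding \<mu>_def by simp
    have \<mu>e: "emeasure \<mu> A = emeasure \<eta> (J -` A \<inter> Y)" if "A \<in> sets ?XR" for A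
      unfolding \<mu>_def using emeasure_distr[OF Jm\<eta> that] sp\<eta> by simp
    have \<mu>p: "prob_space \<mu>" unfolding \<mu>_def by (rule prob_space.prob_space_distr[OF \<eta>(2) Jm\<eta>])
    have compl: "J -` (space ?XR - A) \<inter> Y = Y - (J -` A \<inter> Y)" for A unfolding spXR by blast
    have actR_m: "actR g \<in> ?XR \<rightarrow>\<^sub>M ?XR" for g
      unfolding actR_def by (intro measurable_compose[OF measurable_compose[OF Km actgm] Jm])
    have "distr \<mu> \<mu> (actR g) = \<mu>" for g
    proof -
      have "distr \<mu> \<mu> (actR g) = distr \<mu> ?XR (actR g)" by (rule distr_cong) (simp_all add: \<mu>s)
      also have "\<dots> = distr \<eta> ?XR (actR g \<circ> J)" unfolding \<mu>_def by (rule distr_distr[OF actR_m Jm\<eta>])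
      also have "\<dots> = distr \<eta> ?XR (J \<circ> act g)"
        by (rule distr_cong) (simp_all add: sp\<eta> actR_def KJ)
      also have "\<dots> = distr (distr \<eta> \<eta> (act g)) ?XR J"
        using actgm Jm\<eta> \<eta>(1) by (subst distr_distr) (simp_all cong: measurable_cong_sets)
      finally show ?thesis unfolding \<eta>(3) \<mu>_def .
    qed
    then have \<mu>i: "invariant_measure actR \<mu>" unfolding invariant_measure_def by simp
    have \<mu>erg: "ergodic_measure actR \<mu>"
      unfolding ergodic_measure_def
    proof (intro ballI impI)
      fix A assume A: "A \<in> sets \<mu>" "invariant_set actR A"
      then have As: "A \<in> sets ?XR" using \<mu>s by simp
      have Js: "J -` A \<inter> Y \<in> sets ?X" using measurable_sets[OF Jm As] spX by simp
      have "emeasure \<eta> (J -` A \<inter> Y) = 0 \<or> emeasure \<eta> (topspace T - (J -` A \<inter> Y)) = 0"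
        using inv_pull[OF A(2)] by (intro \<eta>erg Js) (simp_all only: Y_def)
      moreover have "space \<mu> = space ?XR" using sets_eq_imp_space_eq[OF \<mu>s] .
      moreover have "space ?XR - A \<in> sets ?XR" using As by (rule sets.compl_sets)
      ultimately show "emeasure \<mu> A = 0 \<or> emeasure \<mu> (space \<mu> - A) = 0"
        using \<mu>e[OF As] \<mu>e[of "space ?XR - A"] compl[of A] by (simp add: Y_def)
    qed
    obtain E' where E': "E' \<in> sets ?XR" "E' \<subseteq> E" "invariant_set actR E'" "space ?XR - E' \<in> null_sets \<mu>"
      "\<And>x. x \<in> E' \<Longrightarrow> limit_average m G actR \<phi>R x = (\<integral>y. \<phi>R y \<partial>\<mu>)"
      using erg[OF \<mu>s \<mu>p \<mu>i \<mu>erg] by blast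
    have "(\<integral>y. \<phi>R y \<partial>\<mu>) = (\<integral>y. \<phi>R (J y) \<partial>\<eta>)" unfolding \<mu>_def by (rule integral_distr[OF Jm\<eta> \<phi>Rm])
    also have "\<dots> = (\<integral>y. \<phi> y \<partial>\<eta>)"
      by (rule Bochner_Integration.integral_cong) (simp_all add: sp\<eta> \<phi>R_def KJ)
    finally have "E' \<subseteq> GR" using E'(2,5) pos unfolding GR_def by auto
    then have "J -` E' \<inter> Y \<subseteq> J -` GR \<inter> Y" by blast
    moreover have "J -` E' \<inter> Y \<in> sets ?X" using measurable_sets[OF Jm E'(1)] spX by simp
    moreover have "emeasure \<eta> (topspace T - (J -` E' \<inter> Y)) = 0"
      using null_setsD1[OF E'(4)] \<mu>e[of "space ?XR - E'"] E'(1) compl[of E'] by (simp add: Y_def)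
    ultimately show "\<exists>E\<in>sets ?X. E \<subseteq> J -` GR \<inter> Y \<and> (\<forall>g. \<forall>x\<in>topspace T. act g x \<in> E \<longleftrightarrow> x \<in> E) \<and>
        emeasure \<eta> (topspace T - E) = 0"
      using inv_pull[OF E'(3)] unfolding Y_def by (intro bexI[of _ "J -` E' \<inter> topspace T"]) blast+
  qed
qed

section \<open>From averages to lower densities\<close>

context return_set
begin

text \<open>The g for which \<open>translate g Z\<close> hits V form the union over p in Z of sets
  of equal Haar measure c. If such a g lies in G t, then p lies in the outer set of G t, hence in G
  (t + \<delta>). So the average times the volume of G t is at most c times the number of points of
  Z in G (t + \<delta>), and the volume ratio costs only a factor close to 1 - \<epsilon>.\<close>

lemma lower_density_pos:
  assumes m: "sets m = sets borel" "\<And>g. distr m m (\<lambda>x. x + g) = m"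
    and mc: "\<And>C. compact C \<Longrightarrow> emeasure m C < \<infinity>"
    and G: "\<And>t. t > 0 \<Longrightarrow> G t \<in> sets borel" "\<And>t. t > 0 \<Longrightarrow> compact (closure (G t))"
      "\<And>t. t > 0 \<Longrightarrow> measure m (G t) > 0"
    and \<delta>: "\<delta> > 0" "\<epsilon> < 1" "\<And>t. t > \<tau> \<Longrightarrow> outer_set W (G t) \<subseteq> G (t + \<delta>)"
      "ereal (1 - \<epsilon>) \<le> Liminf at_top (\<lambda>t. ereal (measure m (G (t - \<delta>)) / measure m (G t)))"
    and V: "open V" "\<And>v. v \<in> V \<Longrightarrow> - v \<in> W" "emeasure m {g. - g \<in> V} < \<infinity>"
    and Z: "Z \<in> X" and l: "l > 0"
      "((\<lambda>t. window_average m G translate (\<lambda>Q. indicator {Q. Q \<inter> V \<noteq> {}} Q) t Z) \<longlongrightarrow> l) at_top"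
  shows "lower_density m G Z > 0"
proof -
  define \<phi> :: "'g set \<Rightarrow> real" where "\<phi> Q = indicator {Q. Q \<inter> V \<noteq> {}} Q" for Q
  have l\<phi>: "((\<lambda>t. window_average m G translate \<phi> t Z) \<longlongrightarrow> l) at_top" using l(2) unfolding \<phi>_def .
  define N where "N = (\<lambda>p. {g. p - g \<in> V})"
  have oN: "open (N p)" for p
    using open_vimage[OF V(1), of "\<lambda>g. p - g"] unfolding N_def vimage_def by (simp add: continuous_intros)
  have Ns: "N p \<in> sets m" for p using oN m(1) by simp
  have eN: "emeasure m (N p) = emeasure m (N 0)" for p
  proof -
    have eq: "0 - (x + - p) = p - x" for x by (simp only: group_normalize)
    have "emeasure m {x. x + - p \<in> N 0} = emeasure m (N 0)"
      using oN by (intro distr_shift_emeasure m) simp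
    then show ?thesis unfolding N_def mem_Collect_eq eq .
  qed
  define c where "c = measure m (N 0)"
  have N0: "emeasure m (N 0) < \<infinity>" using V(3) by (simp add: N_def)
  have mN: "measure m (N p) = c" for p using eN[of p] unfolding c_def measure_def by simp
  have fG: "emeasure m (G t) < \<infinity>" if "t > 0" for t
  proof -
    have "emeasure m (G t) \<le> emeasure m (closure (G t))"
      using closure_subset m(1) by (intro emeasure_mono) auto
    then show ?thesis using mc[OF G(2)[OF that]] by (rule le_less_trans)
  qed
  have finZ: "finite (Z \<inter> G t)" if "t > 0" for t
  proof -
    have "finite (Z \<inter> closure (G t))"
      by (rule separated_by_finite[OF U(1,2) X_separated[OF Z] G(2)[OF that]])
    then show ?thesis by (rule finite_subset[rotated]) (use closure_subset in blast)
  qed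
  have avg: "window_average m G translate \<phi> t Z * measure m (G t) \<le> c * real (card (Z \<inter> G (t + \<delta>)))"
    if t: "t > 0" "t > \<tau>" for t
  proof -
    define O1 where "O1 = (\<Union>p\<in>Z. N p)"
    have O1: "open O1" unfolding O1_def using oN by blast
    have \<phi>O: "\<phi> (translate g Z) = indicator O1 g" for g
    proof -
      have "translate g Z \<inter> V \<noteq> {} \<longleftrightarrow> g \<in> O1"
        unfolding O1_def N_def translate_def by auto
      then show ?thesis unfolding \<phi>_def by (simp add: indicator_def)
    qed
    have Gs: "G t \<in> sets m" using G(1)[OF t(1)] m(1) by simp
    have O1s: "O1 \<in> sets m" using O1 m(1) by simp
    have "(LINT g:G t|m. \<phi> (translate g Z)) = (LINT g|m. indicator (G t \<inter> O1) g)"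
      unfolding \<phi>O set_lebesgue_integral_def
      by (rule Bochner_Integration.integral_cong) (simp_all add: indicator_def)
    also have "\<dots> = measure m (G t \<inter> O1)"
      using Gs O1s sets.sets_into_space[OF Gs] by (simp add: Int_absorb1 Int_assoc inf.absorb1 le_infI1)
    finally have int: "(LINT g:G t|m. \<phi> (translate g Z)) = measure m (G t \<inter> O1)" .
    have sub: "G t \<inter> O1 \<subseteq> (\<Union>p\<in>Z \<inter> G (t + \<delta>). N p)"
    proof
      fix g assume g: "g \<in> G t \<inter> O1"
      then obtain p where p: "p \<in> Z" "p - g \<in> V" unfolding O1_def N_def by blast
      have "- (p - g) \<in> W" using V(2)[OF p(2)] .
      moreover have "p = - (- (p - g)) + g" by (simp only: group_normalize)
      ultimately have "p \<in> outer_set W (G t)" unfolding outer_set_def using g by blast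
      then have "p \<in> G (t + \<delta>)" using \<delta>(3)[OF t(2)] by blast
      then show "g \<in> (\<Union>p\<in>Z \<inter> G (t + \<delta>). N p)" using p unfolding N_def by blast
    qed
    have fin: "finite (Z \<inter> G (t + \<delta>))" using t(1) \<delta>(1) by (intro finZ) simp
    have Nf: "N p \<in> fmeasurable m" for p using Ns N0 eN[of p] by (intro fmeasurableI) simp_all
    have Uf: "(\<Union>p\<in>Z \<inter> G (t + \<delta>). N p) \<in> fmeasurable m"
      by (rule fmeasurable.finite_UN[OF fin Nf])
    have "measure m (G t \<inter> O1) \<le> measure m (\<Union>p\<in>Z \<inter> G (t + \<delta>). N p)"
      by (rule measure_mono_fmeasurable[OF sub sets.Int[OF Gs O1s] Uf])
    also have "\<dots> \<le> (\<Sum>p\<in>Z \<inter> G (t + \<delta>). measure m (N p))"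
      by (rule measure_UNION_le[OF fin]) (rule Ns)
    also have "\<dots> = c * real (card (Z \<inter> G (t + \<delta>)))" by (simp add: mN)
    finally show ?thesis
      unfolding window_average_def int using G(3)[OF t(1)] by simp
  qed
  have shift: "filterlim (\<lambda>s. s - \<delta>) at_top (at_top :: real filter)"
    using filterlim_tendsto_add_at_top[OF tendsto_const filterlim_ident, of "- \<delta>"] by simp
  have "\<forall>\<^sub>F t in at_top. window_average m G translate \<phi> t Z > l / 2"
    using l(1) by (intro order_tendstoD(1)[OF l\<phi>]) simp
  then have ev1: "\<forall>\<^sub>F s in at_top. window_average m G translate \<phi> (s - \<delta>) Z > l / 2"
    using filterlim_iff[THEN iffD1, OF shift] by blast
  \<comment> \<open>Halving makes the bound strict, so that it holds eventually; the same device
    turns the limit l into l / 2.\<close>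
  have "ereal ((1 - \<epsilon>) / 2) < Liminf at_top (\<lambda>t. ereal (measure m (G (t - \<delta>)) / measure m (G t)))"
    by (rule less_le_trans[OF _ \<delta>(4)]) (use \<delta>(2) in simp)
  then have ev2: "\<forall>\<^sub>F s in at_top. (1 - \<epsilon>) / 2 < measure m (G (s - \<delta>)) / measure m (G s)"
    by (auto dest!: less_LiminfD)
  have ev3: "\<forall>\<^sub>F s in at_top. s > \<bar>\<tau>\<bar> + \<delta>" by (rule eventually_gt_at_top)
  have main: "\<forall>\<^sub>F s in at_top. l / 2 * ((1 - \<epsilon>) / 2) \<le> c * (real (card (Z \<inter> G s)) / measure m (G s))"
    using ev1 ev2 ev3
  proof eventually_elim
    case (elim s)
    have s: "s - \<delta> > 0" "s - \<delta> > \<tau>" "s > 0" using elim(3) \<delta>(1) by linarith+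
    have Gp: "measure m (G s) > 0" by (rule G(3)[OF s(3)])
    have "l / 2 * ((1 - \<epsilon>) / 2) \<le> window_average m G translate \<phi> (s - \<delta>) Z * (measure m (G (s - \<delta>)) / measure m (G s))"
      using elim l(1) \<delta>(2) by (intro mult_mono) auto
    also have "\<dots> = window_average m G translate \<phi> (s - \<delta>) Z * measure m (G (s - \<delta>)) / measure m (G s)" by simp
    also have "\<dots> \<le> c * real (card (Z \<inter> G (s - \<delta> + \<delta>))) / measure m (G s)"
      using avg[OF s(1,2)] Gp by (intro divide_right_mono) simp_all
    finally show ?case by simp
  qed
  \<comment> \<open>If c were 0, the inequality in \<open>main\<close> would bound a positive
    constant by 0; positivity of c comes from that of the limit.\<close>
  have cpos: "c > 0"
  proof (rule ccontr)
    assume "\<not> c > 0"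
    then have "c = 0" unfolding c_def using measure_nonneg[of m "N 0"] by simp
    have "\<forall>\<^sub>F s in (at_top :: real filter). l / 2 * ((1 - \<epsilon>) / 2) \<le> 0"
      using main by (rule eventually_mono) (simp only: \<open>c = 0\<close> mult_zero_left)
    from eventually_happens'[OF trivial_limit_at_top_linorder this]
    have "l / 2 * ((1 - \<epsilon>) / 2) \<le> 0" by blast
    moreover have "l / 2 * ((1 - \<epsilon>) / 2) > 0" using l(1) \<delta>(2) by simp
    ultimately show False by linarith
  qed
  define k where "k = l / 2 * ((1 - \<epsilon>) / 2) / c"
  have k: "k > 0" unfolding k_def using cpos l(1) \<delta>(2) by simp
  have "\<forall>\<^sub>F s in at_top. ereal k \<le> ereal (real (card (Z \<inter> G s)) / measure m (G s))"
    using main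
  proof eventually_elim
    case (elim s)
    then have "k \<le> real (card (Z \<inter> G s)) / measure m (G s)"
      unfolding k_def pos_divide_le_eq[OF cpos] by (simp only: mult.commute[of c])
    then show ?case by simp
  qed
  then have "ereal k \<le> lower_density m G Z" unfolding lower_density_def by (rule Liminf_bounded)
  moreover have "0 < ereal k" using k by simp
  ultimately show ?thesis by (rule less_le_trans[rotated])
qed

end

section \<open>From the extremal measure to almost sure positivity of the averages\<close>

lemma emeasure_open_nonzero:
  fixes m :: "'g::{topological_group_add, second_countable_topology} measure"
  assumes m: "sets m = sets borel" "\<And>g. distr m m (\<lambda>x. x + g) = m" "emeasure m UNIV \<noteq> 0"
    and V: "open V" "0 \<in> V"
  shows "emeasure m V \<noteq> 0"
proof
  assume 0: "emeasure m V = 0"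
  let ?T = "\<lambda>g. (\<lambda>x. x + g) ` V"
  have op: "open (?T g)" for g by (rule open_translate_right[OF V(1)])
  have null: "?T g \<in> null_sets m" for g
  proof -
    have "?T g = {x. x + - g \<in> V}" unfolding image_add_right by auto
    then have "emeasure m (?T g) = 0"
      using distr_shift_emeasure[OF m(1,2), of V "- g"] V(1) 0 by simp
    then show ?thesis using op[of g] m(1) by (simp add: null_sets_def)
  qed
  have opens: "open W" if "W \<in> range ?T" for W using that op by (elim rangeE) (simp only:)
  obtain \<F> where F: "\<F> \<subseteq> range ?T" "countable \<F>" "\<Union>\<F> = \<Union>(range ?T)"
    using Lindelof[OF opens] by blast
  have "g \<in> ?T g" for g using V(2) by (intro image_eqI[of _ _ 0]) simp_all
  then have "\<Union>\<F> = UNIV" unfolding F(3) by blast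
  moreover have "(\<Union>W\<in>\<F>. W) \<in> null_sets m" using F(1,2) null by (intro null_sets_UN') blast+
  ultimately have "UNIV \<in> null_sets m" by simp
  then show False using m(3) null_setsD1 by blast
qed

context haar_return_measure
begin

lemma borel_action_translate: "borel_action XM translate"
  unfolding borel_action_def
  using measurable_translate_joint by (simp add: translate_translate)

text \<open>The normalised induced measure is an ergodic invariant probability measure under which
  hitting V has positive probability, so an invariant set inside \<open>Gd\<close> has full measure.
  \<open>induced_null_iff\<close> turns this into a statement about \<open>\<rho>\<close>, which is
  why an invariant set is required and not just \<open>Gd\<close>.\<close>

lemma AE_good:
  assumes ext: "\<And>D. D \<in> sets (pow_measurable L) \<Longrightarrow>
      (\<And>F c. finite F \<Longrightarrow> F \<subseteq> L \<Longrightarrow> F \<inter> \<Lambda> \<noteq> {} \<Longrightarrow> (\<lambda>x. x + c) ` F \<subseteq> L \<Longrightarrow>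
        (\<lambda>x. x + c) ` F \<inter> \<Lambda> \<noteq> {} \<Longrightarrow>
        emeasure \<rho> ({Z \<in> Pow L. (\<lambda>x. x + c) ` F \<subseteq> Z} \<inter> D) = emeasure \<rho> ({Z \<in> Pow L. F \<subseteq> Z} \<inter> D)) \<Longrightarrow>
      emeasure \<rho> D = 0 \<or> emeasure \<rho> (Pow L - D) = 0"
    and V: "open V" "0 \<in> V" and pos: "emeasure \<rho> S > 0"
    and good: "\<And>\<eta>. sets \<eta> = sets XM \<Longrightarrow> prob_space \<eta> \<Longrightarrow> (\<And>g. distr \<eta> \<eta> (translate g) = \<eta>) \<Longrightarrow>
      (\<And>A. A \<in> sets XM \<Longrightarrow> (\<And>g x. x \<in> X \<Longrightarrow> translate g x \<in> A \<longleftrightarrow> x \<in> A) \<Longrightarrow>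
        emeasure \<eta> A = 0 \<or> emeasure \<eta> (X - A) = 0) \<Longrightarrow>
      (\<integral>y. (indicator {Q. Q \<inter> V \<noteq> {}} y :: real) \<partial>\<eta>) > 0 \<Longrightarrow>
      \<exists>E\<in>sets XM. E \<subseteq> Gd \<and> (\<forall>g. \<forall>x\<in>X. translate g x \<in> E \<longleftrightarrow> x \<in> E) \<and> emeasure \<eta> (X - E) = 0"
  shows "AE Z in \<rho>. Z \<in> S \<longrightarrow> Z \<in> Gd"
proof -
  let ?h = "{Z \<in> space XM. Z \<inter> V \<noteq> {}}"
  have hs: "?h \<in> sets XM" by (rule sets_borel_of_hit[OF V(1)])
  have hpos: "emeasure induced ?h \<noteq> 0" by (rule induced_hit_pos[OF V pos])
  have "emeasure induced ?h \<le> emeasure induced X"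
    using hs sets.top[of XM] space_XM by (intro emeasure_mono) auto
  then have tot: "emeasure induced X \<noteq> 0" using hpos by auto
  define c where "c = inverse (emeasure induced X)"
  have c: "c \<noteq> 0" "c * emeasure induced X = 1"
  proof -
    show "c \<noteq> 0" unfolding c_def using induced_finite by simp
    have "c * emeasure induced X = emeasure induced X / emeasure induced X"
      unfolding c_def by (simp add: divide_ennreal_def mult.commute)
    then show "c * emeasure induced X = 1" using tot induced_finite by simp
  qed
  define \<eta> where "\<eta> = density induced (\<lambda>_. c)"
  have \<eta>s: "sets \<eta> = sets XM" unfolding \<eta>_def by simp
  have \<eta>e: "emeasure \<eta> A = c * emeasure induced A" if "A \<in> sets XM" for A
    unfolding \<eta>_def using that by (intro emeasure_density_const) simp
  have XX: "X \<in> sets XM" using sets.top[of XM] space_XM by simp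
  have sp\<eta>: "space \<eta> = X" using sets_eq_imp_space_eq[OF \<eta>s] space_XM by simp
  have p: "prob_space \<eta>" by (rule prob_spaceI) (simp add: sp\<eta> \<eta>e[OF XX] c)
  have inv: "distr \<eta> \<eta> (translate g) = \<eta>" for g
  proof (rule measure_eqI)
    fix A assume "A \<in> sets (distr \<eta> \<eta> (translate g))"
    then have A: "A \<in> sets XM" using \<eta>s by simp
    have tr: "translate g \<in> \<eta> \<rightarrow>\<^sub>M \<eta>" "translate g \<in> induced \<rightarrow>\<^sub>M induced"
      using measurable_translate_XM \<eta>s by (simp_all cong: measurable_cong_sets)
    have pre: "translate g -` A \<inter> X \<in> sets XM"
      using measurable_sets[OF measurable_translate_XM A] space_XM by simp
    have "emeasure (distr \<eta> \<eta> (translate g)) A = emeasure \<eta> (translate g -` A \<inter> X)"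
      using A \<eta>s by (subst emeasure_distr[OF tr(1)]) (simp_all add: sp\<eta>)
    also have "\<dots> = c * emeasure (distr induced induced (translate g)) A"
      using A unfolding \<eta>e[OF pre] by (subst emeasure_distr[OF tr(2)]) (simp_all add: space_induced)
    finally show "emeasure (distr \<eta> \<eta> (translate g)) A = emeasure \<eta> A"
      unfolding induced_invariant \<eta>e[OF A] .
  qed simp
  have erg: "emeasure \<eta> A = 0 \<or> emeasure \<eta> (X - A) = 0"
    if A: "A \<in> sets XM" "\<And>g x. x \<in> X \<Longrightarrow> translate g x \<in> A \<longleftrightarrow> x \<in> A" for A
  proof -
    have "X - A \<in> sets XM" using XX A(1) by (rule sets.Diff)
    then show ?thesis using induced_ergodic[OF ext A] \<eta>e A(1) by auto
  qed
  interpret \<eta>: prob_space \<eta> by (rule p)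
  have "(\<integral>y. (indicator {Q. Q \<inter> V \<noteq> {}} y :: real) \<partial>\<eta>) = (\<integral>y. indicator ?h y \<partial>\<eta>)"
    by (rule Bochner_Integration.integral_cong) (simp_all add: sp\<eta> space_XM indicator_def)
  also have "\<dots> = measure \<eta> ?h" using hs \<eta>s sets.sets_into_space[OF hs] by (simp add: sp\<eta> space_XM inf.absorb1)
  also have "\<dots> > 0"
  proof -
    have "emeasure \<eta> ?h \<noteq> 0" using \<eta>e[OF hs] hpos c(1) by simp
    then show ?thesis using \<eta>.emeasure_eq_measure[of ?h] measure_nonneg[of \<eta> ?h] by (simp add: less_le)
  qed
  finally obtain E where E: "E \<in> sets XM" "E \<subseteq> Gd" "\<And>g x. x \<in> X \<Longrightarrow> translate g x \<in> E \<longleftrightarrow> x \<in> E"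
    "emeasure \<eta> (X - E) = 0"
    using good[OF \<eta>s p inv erg] by blast
  have XE: "X - E \<in> sets XM" using XX E(1) by (rule sets.Diff)
  have XEinv: "translate k Z \<in> X - E \<longleftrightarrow> Z \<in> X - E" if "Z \<in> X" for k Z using E(3)[OF that] that by simp
  have "emeasure induced (X - E) = 0" using E(4) \<eta>e[OF XE] c(1) by simp
  then have "AE Z in \<rho>. Z \<in> S \<longrightarrow> Z \<notin> X - E" by (intro iffD1[OF induced_null_iff[OF XE XEinv]])
  then show ?thesis by (rule AE_mp) (rule AE_I2, use S_D(2) E(2) in auto)
qed

end

text \<open>A closed set is determined by the basic open sets that it hits, that is, by a set of
  natural numbers, and there are as many of these as reals.\<close>

lemma closed_sets_inject_reals:
  fixes X :: "'g::second_countable_topology set set"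
  assumes "\<And>Z. Z \<in> X \<Longrightarrow> closed Z"
  obtains J :: "'g set \<Rightarrow> real" where "inj_on J X"
proof -
  obtain \<B> :: "'g set set" where \<B>: "countable \<B>" "topological_basis \<B>"
    using ex_countable_basis by blast
  obtain f :: "nat set \<Rightarrow> real" where f: "bij f"
    using nat_sets_eqpoll_reals unfolding eqpoll_def by blast
  define k where "k Z = to_nat_on \<B> ` {V \<in> \<B>. Z \<inter> V \<noteq> {}}" for Z
  have "inj_on (f \<circ> k) X"
  proof (rule inj_onI)
    fix Z Y assume ZY: "Z \<in> X" "Y \<in> X" "(f \<circ> k) Z = (f \<circ> k) Y"
    then have "k Z = k Y" using f by (simp add: bij_def inj_eq)
    then have eq: "{V \<in> \<B>. Z \<inter> V \<noteq> {}} = {V \<in> \<B>. Y \<inter> V \<noteq> {}}"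
      unfolding k_def using inj_on_image_eq_iff[OF inj_on_to_nat_on[OF \<B>(1)]] by auto
    have sub: "A \<subseteq> A'" if A: "closed A'" "\<And>V. V \<in> \<B> \<Longrightarrow> A \<inter> V \<noteq> {} \<Longrightarrow> A' \<inter> V \<noteq> {}" for A A'
    proof (rule ccontr)
      assume "\<not> A \<subseteq> A'"
      then obtain x where x: "x \<in> A" "x \<in> - A'" by blast
      obtain V where V: "V \<in> \<B>" "x \<in> V" "V \<subseteq> - A'"
        using topological_basisE[OF \<B>(2) open_Compl[OF A(1)] x(2)] .
      then show False using A(2)[OF V(1)] x by blast
    qed
    have iff: "Z \<inter> V \<noteq> {} \<longleftrightarrow> Y \<inter> V \<noteq> {}" if "V \<in> \<B>" for V
      using eq that by auto
    show "Z = Y"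
    proof (rule equalityI)
      show "Z \<subseteq> Y" by (rule sub[OF assms[OF ZY(2)]]) (simp add: iff)
      show "Y \<subseteq> Z" by (rule sub[OF assms[OF ZY(1)]]) (simp add: iff)
    qed
  qed
  then show ?thesis by (rule that)
qed

text \<open>Relative density is used only to make P nonempty, which puts 0 into its difference
  set.\<close>

lemma return_set_difference_set:
  fixes P :: "'g::{topological_group_add, second_countable_topology, t2_space} set"
  assumes "relatively_dense (difference_set P)"
    and "uniformly_discrete (difference_set P + difference_set P + difference_set P)"
  shows "return_set (difference_set P)"
proof
  obtain K :: "'g set" where "K + difference_set P = UNIV"
    using assms(1) unfolding relatively_dense_def by blast
  then have "(0::'g) \<in> K + difference_set P" by simp
  then have "difference_set P \<noteq> {}" by (auto elim: set_plus_elim)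
  then obtain a where "a \<in> P" unfolding difference_set_def by blast
  then have "a - a \<in> difference_set P" by (intro difference_setI)
  then show "0 \<in> difference_set P" by simp
  fix x assume "x \<in> difference_set P"
  then obtain a b where "x = a - b" "a \<in> P" "b \<in> P" unfolding difference_set_def by blast
  then show "- x \<in> difference_set P" using difference_setI[of b P a] by simp
qed fact

theorem theorem1p2:
  fixes m :: "'g::{topological_group_add, second_countable_topology, t2_space} measure"
    and P\<^sub>o \<Lambda> :: "'g set"
    and \<mu> \<nu> :: "'g set measure"
    and r :: nat
    and G :: "real \<Rightarrow> 'g set"
  assumes "locally_compact_space (euclidean :: 'g topology)"
    and "\<not> compact (UNIV :: 'g set)"
    and "unimodular TYPE('g)"
    and "left_haar_measure m"
    and "\<Lambda> = difference_set P\<^sub>o"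
    and "relatively_dense \<Lambda>"
    and "uniformly_discrete (\<Lambda> + \<Lambda> + \<Lambda>)"
    and "sets \<mu> = sets (borel_punctured_hull P\<^sub>o)"
    and "prob_space \<mu>"
    and "invariant_measure translate \<mu>"
    and "is_transverse_measure m P\<^sub>o \<mu> \<nu>"
    and "r \<ge> 1"
    and "convenient_sequence m G"
  shows "AE Q in (\<Pi>\<^sub>M i\<in>{1..r}. \<nu>). lower_density m G (\<Inter>i\<in>{1..r}. Q i) > 0"
proof -
  note lc = assms(1)
  have P0: "difference_set P\<^sub>o = \<Lambda>" using assms(5) by simp
  interpret return_set \<Lambda>
    by (rule return_set_difference_set[of P\<^sub>o, unfolded P0, OF assms(6,7)])
  have m: "sets m = sets borel" "emeasure m UNIV \<noteq> 0" "\<And>C. compact C \<Longrightarrow> emeasure m C < \<infinity>"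
    "\<And>g. distr m m (\<lambda>x. g + x) = m"
    using assms(4) unfolding left_haar_measure_def by simp_all
  have m_right: "distr m m (\<lambda>x. x + g) = m" for g
    using assms(3,4) unfolding unimodular_def by simp
  obtain K where K: "compact K" "K + \<Lambda> = UNIV" using assms(6) unfolding relatively_dense_def by blast
  have haar: "haar_return_measure \<Lambda> \<rho> m K" if "return_measure \<Lambda> \<rho>" for \<rho>
    by (intro haar_return_measure.intro haar_return_measure_axioms.intro that lc m m_right K)
  have mB: "emeasure m B \<noteq> 0" by (rule emeasure_open_nonzero[OF m(1) m_right m(2) B(1,2)])
  obtain \<rho> where \<rho>: "sets \<rho> = sets (pow_measurable L)" "prob_space \<rho>"
    "\<And>a c. a \<in> L \<Longrightarrow> c \<in> L \<Longrightarrow> a - c \<notin> \<Lambda> \<Longrightarrow> emeasure \<rho> {Z \<in> Pow L. {a, c} \<subseteq> Z} = 0"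
    "\<And>F c. finite F \<Longrightarrow> F \<subseteq> L \<Longrightarrow> F \<inter> \<Lambda> \<noteq> {} \<Longrightarrow> (\<lambda>x. x + c) ` F \<subseteq> L \<Longrightarrow>
      (\<lambda>x. x + c) ` F \<inter> \<Lambda> \<noteq> {} \<Longrightarrow>
      emeasure \<rho> {Z \<in> Pow L. (\<lambda>x. x + c) ` F \<subseteq> Z} = emeasure \<rho> {Z \<in> Pow L. F \<subseteq> Z}"
    and AE_Inter: "\<And>A. A \<in> sets (pow_measurable L) \<Longrightarrow> A \<subseteq> {Z. 0 \<in> Z} \<Longrightarrow> emeasure \<rho> A = 0 \<Longrightarrow>
      AE Q in (\<Pi>\<^sub>M i\<in>{1..r}. \<nu>). (\<Inter>i\<in>{1..r}. Q i) \<notin> A"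
  proof (rule exists_intersection_measure[OF P0 m(1) m_right mB assms(8,9,11,12)], goal_cases)
    case (1 \<rho>)
    show ?case by (rule 1(1)[of \<rho>]) (fact 1)+
  qed
  interpret R: haar_return_measure \<Lambda> \<rho> m K
    by (intro haar return_measure.intro return_set_axioms return_measure_axioms.intro) (fact \<rho>)+
  note conv = assms(13)[unfolded convenient_sequence_def]
  have G: "\<And>t. t > 0 \<Longrightarrow> G t \<in> sets borel" "\<And>t. t > 0 \<Longrightarrow> compact (closure (G t))"
    "\<And>t. t > 0 \<Longrightarrow> measure m (G t) > 0"
    using conjunct1[OF conv] by simp_all
  obtain Vs where "(\<forall>n. open (Vs n) \<and> 0 \<in> Vs n) \<and> decseq Vs \<and> boundary_regular m G Vs"
    using conjunct1[OF conjunct2[OF conv]] by (elim exE)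
  then have Vs: "\<And>n. open (Vs n)" "\<And>n. 0 \<in> Vs n" "boundary_regular m G Vs" by simp_all
  obtain \<delta> \<epsilon> \<tau> :: "nat \<Rightarrow> real" where br: "(\<forall>n. \<delta> n > 0 \<and> \<epsilon> n > 0 \<and> \<tau> n > 0) \<and>
        \<delta> \<longlonglongrightarrow> 0 \<and> \<epsilon> \<longlonglongrightarrow> 0 \<and>
        (\<forall>n.
          (\<forall>t>\<tau> n. G (t - \<delta> n) \<subseteq> inner_set (Vs n) (G t) \<and>
                    inner_set (Vs n) (G t) \<subseteq> outer_set (Vs n) (G t) \<and>
                    outer_set (Vs n) (G t) \<subseteq> G (t + \<delta> n)) \<and>
          ereal (1 - \<epsilon> n) \<le> Liminf at_top (\<lambda>t. ereal (measure m (G (t - \<delta> n)) / measure m (G t))) \<and>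
          Limsup at_top (\<lambda>t. ereal (measure m (G (t + \<delta> n)) / measure m (G t))) \<le> ereal (1 + \<epsilon> n))"
    using Vs(3) unfolding boundary_regular_def by (elim exE)
  then have \<delta>: "\<And>n. \<delta> n > 0" and \<epsilon>: "\<epsilon> \<longlonglongrightarrow> 0"
    and outer: "\<And>n t. t > \<tau> n \<Longrightarrow> outer_set (Vs n) (G t) \<subseteq> G (t + \<delta> n)"
    and lim: "\<And>n. ereal (1 - \<epsilon> n) \<le> Liminf at_top (\<lambda>t. ereal (measure m (G (t - \<delta> n)) / measure m (G t)))"
    by simp_all
  have "\<forall>\<^sub>F n in sequentially. \<epsilon> n < 1" by (rule order_tendstoD(2)[OF \<epsilon>]) simp
  \<comment> \<open>Only positivity of the density is claimed, so a single level n with a nontrivial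
    volume bound is enough.\<close>
  then obtain n where n: "\<epsilon> n < 1" by (auto simp: eventually_sequentially)
  obtain W0 C where W0: "open W0" "compact C" "(0::'g) \<in> W0" "W0 \<subseteq> C" "C \<subseteq> UNIV"
    using compact_neighbourhood_within[OF lc open_UNIV UNIV_I] .
  \<comment> \<open>The inverse appears because \<open>outer_set\<close> moves by - v. The bounded
    neighbourhood \<open>W0\<close> keeps the Haar measure of the inverse of V finite.\<close>
  define V where "V = uminus -` (Vs n \<inter> W0)"
  have V: "open V" "0 \<in> V" "\<And>v. v \<in> V \<Longrightarrow> - v \<in> Vs n"
    unfolding V_def using Vs(1,2)[of n] W0 by (auto intro!: open_vimage continuous_intros)
  have "{g. - g \<in> V} \<subseteq> C" unfolding V_def using W0(4) by auto
  then have "emeasure m {g. - g \<in> V} \<le> emeasure m C"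
    using m(1) borel_compact[OF W0(2)] by (intro emeasure_mono) auto
  then have Vfin: "emeasure m {g. - g \<in> V} < \<infinity>" using m(3)[OF W0(2)] by (rule le_less_trans)
  let ?T = "subtopology chabauty_fell X"
  have tT: "topspace ?T = X" using R.space_XM by (simp add: space_borel_of)
  obtain J :: "'g set \<Rightarrow> real" where J: "inj_on J X" using closed_sets_inject_reals[OF X_closed] .
  let ?\<phi> = "indicator {Q. Q \<inter> V \<noteq> {}} :: 'g set \<Rightarrow> real"
  have \<phi>: "?\<phi> \<in> borel_measurable (borel_of ?T)"
  proof -
    have "{Q. Q \<inter> V \<noteq> {}} \<inter> space (borel_of ?T) = {Z \<in> space (borel_of ?T). Z \<inter> V \<noteq> {}}" by auto
    then show ?thesis using sets_borel_of_hit[OF V(1), of X] by (simp add: borel_measurable_indicator_iff)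
  qed
  have J': "inj_on J (topspace ?T)" unfolding tT by (rule J)
  have \<phi>b: "\<bar>?\<phi> x\<bar> \<le> 1" for x by (simp add: indicator_def)
  obtain Gd where Gd: "Gd \<in> sets (borel_of ?T)"
    "\<And>x. x \<in> Gd \<Longrightarrow> \<exists>l>0. ((\<lambda>t. window_average m G translate ?\<phi> t x) \<longlongrightarrow> l) at_top"
    and good: "\<And>\<eta>. sets \<eta> = sets (borel_of ?T) \<Longrightarrow> prob_space \<eta> \<Longrightarrow> (\<And>g. distr \<eta> \<eta> (translate g) = \<eta>) \<Longrightarrow>
      (\<And>A. A \<in> sets (borel_of ?T) \<Longrightarrow> (\<And>g x. x \<in> X \<Longrightarrow> translate g x \<in> A \<longleftrightarrow> x \<in> A) \<Longrightarrow>
        emeasure \<eta> A = 0 \<or> emeasure \<eta> (X - A) = 0) \<Longrightarrow>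
      (\<integral>y. ?\<phi> y \<partial>\<eta>) > 0 \<Longrightarrow>
      \<exists>E\<in>sets (borel_of ?T). E \<subseteq> Gd \<and> (\<forall>g. \<forall>x\<in>X. translate g x \<in> E \<longleftrightarrow> x \<in> E) \<and>
        emeasure \<eta> (X - E) = 0"
  proof (rule convenient_sequence_good_set[OF assms(13)
      standard_borel_closedin_chabauty_fell[OF lc closedin_X] J' R.borel_action_translate \<phi> \<phi>b,
      unfolded tT], goal_cases)
    case (1 Gd)
    show ?case by (rule 1(1)[of Gd]) (fact 1)+
  qed
  \<comment> \<open>The bad set, cut down to sets containing 0, since only for these does
    \<open>\<rho>\<close> control the null sets of the product measure.\<close>
  define A where "A = {Z \<in> Pow L. Z \<in> X \<and> Z \<in> X - Gd} \<inter> {Z \<in> Pow L. 0 \<in> Z}"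
  have XGd: "X - Gd \<in> sets (borel_of ?T)" using sets.compl_sets[OF Gd(1)] R.space_XM by simp
  have A: "A \<in> sets (pow_measurable L)"
    unfolding A_def by (intro sets.Int R.sets_trace[OF XGd] sets_pow_measurable_mem)
  have AS: "A \<subseteq> S" unfolding A_def using S_I zero_mem by blast
  have "emeasure \<rho> A = 0"
  proof (rule ccontr)
    assume "emeasure \<rho> A \<noteq> 0"
    then have mA: "measure \<rho> A > 0" by (simp add: R.emeasure_eq_measure less_le)
    \<comment> \<open>Both properties of \<open>\<rho>\<close> are written as equalities of
      probabilities of clopen sets, as the extremal construction requires: \<open>R1\<close> is the
      partial shift invariance, and \<open>R2\<close>, by comparison with the empty event, says that
      \<open>\<rho>\<close> is carried by \<open>X\<close>.\<close>
    define R1 where "R1 = {({Z \<in> Pow L. (\<lambda>x. x + c) ` F \<subseteq> Z}, {Z \<in> Pow L. F \<subseteq> Z}) | F c.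
      finite F \<and> F \<subseteq> L \<and> F \<inter> \<Lambda> \<noteq> {} \<and> (\<lambda>x. x + c) ` F \<subseteq> L \<and> (\<lambda>x. x + c) ` F \<inter> \<Lambda> \<noteq> {}}"
    define R2 where "R2 = {({Z \<in> Pow L. {a, c} \<subseteq> Z}, {} :: 'g set set) | a c. a \<in> L \<and> c \<in> L \<and> a - c \<notin> \<Lambda>}"
    have Rsub: "R1 \<union> R2 \<subseteq> clopens L \<times> clopens L"
      unfolding R1_def R2_def by (auto simp only: clopens_cylinder clopens_empty finite.intros finite_imageI)
    have inv: "measure \<rho> Y1 = measure \<rho> Y2" if Y: "(Y1, Y2) \<in> R1 \<union> R2" for Y1 Y2
      using Y
    proof
      assume "(Y1, Y2) \<in> R1"
      then obtain F c where F: "Y1 = {Z \<in> Pow L. (\<lambda>x. x + c) ` F \<subseteq> Z}" "Y2 = {Z \<in> Pow L. F \<subseteq> Z}"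
        "finite F" "F \<subseteq> L" "F \<inter> \<Lambda> \<noteq> {}" "(\<lambda>x. x + c) ` F \<subseteq> L" "(\<lambda>x. x + c) ` F \<inter> \<Lambda> \<noteq> {}"
        unfolding R1_def by blast
      show ?thesis unfolding measure_def F(1,2) \<rho>(4)[OF F(3-7)] ..
    next
      assume "(Y1, Y2) \<in> R2"
      then obtain a c where Y: "Y1 = {Z \<in> Pow L. {a, c} \<subseteq> Z}" "Y2 = {}" "a \<in> L" "c \<in> L" "a - c \<notin> \<Lambda>"
        unfolding R2_def by blast
      show ?thesis unfolding measure_def Y(1,2) \<rho>(3)[OF Y(3-5)] emeasure_empty ..
    qed
    obtain \<rho>' where \<rho>': "sets \<rho>' = sets (pow_measurable L)" "prob_space \<rho>'"
      "\<And>Y1 Y2. (Y1, Y2) \<in> R1 \<union> R2 \<Longrightarrow> measure \<rho>' Y1 = measure \<rho>' Y2" "measure \<rho>' A > 0"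
      and ext: "\<And>D. D \<in> sets (pow_measurable L) \<Longrightarrow>
        (\<And>Y1 Y2. (Y1, Y2) \<in> R1 \<union> R2 \<Longrightarrow> measure \<rho>' (Y1 \<inter> D) = measure \<rho>' (Y2 \<inter> D)) \<Longrightarrow>
        measure \<rho>' D = 0 \<or> measure \<rho>' D = 1"
    proof (rule exists_extremal_measure[OF countable_return(2) Rsub \<rho>(1,2) _ A mA], goal_cases)
      case (1 Y1 Y2)
      show ?case by (rule inv) (rule 1(2))
    next
      case (2 \<rho>')
      show ?case by (rule 2(1)[of \<rho>']) (fact 2)+
    qed
    interpret \<rho>': prob_space \<rho>' by (rule \<rho>'(2))
    have e0: "emeasure \<rho>' {Z \<in> Pow L. {a, c} \<subseteq> Z} = 0" if "a \<in> L" "c \<in> L" "a - c \<notin> \<Lambda>" for a c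
    proof -
      have "({Z \<in> Pow L. {a, c} \<subseteq> Z}, {}) \<in> R1 \<union> R2" using that unfolding R2_def by blast
      then have "measure \<rho>' {Z \<in> Pow L. {a, c} \<subseteq> Z} = measure \<rho>' {}" by (rule \<rho>'(3))
      then show ?thesis by (simp only: \<rho>'.emeasure_eq_measure measure_empty ennreal_0)
    qed
    have R1I: "({Z \<in> Pow L. (\<lambda>x. x + c) ` F \<subseteq> Z}, {Z \<in> Pow L. F \<subseteq> Z}) \<in> R1 \<union> R2"
      if "finite F" "F \<subseteq> L" "F \<inter> \<Lambda> \<noteq> {}" "(\<lambda>x. x + c) ` F \<subseteq> L" "(\<lambda>x. x + c) ` F \<inter> \<Lambda> \<noteq> {}" for F c
      using that unfolding R1_def by blast
    have e1: "emeasure \<rho>' {Z \<in> Pow L. (\<lambda>x. x + c) ` F \<subseteq> Z} = emeasure \<rho>' {Z \<in> Pow L. F \<subseteq> Z}"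
      if F: "finite F" "F \<subseteq> L" "F \<inter> \<Lambda> \<noteq> {}" "(\<lambda>x. x + c) ` F \<subseteq> L" "(\<lambda>x. x + c) ` F \<inter> \<Lambda> \<noteq> {}" for F c
      unfolding \<rho>'.emeasure_eq_measure \<rho>'(3)[OF R1I[OF F]] ..
    interpret R': haar_return_measure \<Lambda> \<rho>' m K
      by (intro haar return_measure.intro return_set_axioms return_measure_axioms.intro) (fact \<rho>' e0 e1)+
    have cm: "{Z \<in> Pow L. {a, c} \<subseteq> Z} \<in> sets \<rho>'" for a c
      unfolding \<rho>'(1) by (rule cylinder_measurable) simp
    have ext': "emeasure \<rho>' D = 0 \<or> emeasure \<rho>' (Pow L - D) = 0"
      if D: "D \<in> sets (pow_measurable L)" and eq: "\<And>F c. finite F \<Longrightarrow> F \<subseteq> L \<Longrightarrow> F \<inter> \<Lambda> \<noteq> {} \<Longrightarrow>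
        (\<lambda>x. x + c) ` F \<subseteq> L \<Longrightarrow> (\<lambda>x. x + c) ` F \<inter> \<Lambda> \<noteq> {} \<Longrightarrow>
        emeasure \<rho>' ({Z \<in> Pow L. (\<lambda>x. x + c) ` F \<subseteq> Z} \<inter> D) = emeasure \<rho>' ({Z \<in> Pow L. F \<subseteq> Z} \<inter> D)" for D
    proof -
      have "measure \<rho>' D = 0 \<or> measure \<rho>' D = 1"
      proof (rule ext[OF D])
        fix Y1 Y2 assume "(Y1, Y2) \<in> R1 \<union> R2"
        then show "measure \<rho>' (Y1 \<inter> D) = measure \<rho>' (Y2 \<inter> D)"
        proof
          assume "(Y1, Y2) \<in> R1"
          then obtain F c where F: "Y1 = {Z \<in> Pow L. (\<lambda>x. x + c) ` F \<subseteq> Z}" "Y2 = {Z \<in> Pow L. F \<subseteq> Z}"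
            "finite F" "F \<subseteq> L" "F \<inter> \<Lambda> \<noteq> {}" "(\<lambda>x. x + c) ` F \<subseteq> L" "(\<lambda>x. x + c) ` F \<inter> \<Lambda> \<noteq> {}"
            unfolding R1_def by blast
          show ?thesis unfolding measure_def F(1,2) eq[OF F(3-7)] ..
        next
          assume "(Y1, Y2) \<in> R2"
          then obtain a c where Y: "Y1 = {Z \<in> Pow L. {a, c} \<subseteq> Z}" "Y2 = {}" "a \<in> L" "c \<in> L" "a - c \<notin> \<Lambda>"
            unfolding R2_def by blast
          \<comment> \<open>The pairs in \<open>R2\<close> impose no condition on D, as their first
            members are already null.\<close>
          have "measure \<rho>' (Y1 \<inter> D) \<le> measure \<rho>' Y1"
            using cm unfolding Y(1) by (intro \<rho>'.finite_measure_mono) auto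
          moreover have "measure \<rho>' Y1 = 0" using e0[OF Y(3-5)] unfolding Y(1) measure_def by simp
          ultimately show ?thesis using measure_nonneg[of \<rho>' "Y1 \<inter> D"] Y(2) by simp
        qed
      qed
      moreover have "measure \<rho>' (Pow L - D) = 1 - measure \<rho>' D"
        using \<rho>'.prob_compl[of D] D \<rho>'(1) R'.space_\<rho> by simp
      ultimately show ?thesis by (auto simp: \<rho>'.emeasure_eq_measure)
    qed
    have "measure \<rho>' A \<le> measure \<rho>' S"
      using AS R'.sets_rho_S by (intro \<rho>'.finite_measure_mono) auto
    then have Spos: "emeasure \<rho>' S > 0" using \<rho>'(4) by (simp add: \<rho>'.emeasure_eq_measure)
    \<comment> \<open>This contradicts the positive mass of A, as \<open>Gd\<close> and hence A were
      fixed before \<open>\<rho>'\<close> was chosen.\<close>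
    have "AE Z in \<rho>'. Z \<in> S \<longrightarrow> Z \<in> Gd"
      by (rule R'.AE_good[OF _ V(1,2) Spos]) (fact ext' good)+
    then have "AE Z in \<rho>'. Z \<notin> A"
      by (rule AE_mp) (rule AE_I2, use AS in \<open>auto simp: A_def\<close>)
    then have "emeasure \<rho>' A = 0"
    proof (subst (asm) AE_iff_measurable)
      show "A \<in> sets \<rho>'" using A \<rho>'(1) by simp
      show "{x \<in> space \<rho>'. \<not> x \<notin> A} = A" unfolding R'.space_\<rho> A_def by auto
    qed
    then show False using \<rho>'(4) by (simp add: measure_def)
  qed
  then have "AE Q in (\<Pi>\<^sub>M i\<in>{1..r}. \<nu>). (\<Inter>i\<in>{1..r}. Q i) \<notin> A"
    by (intro AE_Inter A) (auto simp: A_def)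
  then show ?thesis
  proof (rule AE_mp, intro AE_I2 impI)
    fix Q assume Q: "Q \<in> space (\<Pi>\<^sub>M i\<in>{1..r}. \<nu>)" "(\<Inter>i\<in>{1..r}. Q i) \<notin> A"
    let ?Z = "\<Inter>i\<in>{1..r}. Q i"
    have \<nu>s: "sets \<nu> = sets (borel_transversal P\<^sub>o)" using assms(11) unfolding is_transverse_measure_def by blast
    have sp: "space \<nu> \<subseteq> transversal P\<^sub>o"
      using sets_eq_imp_space_eq[OF \<nu>s] unfolding borel_transversal_def space_borel_of_fell by blast
    have Qi: "Q i \<in> X" "0 \<in> Q i" if "i \<in> {1..r}" for i
    proof -
      have "Q i \<in> transversal P\<^sub>o" using Q(1) that sp by (auto simp: space_PiM PiE_def Pi_def)
      then show "Q i \<in> X" "0 \<in> Q i" using orbit_hull_subset[OF P0] unfolding transversal_def by auto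
    qed
    have 1: "1 \<in> {1..r}" using assms(12) by simp
    have "?Z \<subseteq> Q 1" using 1 by blast
    then have ZX: "?Z \<in> X" using Qi(1)[OF 1] X_subset by blast
    have Z0: "0 \<in> ?Z" using Qi(2) by blast
    have "?Z \<subseteq> L" using X_subset_L[OF ZX Z0 zero_mem] .
    then have "?Z \<in> Gd" using Q(2) ZX Z0 unfolding A_def by blast
    then obtain l where l: "l > 0" "((\<lambda>t. window_average m G translate ?\<phi> t ?Z) \<longlongrightarrow> l) at_top"
      using Gd(2) by blast
    show "lower_density m G ?Z > 0"
      using lower_density_pos[OF m(1) m_right m(3) G \<delta> n outer lim V(1,3) Vfin ZX l(1)] l(2) by simp
  qed
qed

end
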